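(* Let $\mathcal{D}\subset\mathbb{H}$ be open, bounded, connected and walk-regular, let $F:\partial\mathcal{D}\to\mathbb{R}$ be continuous, and let $u^\epsilon(q)=\mathbb{E}[F\circ Q^{\epsilon,q}]$ for $q\in\mathcal{D}$, $\epsilon\in(0,1)$. If for some sequence $\epsilon_i\to0+$ the functions $u^{\epsilon_i}$ converge uniformly to a function $u\in\mathcal{C}(\bar{\mathcal{D}})$ with $u=F$ on $\partial\mathcal{D}$, then $u$ solves the Dirichlet problem $$\Delta_{\mathbb{H}}u=0\ \text{ in }\mathcal{D},\qquad u=F\ \text{ on }\partial\mathcal{D}.$$ Moreover, the whole family $\{u^\epsilon\}_{\epsilon\to0}$ converges uniformly, as $\epsilon\to0$, to the unique solution $u\in\mathcal{C}^2(\mathcal{D})\cap\mathcal{C}(\bar{\mathcal{D}})$ of this problem.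
   Context: $\mathbb{H}=(\mathbb{R}^3,* )$ is the first Heisenberg group with $(x,y,z)*(x',y',z')=(x+x',y+y',z+z'+\frac12(xy'-yx'))$. The Korányi gauge is $|(x,y,z)|_K=((x^2+y^2)^2+16z^2)^{1/4}$, the metric is $d(q,q')=|q^{-1}*q'|_K$, $d(q,\partial\mathcal{D})$ is the distance to $\partial\mathcal{D}$ in this metric, and $B_r(q)=\{q'\in\mathbb{H}: d(q,q')<r\}$. With $X=\partial_x-\frac y2\partial_z$, $Y=\partial_y+\frac x2\partial_z$, set $\Delta_{\mathbb{H}}v=(X^2+Y^2)v$. Horizontal $\epsilon$-walk: let $w_1,w_2,\ldots$ be independent random variables, uniformly distributed on the Euclidean unit disc $B_1^2(0)\subset\mathbb{R}^2$ (on the countable product probability space $(\Omega,\mathcal{F},\mathbb{P})$ of the disc with normalized Lebesgue measure). For $q_0\in\mathcal{D}$ and $\epsilon\in(0,1)$ set $Q_0^{\epsilon,q_0}=q_0$ and, writing $w_n=(a_n,b_n)$ and $\lambda_{n-1}=\min\{\epsilon,d(Q^{\epsilon,q_0}_{n-1},\partial\mathcal{D})\}$, $$Q_n^{\epsilon,q_0}=Q_{n-1}^{\epsilon,q_0}*(\lambda_{n-1}a_n,\lambda_{n-1}b_n,0).$$ This sequence is a bounded martingale with values in $\mathcal{D}$, converging almost surely to a random variable $Q^{\epsilon,q_0}$ with values in $\partial\mathcal{D}$. A point $q_0\in\partial\mathcal{D}$ is walk-regular if for every $\eta,\delta>0$ there exist $\hat\delta\in(0,\delta)$ and $\hat\epsilon\in(0,1)$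 such that $\mathbb{P}(Q^{\epsilon,q}\in B_\delta(q_0))\ge1-\eta$ for all $\epsilon\in(0,\hat\epsilon)$ and all $q\in B_{\hat\delta}(q_0)\cap\mathcal{D}$. The domain $\mathcal{D}$ is walk-regular if every $q_0\in\partial\mathcal{D}$ is walk-regular. *)

theory Defs
  imports "HOL-Probability.Probability"
begin

text \<open>The Heisenberg group is \<open>\<real>\<^sup>3\<close>, so open, bounded, closure and frontier below are those of the
  product topology and metric; the Koranyi metric induces the same open and the same bounded sets.\<close>

type_synonym heis = "real \<times> real \<times> real"

fun hmul :: "heis \<Rightarrow> heis \<Rightarrow> heis" (infixl "\<star>" 70) where
  "(x, y, z) \<star> (x', y', z') = (x + x', y + y', z + z' + (x * y' - y * x') / 2)"

fun hinv :: "heis \<Rightarrow> heis" where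
  "hinv (x, y, z) = (- x, - y, - z)"

fun koranyi :: "heis \<Rightarrow> real" where
  "koranyi (x, y, z) = root 4 ((x\<^sup>2 + y\<^sup>2)\<^sup>2 + 16 * z\<^sup>2)"

definition hdist :: "heis \<Rightarrow> heis \<Rightarrow> real" where
  "hdist q q' = koranyi (hinv q \<star> q')"

definition hball :: "heis \<Rightarrow> real \<Rightarrow> heis set" where
  "hball q r = {q'. hdist q q' < r}"

definition hsetdist :: "heis \<Rightarrow> heis set \<Rightarrow> real" where
  "hsetdist q A = (INF p\<in>A. hdist q p)"


definition X_field :: "(heis \<Rightarrow> real) \<Rightarrow> heis \<Rightarrow> real" where
  "X_field v = (\<lambda>(x, y, z).
     deriv (\<lambda>s. v (s, y, z)) x - y / 2 * deriv (\<lambda>s. v (x, y, s)) z)"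

definition Y_field :: "(heis \<Rightarrow> real) \<Rightarrow> heis \<Rightarrow> real" where
  "Y_field v = (\<lambda>(x, y, z).
     deriv (\<lambda>s. v (x, s, z)) y + x / 2 * deriv (\<lambda>s. v (x, y, s)) z)"

definition hlaplacian :: "(heis \<Rightarrow> real) \<Rightarrow> heis \<Rightarrow> real" where
  "hlaplacian v q = X_field (X_field v) q + Y_field (Y_field v) q"

text \<open>Class \<open>C\<^sup>2\<close> on an open set, by continuous second Frechet derivatives in operator norm.\<close>

definition C2_on :: "'a::real_normed_vector set \<Rightarrow> ('a \<Rightarrow> 'b::real_normed_vector) \<Rightarrow> bool" where
  "C2_on S f \<longleftrightarrow> (\<exists>(f' :: 'a \<Rightarrow> 'a \<Rightarrow>\<^sub>L 'b) (f'' :: 'a \<Rightarrow> 'a \<Rightarrow>\<^sub>L 'a \<Rightarrow>\<^sub>L 'b).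
     (\<forall>x\<in>S. (f has_derivative blinfun_apply (f' x)) (at x)) \<and>
     (\<forall>x\<in>S. (f' has_derivative blinfun_apply (f'' x)) (at x)) \<and>
     continuous_on S f'')"

definition dirichlet_solution :: "heis set \<Rightarrow> (heis \<Rightarrow> real) \<Rightarrow> (heis \<Rightarrow> real) \<Rightarrow> bool" where
  "dirichlet_solution D F u \<longleftrightarrow>
     C2_on D u \<and> continuous_on (closure D) u \<and>
     (\<forall>q\<in>D. hlaplacian u q = 0) \<and> (\<forall>q\<in>frontier D. u q = F q)"


text \<open>The sample space: sequences of points of the plane, the complement of the unit disc being
  null in every coordinate. The coordinate \<open>\<omega> n\<close> is the \<open>(n+1)\<close>-st step, usually written
  \<open>w\<^sub>n\<^sub>+\<^sub>1\<close>.\<close>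

definition step_space :: "(nat \<Rightarrow> real \<times> real) measure" where
  "step_space = (\<Pi>\<^sub>M n\<in>UNIV. uniform_measure lborel (ball 0 1))"

primrec walk :: "heis set \<Rightarrow> real \<Rightarrow> heis \<Rightarrow> (nat \<Rightarrow> real \<times> real) \<Rightarrow> nat \<Rightarrow> heis" where
  "walk D \<epsilon> q \<omega> 0 = q"
| "walk D \<epsilon> q \<omega> (Suc n) =
     (let r = min \<epsilon> (hsetdist (walk D \<epsilon> q \<omega> n) (frontier D))
      in walk D \<epsilon> q \<omega> n \<star> (r * fst (\<omega> n), r * snd (\<omega> n), 0))"

text \<open>Almost every walk started in a bounded open set \<open>D\<close> converges to a point of the frontier;
  on the remaining null set \<open>exit_pt\<close> may be any point.\<close>

definition exit_pt :: "heis set \<Rightarrow> real \<Rightarrow> heis \<Rightarrow> (nat \<Rightarrow> real \<times> real) \<Rightarrow> heis" where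
  "exit_pt D \<epsilon> q \<omega> = lim (walk D \<epsilon> q \<omega>)"

text \<open>The boundary data \<open>F\<close> matter only on \<open>frontier D\<close>. The integral is restricted to the
  full-measure event that the exit point lies there, as otherwise values of \<open>F\<close> elsewhere could make
  the integrand non-measurable and the Bochner integral would be \<open>0\<close> by convention.\<close>

definition u_eps :: "heis set \<Rightarrow> (heis \<Rightarrow> real) \<Rightarrow> real \<Rightarrow> heis \<Rightarrow> real" where
  "u_eps D F \<epsilon> q =
     (LINT \<omega>:{\<omega>\<in>space step_space. exit_pt D \<epsilon> q \<omega> \<in> frontier D}|step_space. F (exit_pt D \<epsilon> q \<omega>))"

definition walk_regular_at :: "heis set \<Rightarrow> heis \<Rightarrow> bool" where
  "walk_regular_at D q\<^sub>0 \<longleftrightarrow>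
     (\<forall>\<eta>>0. \<forall>\<delta>>0. \<exists>\<delta>' \<epsilon>'. 0 < \<delta>' \<and> \<delta>' < \<delta> \<and> 0 < \<epsilon>' \<and> \<epsilon>' < 1 \<and>
        (\<forall>\<epsilon> q. 0 < \<epsilon> \<and> \<epsilon> < \<epsilon>' \<and> q \<in> hball q\<^sub>0 \<delta>' \<inter> D \<longrightarrow>
           measure step_space {\<omega>\<in>space step_space. exit_pt D \<epsilon> q \<omega> \<in> hball q\<^sub>0 \<delta>} \<ge> 1 - \<eta>))"

definition walk_regular :: "heis set \<Rightarrow> bool" where
  "walk_regular D \<longleftrightarrow> (\<forall>q\<^sub>0\<in>frontier D. walk_regular_at D q\<^sub>0)"

end

theory Submission
  imports Defs "HOL-Complex_Analysis.Great_Picard"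
begin

text \<open>Conditioning on the first step gives \<open>u_eps = disc_avg \<epsilon> u_eps\<close> away from the boundary. Since
  averaging over horizontal discs is symmetric for Lebesgue measure and
  \<open>disc_avg \<epsilon> \<phi> - \<phi> = c \<epsilon>\<^sup>2 hlaplacian \<phi> + o(\<epsilon>\<^sup>2)\<close> for smooth \<open>\<phi>\<close>, a uniform limit \<open>u\<close> is weakly
  harmonic. Testing with differences of regularized fundamental solutions shows that the averages of
  \<open>u\<close> against a left-translated, rescaled \<open>C\<^sup>2\<close> kernel do not depend on the scale; letting the scale
  tend to zero, \<open>u\<close> is itself such an average, hence \<open>C\<^sup>2\<close>, which replaces hypoellipticity, and then
  classically harmonic. For compactness, walk-regularity controls \<open>u_eps\<close> near the boundary, and the
  maximum principle for \<open>u_eps\<close> minus its left translates carries this control inside, giving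
  equicontinuity up to \<open>o(1)\<close>. Uniqueness in the Dirichlet problem identifies all subsequential
  limits.\<close>

subsection \<open>The Heisenberg group and the Koranyi distance\<close>

text \<open>The limit of \<open>u_eps\<close> inherits only a mean value property at scales
  shrinking to zero, so every derivative has to be placed on a test function or a kernel. Two kinds
  of translation make this work. A step of the walk is a right translation by a horizontal vector.
  It therefore commutes with left translations, which permits comparing \<open>u_eps\<close> with
  its left translates and moving any interior point to the origin. Right translations preserve
  Lebesgue measure, which makes averaging symmetric. The kernel comes from the radial chain rule:
  for \<open>t = kor4 p\<close>, a function \<open>k t\<close> has sub-Laplacian
  \<open>8 * hor2 p * (2 * t * k'' t + 3 * k' t)\<close>, and \<open>t powr (-1/2)\<close> solves
  the homogeneous equation. Replacing it by its Taylor polynomial of degree \<open>n\<close> for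
  \<open>t \<le> 1\<close> leaves a residual of order \<open>n - 1\<close> in \<open>1 - t\<close>.
  Degree four yields a cube, the least integer power whose truncation at zero is of class
  \<open>C\<^sup>2\<close>.\<close>

lemma hmul_eq:
  "p \<star> q = (fst p + fst q, fst (snd p) + fst (snd q),
     snd (snd p) + snd (snd q) + (fst p * fst (snd q) - fst (snd p) * fst q) / 2)"
  by (cases p; cases q) simp

lemma hinv_eq: "hinv p = - p"
  by (cases p) simp

lemma hmul_assoc: "p \<star> q \<star> r = p \<star> (q \<star> r)"
  by (simp add: hmul_eq field_simps)

lemma hmul_zero [simp]: "p \<star> 0 = p" "0 \<star> p = p"
  by (simp_all add: hmul_eq prod_eq_iff)

lemma hmul_hinv [simp]: "hinv p \<star> p = 0" "p \<star> hinv p = 0"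
  by (simp_all add: hmul_eq hinv_eq prod_eq_iff field_simps)

lemma hmul_hinv_cancel [simp]: "hinv p \<star> (p \<star> q) = q" "p \<star> (hinv p \<star> q) = q"
  by (simp_all flip: hmul_assoc)

lemma continuous_on_hmul [continuous_intros]:
  assumes "continuous_on S f" "continuous_on S g"
  shows "continuous_on S (\<lambda>x. f x \<star> g x)"
  unfolding hmul_eq by (intro continuous_intros assms) auto

lemma continuous_on_hinv [continuous_intros]:
  "continuous_on S f \<Longrightarrow> continuous_on S (\<lambda>x. hinv (f x))"
  unfolding hinv_eq by (intro continuous_intros)

lemma borel_measurable_hmul [measurable]:
  assumes [measurable]: "f \<in> borel_measurable M" "g \<in> borel_measurable M"
  shows "(\<lambda>x. f x \<star> g x :: heis) \<in> borel_measurable M"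
  by (rule borel_measurable_continuous_Pair) (auto intro!: continuous_intros)

lemma norm_heis_le: "norm p \<le> \<bar>fst p\<bar> + \<bar>fst (snd p)\<bar> + \<bar>snd (snd p)\<bar>" for p :: heis
proof -
  have "norm p \<le> \<bar>fst p\<bar> + norm (snd p)"
    using sqrt_sum_squares_le_sum_abs[of "fst p" "norm (snd p)"] by (cases p) (simp add: norm_Pair)
  also have "norm (snd p) \<le> \<bar>fst (snd p)\<bar> + \<bar>snd (snd p)\<bar>"
    using sqrt_sum_squares_le_sum_abs by (cases p) (simp add: norm_Pair)
  finally show ?thesis by simp
qed

lemma abs_coords_le_norm:
  fixes p :: heis
  shows "\<bar>fst p\<bar> \<le> norm p" "\<bar>fst (snd p)\<bar> \<le> norm p" "\<bar>snd (snd p)\<bar> \<le> norm p"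
proof -
  have "norm (snd p) \<le> norm p" by (metis norm_snd_le prod.collapse)
  moreover have "norm (fst (snd p)) \<le> norm (snd p)" "norm (snd (snd p)) \<le> norm (snd p)"
    by (metis norm_fst_le prod.collapse, metis norm_snd_le prod.collapse)
  ultimately show "\<bar>fst (snd p)\<bar> \<le> norm p" "\<bar>snd (snd p)\<bar> \<le> norm p" by simp_all
  show "\<bar>fst p\<bar> \<le> norm p" by (metis norm_fst_le prod.collapse real_norm_def)
qed

lemma norm_hmul_commutator_le:
  "\<bar>fst p * fst (snd q) - fst (snd p) * fst q\<bar> / 2 \<le> norm p * norm q" for p q :: heis
proof -
  have "\<bar>fst p * fst (snd q) - fst (snd p) * fst q\<bar> \<le> \<bar>fst p\<bar> * \<bar>fst (snd q)\<bar> + \<bar>fst (snd p)\<bar> * \<bar>fst q\<bar>"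
    by (metis abs_mult abs_triangle_ineq4)
  also have "\<dots> \<le> norm p * norm q + norm p * norm q"
    by (intro add_mono mult_mono abs_coords_le_norm) auto
  finally show ?thesis by simp
qed

text \<open>Apart from the commutator term in the third coordinate the group law is addition, and
  that term is at most \<open>norm p * norm q\<close>. Small group increments are thus small
  Euclidean ones, uniformly for \<open>p\<close> in a bounded set.\<close>

lemma norm_hmul_diff_left: "norm (p \<star> q - p) \<le> (1 + norm p) * norm q"
proof -
  have "p \<star> q - p = q + (0, 0, (fst p * fst (snd q) - fst (snd p) * fst q) / 2)"
    by (simp add: hmul_eq prod_eq_iff)
  also have "norm \<dots> \<le> norm q + \<bar>fst p * fst (snd q) - fst (snd p) * fst q\<bar> / 2"
    by (rule norm_triangle_le) (simp add: norm_Pair)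
  finally show ?thesis using norm_hmul_commutator_le[of p q] by (simp add: algebra_simps)
qed

lemma norm_hmul_diff_right: "norm (p \<star> q - q) \<le> (1 + norm q) * norm p"
proof -
  have "p \<star> q - q = p + (0, 0, (fst p * fst (snd q) - fst (snd p) * fst q) / 2)"
    by (simp add: hmul_eq prod_eq_iff)
  also have "norm \<dots> \<le> norm p + \<bar>fst p * fst (snd q) - fst (snd p) * fst q\<bar> / 2"
    by (rule norm_triangle_le) (simp add: norm_Pair)
  finally show ?thesis using norm_hmul_commutator_le[of p q] by (simp add: algebra_simps)
qed

lemma koranyi_eq:
  "koranyi p = root 4 (((fst p)\<^sup>2 + (fst (snd p))\<^sup>2)\<^sup>2 + 16 * (snd (snd p))\<^sup>2)"
  by (cases p) simp

lemma koranyi_nonneg [simp]: "0 \<le> koranyi p"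
  by (simp add: koranyi_eq)

lemma koranyi_power4: "koranyi p ^ 4 = ((fst p)\<^sup>2 + (fst (snd p))\<^sup>2)\<^sup>2 + 16 * (snd (snd p))\<^sup>2"
  by (simp add: koranyi_eq)

lemma koranyi_eq_0_iff [simp]: "koranyi p = 0 \<longleftrightarrow> p = 0"
  by (simp add: koranyi_eq add_nonneg_eq_0_iff prod_eq_iff)

lemma koranyi_horizontal: "koranyi (r * a, r * b, 0) = \<bar>r\<bar> * norm (a, b)"
proof (rule power_eq_imp_eq_base[of _ 4])
  have "(\<bar>r\<bar> * norm (a, b)) ^ 4 = (r\<^sup>2)\<^sup>2 * ((norm (a, b))\<^sup>2)\<^sup>2"
    by (simp add: power_mult_distrib flip: power_mult)
  also have "\<dots> = koranyi (r * a, r * b, 0) ^ 4"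
    by (simp add: koranyi_power4 norm_Pair del: koranyi.simps) (simp add: power2_eq_square power4_eq_xxxx algebra_simps)
  finally show "koranyi (r * a, r * b, 0) ^ 4 = (\<bar>r\<bar> * norm (a, b)) ^ 4" ..
qed (auto simp: koranyi_nonneg simp del: koranyi.simps)

lemma continuous_on_koranyi [continuous_intros]:
  "continuous_on S f \<Longrightarrow> continuous_on S (\<lambda>x. koranyi (f x))"
  unfolding koranyi_eq by (intro continuous_intros)

text \<open>The Koranyi gauge is comparable to the Euclidean norm only near the origin.\<close>

lemma norm_le_koranyi:
  assumes "koranyi p \<le> 1"
  shows "norm p \<le> 3 * koranyi p"
proof -
  let ?k = "koranyi p" and ?r = "(fst p)\<^sup>2 + (fst (snd p))\<^sup>2"
  have "?r\<^sup>2 \<le> (?k\<^sup>2)\<^sup>2" and z: "(snd (snd p))\<^sup>2 \<le> (?k\<^sup>2)\<^sup>2"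
    using koranyi_power4[of p] by (simp_all flip: power_mult)
  then have r: "?r \<le> ?k\<^sup>2" by (meson power2_le_imp_le zero_le_power2)
  have "\<bar>fst p\<bar> \<le> ?k" "\<bar>fst (snd p)\<bar> \<le> ?k"
    using r by (auto intro!: power2_le_imp_le[of "\<bar>_\<bar>"] elim: order_trans[rotated])
  moreover have "\<bar>snd (snd p)\<bar> \<le> ?k\<^sup>2"
    using z by (intro power2_le_imp_le[of "\<bar>_\<bar>"]) auto
  moreover have "?k\<^sup>2 \<le> ?k" using assms by (simp add: power2_eq_square mult_left_le)
  ultimately show ?thesis using norm_heis_le[of p] by linarith
qed

lemma hdist_nonneg [simp]: "0 \<le> hdist p q"
  by (simp add: hdist_def)

lemma hdist_pos_iff: "0 < hdist p q \<longleftrightarrow> p \<noteq> q"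
proof -
  have "hinv p \<star> q = 0 \<longleftrightarrow> p = q"
    by (metis hmul_hinv_cancel(2) hmul_zero(1) hmul_hinv(1))
  then show ?thesis
    unfolding hdist_def using koranyi_eq_0_iff koranyi_nonneg by (metis less_le)
qed

lemma continuous_on_hdist [continuous_intros]:
  "continuous_on S f \<Longrightarrow> continuous_on S g \<Longrightarrow> continuous_on S (\<lambda>x. hdist (f x) (g x))"
  unfolding hdist_def by (intro continuous_intros)

text \<open>Write \<open>q\<close> as \<open>p \<star> (hinv p \<star> q)\<close> and bound the
  increment by its gauge. The factor depends on \<open>p\<close> because the Euclidean distance is
  not left invariant.\<close>

lemma dist_le_hdist:
  assumes "hdist p q \<le> 1"
  shows "dist p q \<le> 3 * (1 + norm p) * hdist p q"
proof -
  have "norm (p \<star> (hinv p \<star> q) - p) \<le> (1 + norm p) * norm (hinv p \<star> q)"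
    by (rule norm_hmul_diff_left)
  also have "\<dots> \<le> (1 + norm p) * (3 * hdist p q)"
    using norm_le_koranyi[of "hinv p \<star> q"] assms by (intro mult_left_mono) (auto simp: hdist_def)
  finally show ?thesis by (simp add: dist_norm norm_minus_commute mult.commute mult.left_commute)
qed

lemma open_hball: "open (hball q r)"
  unfolding hball_def by (intro open_Collect_less continuous_intros)

lemma hball_subset_ball:
  assumes "0 < \<delta>"
  obtains r where "0 < r" "hball q r \<subseteq> ball q \<delta>"
proof
  let ?r = "min 1 (\<delta> / (3 * (1 + norm q)))"
  show "0 < ?r" using assms by (simp add: add_pos_nonneg)
  show "hball q ?r \<subseteq> ball q \<delta>"
  proof
    fix p assume "p \<in> hball q ?r"
    then have "hdist q p \<le> 1" and lt: "hdist q p < \<delta> / (3 * (1 + norm q))"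
      by (auto simp: hball_def)
    have "dist q p \<le> 3 * (1 + norm q) * hdist q p"
      by (rule dist_le_hdist) fact
    also have "\<dots> < \<delta>"
      using lt by (simp add: pos_less_divide_eq add_pos_nonneg mult.commute)
    finally show "p \<in> ball q \<delta>" by simp
  qed
qed

lemma hsetdist_le: "p \<in> A \<Longrightarrow> hsetdist q A \<le> hdist q p"
  unfolding hsetdist_def by (intro cINF_lower bdd_belowI2[where m = 0]) auto

lemma hsetdist_less_iff:
  "A \<noteq> {} \<Longrightarrow> hsetdist q A < c \<longleftrightarrow> (\<exists>p\<in>A. hdist q p < c)"
  unfolding hsetdist_def by (intro cINF_less_iff bdd_belowI2[where m = 0]) auto

text \<open>An infimum of continuous functions is upper semicontinuous: each strict sublevel set is
  a union of open sets.\<close>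

lemma borel_measurable_hsetdist [measurable]:
  assumes "A \<noteq> {}"
  shows "(\<lambda>q. hsetdist q A) \<in> borel_measurable borel"
proof (rule borel_measurableI_less)
  fix c
  have "{q. hsetdist q A < c} = (\<Union>p\<in>A. {q. hdist q p < c})"
    using hsetdist_less_iff[OF assms] by auto
  also have "open \<dots>"
    by (intro open_UN ballI open_Collect_less continuous_intros)
  finally show "{q \<in> space borel. hsetdist q A < c} \<in> sets borel" by simp
qed

text \<open>The continuous function \<open>hdist\<close> is positive on the compact product and
  attains its minimum there. With the frontier as \<open>A\<close>, this tells for which
  \<open>e\<close> no step from \<open>K\<close> is shortened by the boundary.\<close>

lemma hsetdist_pos_on_compact:
  assumes "compact A" "A \<noteq> {}" "compact K" "K \<inter> A = {}"
  obtains m where "0 < m" "\<And>q. q \<in> K \<Longrightarrow> m \<le> hsetdist q A"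
proof (cases "K = {}")
  case False
  have "continuous_on (K \<times> A) (\<lambda>x. hdist (fst x) (snd x))"
    by (intro continuous_intros)
  from continuous_attains_inf[OF compact_Times[OF assms(3,1)] _ this] False assms(2)
  obtain x where x: "x \<in> K \<times> A" "\<And>y. y \<in> K \<times> A \<Longrightarrow> hdist (fst x) (snd x) \<le> hdist (fst y) (snd y)"
    by blast
  show thesis
  proof (rule that[of "hdist (fst x) (snd x)"])
    show "0 < hdist (fst x) (snd x)" using x(1) assms(4) by (auto simp: hdist_pos_iff)
    show "hdist (fst x) (snd x) \<le> hsetdist q A" if "q \<in> K" for q
      unfolding hsetdist_def using that assms(2) x(2)[of "(q, _)"] by (intro cINF_greatest) auto
  qed
qed (use that[of 1] in auto)

section \<open>Horizontal steps\<close>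

definition hshift :: "real \<Rightarrow> heis \<Rightarrow> real \<times> real \<Rightarrow> heis" where
  "hshift e q w = q \<star> (e * fst w, e * snd w, 0)"

lemma hshift_eq:
  "hshift e q w = q + e *\<^sub>R (fst w, snd w, (fst q * snd w - fst (snd q) * fst w) / 2)"
  by (simp add: hshift_def hmul_eq prod_eq_iff algebra_simps diff_divide_distrib)

lemma hshift_hmul: "hshift e (p \<star> q) w = p \<star> hshift e q w"
  by (simp add: hshift_def hmul_assoc)

lemma continuous_on_hshift [continuous_intros]:
  "continuous_on S e \<Longrightarrow> continuous_on S f \<Longrightarrow> continuous_on S g \<Longrightarrow>
    continuous_on S (\<lambda>x. hshift (e x) (f x) (g x))"
  unfolding hshift_def by (intro continuous_intros)

lemma borel_measurable_hshift [measurable]: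
  assumes [measurable]: "e \<in> borel_measurable M" "f \<in> borel_measurable M" "g \<in> borel_measurable M"
  shows "(\<lambda>x. hshift (e x) (f x) (g x)) \<in> borel_measurable M"
proof -
  have "(\<lambda>x. (e x * fst (g x), e x * snd (g x), 0::real)) \<in> borel_measurable M"
    by (intro borel_measurable_Pair) (auto intro!: borel_measurable_times
        measurable_compose[OF assms(3)] borel_measurable_continuous_onI continuous_intros)
  then show ?thesis unfolding hshift_def by (intro borel_measurable_hmul assms)
qed

lemma dist_hshift_le:
  assumes "norm w \<le> 1"
  shows "dist (hshift e q w) q \<le> (1 + norm q) * \<bar>e\<bar>"
proof -
  have "norm (e * fst w, e * snd w, 0::real) = \<bar>e\<bar> * norm w"
    by (cases w) (simp add: norm_Pair real_sqrt_mult power_mult_distrib flip: distrib_left)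
  also have "\<dots> \<le> \<bar>e\<bar>" using assms by (simp add: mult_left_le)
  finally have "(1 + norm q) * norm (e * fst w, e * snd w, 0::real) \<le> (1 + norm q) * \<bar>e\<bar>"
    by (intro mult_left_mono) auto
  then show ?thesis
    unfolding dist_norm hshift_def using norm_hmul_diff_left[of q] order_trans by blast
qed

lemma hdist_hshift: "hdist q (hshift e q w) = \<bar>e\<bar> * norm w"
  by (cases w) (simp add: hdist_def hshift_def koranyi_horizontal del: koranyi.simps)

text \<open>The path \<open>t \<mapsto> hshift (t * e) q w\<close> is connected, so if it left
  \<open>D\<close> it would meet the frontier at gauge distance \<open>t * e * norm w\<close> from
  \<open>q\<close>. Since \<open>norm w < 1\<close>, this is smaller than the distance from
  \<open>q\<close> to the frontier.\<close>

lemma hshift_in_domain: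
  assumes "open D" "q \<in> D" "norm w < 1" "0 \<le> e" "e \<le> hsetdist q (frontier D)" "frontier D \<noteq> {}"
    "0 < hsetdist q (frontier D)"
  shows "hshift e q w \<in> D"
proof (rule ccontr)
  assume "hshift e q w \<notin> D"
  define c where "c t = hshift (t * e) q w" for t
  have "connected (c ` {0..1})"
    unfolding c_def by (intro connected_continuous_image continuous_intros) auto
  moreover have "q \<in> c ` {0..1} \<inter> D"
    using assms(2) by (force simp: c_def hshift_def zero_prod_def[symmetric] image_iff intro: bexI[of _ 0])
  moreover have "hshift e q w \<in> c ` {0..1} - D"
    using \<open>hshift e q w \<notin> D\<close> by (force simp: c_def image_iff intro: bexI[of _ 1])
  ultimately obtain t where t: "t \<in> {0..1}" "c t \<in> frontier D"
    using connected_Int_frontier[of "c ` {0..1}" D] by blast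
  have "hsetdist q (frontier D) \<le> hdist q (c t)" by (rule hsetdist_le) fact
  also have "\<dots> = t * e * norm w" using t(1) assms(4) by (simp add: c_def hdist_hshift)
  also have "\<dots> \<le> e * norm w" using t(1) assms(4) by (intro mult_right_mono) (auto simp: mult_left_le_one_le)
  also have "\<dots> \<le> hsetdist q (frontier D) * norm w"
    using assms(5) by (intro mult_right_mono) auto
  also have "\<dots> < hsetdist q (frontier D)" using assms(3,7) by simp
  finally show False by simp
qed

subsection \<open>The uniform distribution on the disc and the averaging operator\<close>

lemma emeasure_lborel_open_pos:
  fixes U :: "'a::euclidean_space set"
  assumes "open U" "U \<noteq> {}"
  shows "0 < emeasure lborel U"
proof -
  obtain c r where "0 < r" "ball c r \<subseteq> U"
    using assms by (metis all_not_in_conv open_contains_ball)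
  moreover from content_ball_pos[OF \<open>0 < r\<close>, of c] have "0 < emeasure lborel (ball c r)"
    by (auto simp: Sigma_Algebra.measure_def zero_less_iff_neq_zero)
  ultimately show ?thesis
    using assms(1) by (metis borel_open emeasure_mono order_less_le_trans sets_lborel)
qed

abbreviation step_dist :: "(real \<times> real) measure" where
  "step_dist \<equiv> uniform_measure lborel (ball 0 1)"

lemma emeasure_unit_ball: "emeasure lborel (ball (0 :: real \<times> real) 1) \<noteq> 0"
    "emeasure lborel (ball (0 :: real \<times> real) 1) \<noteq> \<infinity>"
proof -
  have "0 < measure lborel (ball (0 :: real \<times> real) 1)" by (rule content_ball_pos) simp
  then show "emeasure lborel (ball (0 :: real \<times> real) 1) \<noteq> 0"
    by (auto simp: Sigma_Algebra.measure_def)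
  show "emeasure lborel (ball (0 :: real \<times> real) 1) \<noteq> \<infinity>"
    using emeasure_lborel_ball_finite[of "0 :: real \<times> real" 1] by simp
qed

interpretation step: prob_space step_dist
  using emeasure_unit_ball by (intro prob_space_uniform_measure) auto

lemma AE_step_dist: "AE w in step_dist. norm w < 1"
  by (rule AE_uniform_measureI) auto

lemma emeasure_step_dist_pos:
  assumes "open U" "U \<noteq> {}" "U \<subseteq> ball 0 1"
  shows "0 < emeasure step_dist U"
proof -
  have "0 < emeasure lborel U" using assms(1,2) by (rule emeasure_lborel_open_pos)
  then show ?thesis
    using assms emeasure_unit_ball
    by (simp add: Int_absorb1 ennreal_zero_less_divide emeasure_lborel_ball_finite less_top)
qed

lemma distr_step_dist:
  assumes T: "T \<in> borel_measurable borel" and "distr lborel borel T = lborel"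
    and norm: "\<And>w. norm (T w) = norm w"
  shows "distr step_dist borel T = step_dist"
proof (rule measure_eqI)
  fix A :: "(real \<times> real) set" assume "A \<in> sets (distr step_dist borel T)"
  then have A: "A \<in> sets borel" by simp
  have "T -` A \<in> sets borel" using measurable_sets[OF T A] by simp
  moreover have "ball 0 1 \<inter> T -` A = T -` (ball 0 1 \<inter> A)"
    by (rule set_eqI) (simp add: norm)
  moreover have "emeasure lborel (T -` (ball 0 1 \<inter> A)) = emeasure (distr lborel borel T) (ball 0 1 \<inter> A)"
    using A T by (subst emeasure_distr) auto
  ultimately show "emeasure (distr step_dist borel T) A = emeasure step_dist A"
    using A T assms(2) by (simp add: emeasure_distr)
qed simp

lemma integral_step_dist_transform:
  fixes f :: "real \<times> real \<Rightarrow> 'b::{banach, second_countable_topology}"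
  assumes T: "T \<in> borel_measurable borel" and "distr lborel borel T = lborel"
    and "\<And>w. norm (T w) = norm w" and f: "f \<in> borel_measurable borel"
  shows "(\<integral>w. f (T w) \<partial>step_dist) = (\<integral>w. f w \<partial>step_dist)"
proof -
  have "(\<integral>w. f w \<partial>step_dist) = (\<integral>w. f w \<partial>distr step_dist borel T)"
    by (subst distr_step_dist) (fact assms refl)+
  also have "\<dots> = (\<integral>w. f (T w) \<partial>step_dist)"
    using T f by (intro integral_distr) auto
  finally show ?thesis ..
qed

lemma distr_lborel_reflect:
  "distr lborel borel (\<lambda>w :: real \<times> real. (- fst w, snd w)) = lborel"
  "distr lborel borel (\<lambda>w :: real \<times> real. (fst w, - snd w)) = lborel"
  "distr lborel borel (\<lambda>w :: real \<times> real. (snd w, fst w)) = lborel"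
proof -
  have *: "distr lborel borel (\<lambda>w :: real \<times> real. (f (fst w), g (snd w))) = lborel"
    if [measurable]: "f \<in> borel_measurable borel" "g \<in> borel_measurable borel"
      and f: "distr lborel borel f = (lborel :: real measure)"
      and g: "distr lborel borel g = (lborel :: real measure)" for f g :: "real \<Rightarrow> real"
  proof -
    have "(lborel :: (real \<times> real) measure) = distr lborel borel f \<Otimes>\<^sub>M distr lborel borel g"
      by (simp only: f g lborel_prod)
    also have "\<dots> = distr (lborel \<Otimes>\<^sub>M lborel) (borel \<Otimes>\<^sub>M borel) (\<lambda>(x, y). (f x, g y))"
      by (rule pair_measure_distr) (simp_all add: g lborel.sigma_finite_measure_axioms)
    finally show ?thesis
      by (simp add: lborel_prod borel_prod case_prod_beta')
  qed
  have id: "distr lborel borel (\<lambda>x::real. x) = lborel"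
    by (simp add: distr_id2)
  show "distr lborel borel (\<lambda>w :: real \<times> real. (- fst w, snd w)) = lborel"
    using *[of uminus "\<lambda>x. x"] lborel_distr_uminus id by simp
  show "distr lborel borel (\<lambda>w :: real \<times> real. (fst w, - snd w)) = lborel"
    using *[of "\<lambda>x. x" uminus] lborel_distr_uminus id by simp
  have "lborel \<Otimes>\<^sub>M lborel = distr (lborel \<Otimes>\<^sub>M lborel) (lborel \<Otimes>\<^sub>M lborel) (\<lambda>(x :: real, y :: real). (y, x))"
    by (rule lborel_pair.distr_pair_swap)
  then have "lborel = distr lborel lborel (\<lambda>w :: real \<times> real. (snd w, fst w))"
    by (simp add: lborel_prod case_prod_beta')
  also have "\<dots> = distr lborel borel (\<lambda>w. (snd w, fst w))"
    by (rule distr_cong) auto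
  finally show "distr lborel borel (\<lambda>w :: real \<times> real. (snd w, fst w)) = lborel" ..
qed

text \<open>The coordinate reflections kill the odd and mixed moments, the swap equates the two
  variances, and the point reflection makes the averaging operator symmetric.\<close>

lemma integral_step_dist_reflect:
  fixes f :: "real \<times> real \<Rightarrow> 'b::{banach, second_countable_topology}"
  assumes f: "f \<in> borel_measurable borel"
  shows "(\<integral>w. f (- fst w, snd w) \<partial>step_dist) = (\<integral>w. f w \<partial>step_dist)"
    and "(\<integral>w. f (fst w, - snd w) \<partial>step_dist) = (\<integral>w. f w \<partial>step_dist)"
    and "(\<integral>w. f (snd w, fst w) \<partial>step_dist) = (\<integral>w. f w \<partial>step_dist)"
    and "(\<integral>w. f (- w) \<partial>step_dist) = (\<integral>w. f w \<partial>step_dist)"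
proof -
  have m: "(\<lambda>w :: real \<times> real. (- fst w, snd w)) \<in> borel_measurable borel"
    "(\<lambda>w :: real \<times> real. (fst w, - snd w)) \<in> borel_measurable borel"
    "(\<lambda>w :: real \<times> real. (snd w, fst w)) \<in> borel_measurable borel"
    by (auto intro!: borel_measurable_continuous_onI continuous_intros)
  show 1: "(\<integral>w. f (- fst w, snd w) \<partial>step_dist) = (\<integral>w. f w \<partial>step_dist)"
    and "(\<integral>w. f (fst w, - snd w) \<partial>step_dist) = (\<integral>w. f w \<partial>step_dist)"
    and "(\<integral>w. f (snd w, fst w) \<partial>step_dist) = (\<integral>w. f w \<partial>step_dist)"
    by (rule integral_step_dist_transform[OF m(1) distr_lborel_reflect(1) _ f]
             integral_step_dist_transform[OF m(2) distr_lborel_reflect(2) _ f]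
             integral_step_dist_transform[OF m(3) distr_lborel_reflect(3) _ f];
        simp add: norm_prod_def add.commute)+
  have "(\<integral>w. f (- fst w, - snd w) \<partial>step_dist) = (\<integral>w. f (- fst w, snd w) \<partial>step_dist)"
    using integral_step_dist_transform[OF m(2) distr_lborel_reflect(2) _ measurable_compose[OF m(1) f]]
    by (simp add: norm_prod_def)
  moreover have "- w = (- fst w, - snd w)" for w :: "real \<times> real" by (simp add: prod_eq_iff)
  ultimately show "(\<integral>w. f (- w) \<partial>step_dist) = (\<integral>w. f w \<partial>step_dist)"
    using 1 by simp
qed

lemma integrable_step_dist_bounded:
  fixes f :: "real \<times> real \<Rightarrow> 'b::{banach, second_countable_topology}"
  assumes "f \<in> borel_measurable borel" "\<And>w. norm w < 1 \<Longrightarrow> norm (f w) \<le> B"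
  shows "integrable step_dist f"
  using assms AE_step_dist
  by (intro step.integrable_const_bound[of _ B]) (auto elim: eventually_mono)

lemma abs_coords_le_norm2:
  fixes w :: "real \<times> real"
  shows "\<bar>fst w\<bar> \<le> norm w" "\<bar>snd w\<bar> \<le> norm w"
  by (metis norm_fst_le prod.collapse real_norm_def, metis norm_snd_le prod.collapse real_norm_def)

lemma integrable_step_dist_moments:
  "integrable step_dist fst" "integrable step_dist snd"
  "integrable step_dist (\<lambda>w. fst w * snd w)"
  "integrable step_dist (\<lambda>w. (fst w)\<^sup>2)" "integrable step_dist (\<lambda>w. (snd w)\<^sup>2)"
proof -
  have bd: "\<bar>fst w\<bar> \<le> 1" "\<bar>snd w\<bar> \<le> 1" if "norm w < 1" for w :: "real \<times> real"
    using abs_coords_le_norm2[of w] that by linarith+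
  show "integrable step_dist fst" "integrable step_dist snd"
    "integrable step_dist (\<lambda>w. fst w * snd w)"
    "integrable step_dist (\<lambda>w. (fst w)\<^sup>2)" "integrable step_dist (\<lambda>w. (snd w)\<^sup>2)"
    by (rule integrable_step_dist_bounded[where B = 1];
        use bd in \<open>auto simp: abs_mult abs_square_le_1 simp del: split_paired_All
          intro!: mult_le_one borel_measurable_continuous_onI continuous_intros\<close>)+
qed

lemma step_dist_moments:
  "(\<integral>w. fst w \<partial>step_dist) = 0" "(\<integral>w. snd w \<partial>step_dist) = 0"
  "(\<integral>w. fst w * snd w \<partial>step_dist) = 0"
  "(\<integral>w. (snd w)\<^sup>2 \<partial>step_dist) = (\<integral>w. (fst w)\<^sup>2 \<partial>step_dist)"
proof -
  have [measurable]: "(fst :: real \<times> real \<Rightarrow> real) \<in> borel_measurable borel"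
      "(snd :: real \<times> real \<Rightarrow> real) \<in> borel_measurable borel"
      "(\<lambda>w :: real \<times> real. fst w * snd w) \<in> borel_measurable borel"
      "(\<lambda>w :: real \<times> real. (fst w)\<^sup>2) \<in> borel_measurable borel"
    by (auto intro!: borel_measurable_continuous_onI continuous_intros)
  show "(\<integral>w. fst w \<partial>step_dist) = 0" "(\<integral>w. snd w \<partial>step_dist) = 0"
    "(\<integral>w. fst w * snd w \<partial>step_dist) = 0"
    using integral_step_dist_reflect(1)[of "fst :: real \<times> real \<Rightarrow> real"]
      integral_step_dist_reflect(2)[of "snd :: real \<times> real \<Rightarrow> real"]
      integral_step_dist_reflect(1)[of "\<lambda>w. fst w * snd w"] by simp_all
  show "(\<integral>w. (snd w)\<^sup>2 \<partial>step_dist) = (\<integral>w. (fst w)\<^sup>2 \<partial>step_dist)"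
    using integral_step_dist_reflect(3)[of "\<lambda>w. (fst w)\<^sup>2"] by simp
qed

text \<open>The variance of either coordinate, equal to 1/4 for the unit disc. It enters later only
  through its sign, so the integral stays unevaluated.\<close>

definition step_var :: real where
  "step_var = (\<integral>w. (fst w)\<^sup>2 \<partial>step_dist)"

lemma step_var_pos: "0 < step_var"
proof (rule ccontr)
  assume "\<not> 0 < step_var"
  moreover have "0 \<le> step_var" unfolding step_var_def by (intro integral_nonneg_AE) simp
  ultimately have "step_var = 0" by simp
  then have "(\<integral>w. (fst w)\<^sup>2 \<partial>step_dist) = 0" unfolding step_var_def .
  then have "AE w in step_dist. (fst w)\<^sup>2 = 0"
    by (subst (asm) integral_nonneg_eq_0_iff_AE) (auto intro: integrable_step_dist_moments)
  then have ae: "AE w in step_dist. w \<notin> {w. 0 < fst w} \<inter> ball 0 1"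
    by eventually_elim auto
  have op: "open ({w :: real \<times> real. 0 < fst w} \<inter> ball 0 1)"
    by (intro open_Int open_Collect_less continuous_intros) auto
  have "emeasure step_dist ({w. 0 < fst w} \<inter> ball 0 1) = 0"
    using ae op AE_iff_null_sets[of _ step_dist] by (metis borel_open null_setsD1 sets_lborel
        sets_uniform_measure)
  moreover have "(1/2, 0) \<in> {w :: real \<times> real. 0 < fst w} \<inter> ball 0 1" by (simp add: norm_Pair)
  then have "{w :: real \<times> real. 0 < fst w} \<inter> ball 0 1 \<noteq> {}" by blast
  ultimately show False
    using emeasure_step_dist_pos[OF op] by (metis inf_le2 less_irrefl)
qed

lemma step_var_eq:
  "(\<integral>w. (fst w)\<^sup>2 \<partial>step_dist) = step_var" "(\<integral>w. (snd w)\<^sup>2 \<partial>step_dist) = step_var"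
  by (simp_all add: step_var_def step_dist_moments)

section \<open>The averaging operator and its maximum principle\<close>

definition disc_avg :: "real \<Rightarrow> (heis \<Rightarrow> real) \<Rightarrow> heis \<Rightarrow> real" where
  "disc_avg e f q = (\<integral>w. f (hshift e q w) \<partial>step_dist)"

lemma borel_measurable_hshift_apply:
  assumes "f \<in> borel_measurable borel"
  shows "(\<lambda>w. f (hshift e q w)) \<in> borel_measurable borel"
  by (intro measurable_compose[OF _ assms] borel_measurable_continuous_onI continuous_intros)

lemma borel_measurable_disc_avg [measurable]:
  assumes [measurable]: "f \<in> borel_measurable borel"
  shows "disc_avg e f \<in> borel_measurable borel"
  unfolding disc_avg_def[abs_def]
proof (rule step.borel_measurable_lebesgue_integral)
  have "(\<lambda>x :: heis \<times> real \<times> real. hshift e (fst x) (snd x)) \<in> borel_measurable borel"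
    by (intro borel_measurable_continuous_onI continuous_intros)
  then have "(\<lambda>x :: heis \<times> real \<times> real. f (hshift e (fst x) (snd x))) \<in> borel_measurable borel"
    by measurable
  then have "(\<lambda>x :: heis \<times> real \<times> real. f (hshift e (fst x) (snd x))) \<in> borel_measurable (borel \<Otimes>\<^sub>M borel)"
    by (simp add: borel_prod)
  then show "(\<lambda>(q, w). f (hshift e q w)) \<in> borel_measurable (borel \<Otimes>\<^sub>M step_dist)"
    by (simp add: case_prod_beta' cong: measurable_cong_sets)
qed

text \<open>The terms linear in \<open>w\<close> have mean zero, so averaging raises the squared
  horizontal norm by the same positive amount at every point. This makes it the strict subsolution
  for the maximum principle.\<close>

lemma disc_avg_horizontal:
  "disc_avg e (\<lambda>p. (fst p)\<^sup>2 + (fst (snd p))\<^sup>2) q = (fst q)\<^sup>2 + (fst (snd q))\<^sup>2 + 2 * e\<^sup>2 * step_var"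
proof -
  have "disc_avg e (\<lambda>p. (fst p)\<^sup>2 + (fst (snd p))\<^sup>2) q =
     (\<integral>w. ((fst q)\<^sup>2 + (fst (snd q))\<^sup>2) + 2 * e * fst q * fst w + 2 * e * fst (snd q) * snd w
        + e\<^sup>2 * (fst w)\<^sup>2 + e\<^sup>2 * (snd w)\<^sup>2 \<partial>step_dist)"
    unfolding disc_avg_def by (intro arg_cong[where f = "lebesgue_integral _"] ext)
      (simp add: hshift_eq power2_eq_square algebra_simps)
  also have "\<dots> = (fst q)\<^sup>2 + (fst (snd q))\<^sup>2 + 2 * e\<^sup>2 * step_var"
    using step.prob_space
    by (simp add: integrable_step_dist_moments step_dist_moments(1,2) step_var_eq)
  finally show ?thesis .
qed

text \<open>A bounded subsolution on \<open>E\<close> need not be continuous; adding a small multiple of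
  \<open>x\<^sup>2 + y\<^sup>2\<close> makes the averaging inequality strict, so that even an approximate maximum
  over \<open>E\<close> is impossible.\<close>

lemma disc_avg_maximum_principle:
  assumes e: "0 < e" and v: "v \<in> borel_measurable borel" and bd: "\<And>p. \<bar>v p\<bar> \<le> M"
    and E: "bounded E"
    and sub: "\<And>p. p \<in> E \<Longrightarrow> v p \<le> disc_avg e v p"
    and bdry: "\<And>p w. p \<in> E \<Longrightarrow> norm w < 1 \<Longrightarrow> hshift e p w \<in> E \<or> v (hshift e p w) \<le> m"
    and "p \<in> E"
  shows "v p \<le> m"
proof -
  define h where "h p = (fst p)\<^sup>2 + (fst (snd p))\<^sup>2" for p :: heis
  obtain R where R: "\<And>p. p \<in> E \<Longrightarrow> norm p \<le> R" "0 < R"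
    using E bounded_pos by metis
  define H where "H = 2 * (R + (1 + R) * e)\<^sup>2"
  have h0: "0 \<le> h p" for p by (simp add: h_def)
  have hE: "h (hshift e p w) \<le> H" if "p \<in> E" "norm w \<le> 1" for p w
  proof -
    have "norm (hshift e p w) \<le> norm p + dist (hshift e p w) p"
      by (metis add.commute dist_norm norm_triangle_sub)
    also have "\<dots> \<le> R + (1 + R) * e"
      using dist_hshift_le[OF that(2), of e p] R(1)[OF that(1)] e
      by (intro add_mono order_trans[OF dist_hshift_le[OF that(2)]] mult_right_mono) auto
    finally have "\<bar>fst (hshift e p w)\<bar> \<le> R + (1 + R) * e" "\<bar>fst (snd (hshift e p w))\<bar> \<le> R + (1 + R) * e"
      using abs_coords_le_norm[of "hshift e p w"] by linarith+
    then show ?thesis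
      using power_mono[of "\<bar>fst (hshift e p w)\<bar>" _ 2] power_mono[of "\<bar>fst (snd (hshift e p w))\<bar>" _ 2]
      unfolding h_def H_def power2_abs mult_2 by (intro add_mono) auto
  qed
  have hE': "h p \<le> H" if "p \<in> E" for p
    using hE[OF that, of 0] by (simp add: hshift_def zero_prod_def[symmetric])
  have main: "v p + k * h p \<le> m + k * H" if k: "0 < k" and "p \<in> E" for k p
  proof (rule ccontr)
    assume neg: "\<not> v p + k * h p \<le> m + k * H"
    define f where "f q = v q + k * h q" for q
    define S where "S = Sup (f ` E)"
    have bdd: "bdd_above (f ` E)"
    proof (rule bdd_aboveI2)
      fix q assume "q \<in> E" then show "f q \<le> M + k * H"
        using bd[of q] hE'[of q] k by (simp add: f_def add_mono)
    qed
    have fS: "f q \<le> S" if "q \<in> E" for q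
      unfolding S_def using that bdd by (intro cSUP_upper)
    then have mS: "m + k * H < S" using neg \<open>p \<in> E\<close> by (fastforce simp: f_def)
    have "f q \<le> S - k * (2 * e\<^sup>2 * step_var)" if q: "q \<in> E" for q
    proof -
      have i1: "integrable step_dist (\<lambda>w. v (hshift e q w))"
        using v bd by (intro integrable_step_dist_bounded[where B = M] borel_measurable_hshift_apply) auto
      have i2: "integrable step_dist (\<lambda>w. h (hshift e q w))"
        using hE[OF q] h0 by (intro integrable_step_dist_bounded[where B = H] borel_measurable_hshift_apply)
          (auto simp: h_def[abs_def] intro!: borel_measurable_continuous_onI continuous_intros)
      have "disc_avg e v q + k * disc_avg e h q = (\<integral>w. f (hshift e q w) \<partial>step_dist)"
        using i1 i2 by (simp add: disc_avg_def f_def)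
      also have "\<dots> \<le> (\<integral>w. S \<partial>step_dist)"
      proof (rule integral_mono_AE)
        show "integrable step_dist (\<lambda>w. f (hshift e q w))" using i1 i2 by (simp add: f_def)
        show "AE w in step_dist. f (hshift e q w) \<le> S"
          using AE_step_dist
        proof eventually_elim
          case (elim w)
          show ?case
          proof (cases "hshift e q w \<in> E")
            case False
            then have "v (hshift e q w) \<le> m" using bdry q elim by blast
            then have "f (hshift e q w) \<le> m + k * H"
              using hE[OF q, of w] elim k by (simp add: f_def add_mono)
            then show ?thesis using mS by simp
          qed (rule fS)
        qed
      qed simp
      also have "\<dots> = S" using step.prob_space by simp
      finally have "disc_avg e v q + k * (h q + 2 * e\<^sup>2 * step_var) \<le> S"
        using disc_avg_horizontal[of e q] by (simp add: h_def[abs_def])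
      with sub[OF q] show ?thesis by (simp add: f_def algebra_simps)
    qed
    then have "S \<le> S - k * (2 * e\<^sup>2 * step_var)"
      unfolding S_def using \<open>p \<in> E\<close> by (intro cSUP_least) auto
    then show False using k e step_var_pos by (simp add: mult_le_0_iff)
  qed
  show ?thesis
  proof (rule field_le_epsilon)
    fix d :: real assume "0 < d"
    define k where "k = d / (H + 1)"
    have "0 \<le> H" by (simp add: H_def)
    then have k: "0 < k" "k * H \<le> d" using \<open>0 < d\<close> by (auto simp: k_def field_simps)
    then have "v p + k * h p \<le> m + k * H" using main \<open>p \<in> E\<close> by blast
    moreover have "0 \<le> k * h p" using k h0 by simp
    ultimately show "v p \<le> m + d" using k by linarith
  qed
qed

subsection \<open>The walk and its almost sure convergence\<close>

interpretation steps: sequence_space step_dist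
  by unfold_locales

lemma step_space_eq: "step_space = steps.S"
  by (simp add: step_space_def)

interpretation step_space: prob_space step_space
  unfolding step_space_eq by unfold_locales

lemma sets_step_space [measurable_cong]: "sets step_space = sets (\<Pi>\<^sub>M n\<in>UNIV. borel)"
  unfolding step_space_def by (intro sets_PiM_cong) auto

lemma measurable_step_space_component [measurable]:
  "(\<lambda>\<omega>. \<omega> n) \<in> borel_measurable step_space"
  unfolding measurable_cong_sets[OF sets_step_space refl]
  by (rule measurable_component_singleton) simp

lemma space_step_space [simp]: "space step_space = UNIV"
  by (simp add: step_space_def space_PiM)

lemma measurable_case_nat_step_space [measurable]:
  "(\<lambda>(w, \<omega>). case_nat w \<omega>) \<in> step_dist \<Otimes>\<^sub>M step_space \<rightarrow>\<^sub>M step_space"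
  unfolding step_space_eq by measurable

lemma distr_step_space: "distr (step_dist \<Otimes>\<^sub>M step_space) step_space (\<lambda>(w, \<omega>). case_nat w \<omega>) = step_space"
  unfolding step_space_eq by (rule steps.PiM_iter)

lemma emeasure_step_space_UNIV [simp]: "emeasure step_space UNIV = 1"
  using step_space.emeasure_space_1 by simp

lemma measure_step_space_UNIV [simp]: "measure step_space UNIV = 1"
  using step_space.prob_space by simp

interpretation step_pair: pair_prob_space step_dist step_space
  by unfold_locales

text \<open>Splitting off the first coordinate leaves a sequence with the same law. Since prepending
  \<open>w\<close> restarts the walk from the point reached by the first step, this serves as the
  Markov property throughout.\<close>

lemma nn_integral_step_space:
  assumes f: "f \<in> borel_measurable step_space"
  shows "(\<integral>\<^sup>+\<omega>. f \<omega> \<partial>step_space) = (\<integral>\<^sup>+w. \<integral>\<^sup>+\<omega>. f (case_nat w \<omega>) \<partial>step_space \<partial>step_dist)"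
proof -
  have "(\<integral>\<^sup>+\<omega>. f \<omega> \<partial>step_space) = (\<integral>\<^sup>+x. f (case x of (w, \<omega>) \<Rightarrow> case_nat w \<omega>) \<partial>(step_dist \<Otimes>\<^sub>M step_space))"
    using f by (subst distr_step_space[symmetric], subst nn_integral_distr) auto
  also have "\<dots> = (\<integral>\<^sup>+w. \<integral>\<^sup>+\<omega>. f (case_nat w \<omega>) \<partial>step_space \<partial>step_dist)"
    using measurable_compose[OF measurable_case_nat_step_space f]
    by (subst step_space.nn_integral_fst[symmetric]) (auto simp: case_prod_beta')
  finally show ?thesis .
qed

lemma integral_step_space:
  fixes f :: "_ \<Rightarrow> 'b::{banach, second_countable_topology}"
  assumes f: "integrable step_space f"
  shows "(\<integral>\<omega>. f \<omega> \<partial>step_space) = (\<integral>w. \<integral>\<omega>. f (case_nat w \<omega>) \<partial>step_space \<partial>step_dist)"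
proof -
  have m: "f \<in> borel_measurable step_space" using f by simp
  have "integrable (distr (step_dist \<Otimes>\<^sub>M step_space) step_space (\<lambda>(w, \<omega>). case_nat w \<omega>)) f"
    using f by (simp add: distr_step_space)
  then have i: "integrable (step_dist \<Otimes>\<^sub>M step_space) (\<lambda>x. f (case x of (w, \<omega>) \<Rightarrow> case_nat w \<omega>))"
    by (subst (asm) integrable_distr_eq) (use m in auto)
  have "(\<integral>\<omega>. f \<omega> \<partial>step_space) = (\<integral>x. f (case x of (w, \<omega>) \<Rightarrow> case_nat w \<omega>) \<partial>(step_dist \<Otimes>\<^sub>M step_space))"
    using m by (subst distr_step_space[symmetric], subst integral_distr) auto
  also have "\<dots> = (\<integral>w. \<integral>\<omega>. f (case_nat w \<omega>) \<partial>step_space \<partial>step_dist)"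
    using step_pair.integral_fst'[OF i] by simp
  finally show ?thesis .
qed

lemma AE_step_space_case_nat:
  assumes P: "Measurable.pred step_space P"
    and "AE w in step_dist. AE \<omega> in step_space. P (case_nat w \<omega>)"
  shows "AE \<omega> in step_space. P \<omega>"
proof -
  have "AE x in step_dist \<Otimes>\<^sub>M step_space. P (case x of (w, \<omega>) \<Rightarrow> case_nat w \<omega>)"
    using measurable_compose[OF measurable_case_nat_step_space P] assms(2)
    by (intro step_pair.AE_pair_measure) (auto simp: pred_def)
  then have "AE \<omega> in distr (step_dist \<Otimes>\<^sub>M step_space) step_space (\<lambda>(w, \<omega>). case_nat w \<omega>). P \<omega>"
    using P by (subst AE_distr_iff) (auto simp: pred_def)
  then show ?thesis unfolding distr_step_space .
qed

lemma AE_step_space_norm: "AE \<omega> in step_space. \<forall>n. norm (\<omega> n) < 1"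
  unfolding AE_all_countable step_space_def
  by (intro allI AE_PiM_component AE_step_dist) (auto intro: step.prob_space_axioms)

text \<open>The probability \<open>p\<close> that all steps are shorter than \<open>1/2\<close> satisfies
  \<open>p = \<theta> * p\<close> with \<open>\<theta> < 1\<close>.\<close>

lemma AE_step_space_long_steps:
  "AE \<omega> in step_space. \<forall>N. \<exists>n\<ge>N. 1/2 \<le> norm (\<omega> n)"
proof -
  define B where "B N = {\<omega>. \<forall>n\<ge>N. norm (\<omega> n :: real \<times> real) < 1/2}" for N :: nat
  have meas: "B N \<in> sets step_space" for N
  proof -
    have "{\<omega> \<in> space step_space. \<forall>n\<ge>N. norm (\<omega> n) < 1/2} \<in> sets step_space" by measurable
    then show ?thesis by (simp add: B_def)
  qed
  have ind: "indicator (B 0) (case_nat w \<omega>) = (indicator (ball 0 (1/2)) w * indicator (B 0) \<omega> :: ennreal)"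
    for w \<omega>
  proof -
    have "(\<forall>n. P n) \<longleftrightarrow> P 0 \<and> (\<forall>n. P (Suc n))" for P by (metis not0_implies_Suc)
    from this[of "\<lambda>n. norm (case_nat w \<omega> n) < 1/2"] show ?thesis
      by (simp add: B_def indicator_def)
  qed
  have "emeasure step_space (B 0) = (\<integral>\<^sup>+w. \<integral>\<^sup>+\<omega>. indicator (ball 0 (1/2)) w * indicator (B 0) \<omega> \<partial>step_space \<partial>step_dist)"
    using meas[of 0] by (subst nn_integral_indicator[symmetric], simp, subst nn_integral_step_space)
      (auto simp: ind)
  also have "\<dots> = emeasure step_dist (ball 0 (1/2)) * emeasure step_space (B 0)"
    using meas[of 0] by (simp add: nn_integral_cmult del: emeasure_uniform_measure)
      (subst nn_integral_multc, auto simp del: emeasure_uniform_measure intro!: borel_measurable_indicator)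
  finally have eq: "emeasure step_space (B 0) = emeasure step_dist (ball 0 (1/2)) * emeasure step_space (B 0)" .
  \<comment> \<open>The annulus between the radii 1/2 and 1 has positive mass, so a single step is
    shorter than 1/2 with probability below 1.\<close>
  define U :: "(real \<times> real) set" where "U = ball 0 1 - cball 0 (1/2)"
  have "open U" "U \<subseteq> ball 0 1" by (auto simp: U_def)
  moreover have "(3/4, 0) \<in> U" by (simp add: U_def norm_Pair)
  ultimately have "0 < emeasure step_dist U" by (intro emeasure_step_dist_pos) auto
  then have "measure step_dist U \<noteq> 0" by (metis step.emeasure_eq_measure ennreal_0 less_irrefl)
  moreover have "measure step_dist (ball 0 (1/2) \<union> U) = measure step_dist (ball 0 (1/2)) + measure step_dist U"
    using \<open>open U\<close> by (intro step.finite_measure_Union) (auto simp: U_def)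
  moreover have "measure step_dist (ball 0 (1/2) \<union> U) \<le> 1" by (rule step.prob_le_1)
  ultimately have "measure step_dist (ball 0 (1/2)) \<noteq> 1"
    using measure_nonneg[of step_dist U] by linarith
  moreover have "measure step_space (B 0) = measure step_dist (ball 0 (1/2)) * measure step_space (B 0)"
    unfolding Sigma_Algebra.measure_def by (metis eq enn2real_mult)
  ultimately have "measure step_space (B 0) = 0" by auto
  then have "B 0 \<in> null_sets step_space"
    using meas[of 0] by (simp add: step_space.emeasure_eq_measure null_sets_def)
  then have B0: "AE \<omega> in step_space. \<omega> \<notin> B 0" by (rule AE_not_in)
  \<comment> \<open>Dropping the first coordinate turns \<open>B (Suc N)\<close> into
    \<open>B N\<close>, which reduces every tail event to \<open>B 0\<close>.\<close>
  have "AE \<omega> in step_space. \<omega> \<notin> B N" for N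
  proof (induction N)
    case (Suc N)
    have shift: "case_nat w \<omega> \<in> B (Suc N) \<longleftrightarrow> \<omega> \<in> B N" for w \<omega>
      by (auto simp: B_def split: nat.splits)
    have [measurable]: "B (Suc N) \<in> sets step_space" by (rule meas)
    show ?case
      by (rule AE_step_space_case_nat) (use Suc in \<open>auto simp: shift\<close>)
  qed (rule B0)
  then have "AE \<omega> in step_space. \<forall>N. \<omega> \<notin> B N" by (simp add: AE_all_countable)
  then show ?thesis by eventually_elim (force simp: B_def not_less)
qed

section \<open>The walk as a Markov chain in the domain\<close>

definition walk_step :: "heis set \<Rightarrow> real \<Rightarrow> heis \<Rightarrow> real \<times> real \<Rightarrow> heis" where
  "walk_step D \<epsilon> q w = hshift (min \<epsilon> (hsetdist q (frontier D))) q w"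

lemma walk_Suc: "walk D \<epsilon> q \<omega> (Suc n) = walk_step D \<epsilon> (walk D \<epsilon> q \<omega> n) (\<omega> n)"
  by (simp add: walk_step_def hshift_def Let_def)

declare walk.simps(2) [simp del]

text \<open>The recursion of \<open>walk\<close> appends the last step. Exposing the first one
  instead is what the splitting of the sample space requires.\<close>

lemma walk_case_nat: "walk D \<epsilon> q (case_nat w \<omega>) (Suc n) = walk D \<epsilon> (walk_step D \<epsilon> q w) \<omega> n"
  by (induction n) (simp_all add: walk_Suc)

lemma exit_pt_case_nat: "exit_pt D \<epsilon> q (case_nat w \<omega>) = exit_pt D \<epsilon> (walk_step D \<epsilon> q w) \<omega>"
proof -
  have "walk D \<epsilon> q (case_nat w \<omega>) \<longlonglongrightarrow> l \<longleftrightarrow> walk D \<epsilon> (walk_step D \<epsilon> q w) \<omega> \<longlonglongrightarrow> l" for l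
    using filterlim_sequentially_Suc[of "walk D \<epsilon> q (case_nat w \<omega>)"] by (simp add: walk_case_nat)
  then show ?thesis by (simp add: exit_pt_def lim_def)
qed

locale walk_domain =
  fixes D :: "heis set" and \<epsilon> :: real
  assumes D: "open D" "bounded D" "D \<noteq> {}" and eps: "0 < \<epsilon>"
begin

lemma frontier_nonempty: "frontier D \<noteq> {}"
  using D by (metis frontier_eq_empty not_bounded_UNIV)

lemma compact_frontier: "compact (frontier D)"
  using D(2) by (rule compact_frontier_bounded)

lemma frontier_disjoint: "frontier D \<inter> D = {}"
  using D(1) by (auto simp: frontier_def interior_open)

lemma hsetdist_frontier_pos:
  assumes "q \<in> D"
  shows "0 < hsetdist q (frontier D)"
proof -
  have "{q} \<inter> frontier D = {}" using assms frontier_disjoint by blast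
  with hsetdist_pos_on_compact[OF compact_frontier frontier_nonempty compact_sing]
  obtain m where "0 < m" "m \<le> hsetdist q (frontier D)" by (metis insertI1)
  then show ?thesis by simp
qed

lemma walk_step_in: "q \<in> D \<Longrightarrow> norm w < 1 \<Longrightarrow> walk_step D \<epsilon> q w \<in> D"
  unfolding walk_step_def using D frontier_nonempty hsetdist_frontier_pos[of q] eps
  by (intro hshift_in_domain) auto

lemma AE_walk_step_in: "q \<in> D \<Longrightarrow> AE w in step_dist. walk_step D \<epsilon> q w \<in> D"
  using AE_step_dist by eventually_elim (rule walk_step_in)

lemma borel_measurable_walk_step [measurable]:
  assumes "f \<in> borel_measurable M" "g \<in> borel_measurable M"
  shows "(\<lambda>x. walk_step D \<epsilon> (f x) (g x)) \<in> borel_measurable M"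
proof -
  have "(\<lambda>x. hsetdist (f x) (frontier D)) \<in> borel_measurable M"
    by (rule measurable_compose[OF assms(1) borel_measurable_hsetdist[OF frontier_nonempty]])
  then have "(\<lambda>x. min \<epsilon> (hsetdist (f x) (frontier D))) \<in> borel_measurable M"
    by (intro borel_measurable_min borel_measurable_const)
  then show ?thesis
    unfolding walk_step_def by (rule borel_measurable_hshift[OF _ assms])
qed

lemma borel_measurable_walk [measurable]:
  assumes [measurable]: "f \<in> borel_measurable M" "g \<in> M \<rightarrow>\<^sub>M step_space"
  shows "(\<lambda>x. walk D \<epsilon> (f x) (g x) n) \<in> borel_measurable M"
proof (induction n)
  case (Suc n)
  have "(\<lambda>x. g x n) \<in> borel_measurable M"
    by (rule measurable_compose[OF assms(2) measurable_step_space_component])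
  then show ?case unfolding walk_Suc using Suc by (intro borel_measurable_walk_step)
qed simp

lemma borel_measurable_exit_pt [measurable]:
  assumes [measurable]: "f \<in> borel_measurable M" "g \<in> M \<rightarrow>\<^sub>M step_space"
  shows "(\<lambda>x. exit_pt D \<epsilon> (f x) (g x)) \<in> borel_measurable M"
  unfolding exit_pt_def by measurable

lemma AE_walk_in: "q \<in> D \<Longrightarrow> AE \<omega> in step_space. \<forall>n. walk D \<epsilon> q \<omega> n \<in> D"
  using AE_step_space_norm
proof eventually_elim
  case (elim \<omega>)
  have "walk D \<epsilon> q \<omega> n \<in> D" for n
    by (induction n) (use elim in \<open>auto simp: walk_Suc walk_step_in\<close>)
  then show ?case ..
qed

text \<open>Doob's maximal inequality; conditioning on the first step replaces the usual stopping time.\<close>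

lemma doob_submartingale:
  fixes f :: "heis \<Rightarrow> ennreal"
  assumes f [measurable]: "f \<in> borel_measurable borel"
    and sub: "\<And>p. p \<in> D \<Longrightarrow> f p \<le> (\<integral>\<^sup>+w. f (walk_step D \<epsilon> p w) \<partial>step_dist)"
    and q: "q \<in> D"
  shows "f q \<le> (\<integral>\<^sup>+\<omega>. f (walk D \<epsilon> q \<omega> n) \<partial>step_space)"
    and "c * emeasure step_space {\<omega>. \<exists>k\<le>n. c \<le> f (walk D \<epsilon> q \<omega> k)} \<le> (\<integral>\<^sup>+\<omega>. f (walk D \<epsilon> q \<omega> n) \<partial>step_space)"
proof -
  have Suc_n: "(\<integral>\<^sup>+\<omega>. f (walk D \<epsilon> p \<omega> (Suc n)) \<partial>step_space) =
      (\<integral>\<^sup>+w. \<integral>\<^sup>+\<omega>. f (walk D \<epsilon> (walk_step D \<epsilon> p w) \<omega> n) \<partial>step_space \<partial>step_dist)" for p n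
    by (subst nn_integral_step_space) (simp_all add: walk_case_nat)
  have 1: "f q \<le> (\<integral>\<^sup>+\<omega>. f (walk D \<epsilon> q \<omega> n) \<partial>step_space)" if "q \<in> D" for q n
    using that
  proof (induction n arbitrary: q)
    case 0 show ?case by (simp add: step_space.emeasure_space_1)
  next
    case (Suc n)
    show ?case
      unfolding Suc_n using sub[OF Suc.prems]
      by (rule order_trans)
        (intro nn_integral_mono_AE eventually_mono[OF AE_walk_step_in[OF Suc.prems]] Suc.IH)
  qed
  from q show "f q \<le> (\<integral>\<^sup>+\<omega>. f (walk D \<epsilon> q \<omega> n) \<partial>step_space)" by (rule 1)
  define A where "A q n = {\<omega>. \<exists>k\<le>n. c \<le> f (walk D \<epsilon> q \<omega> k)}" for q n
  have A: "A q n \<in> sets step_space" for q n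
  proof -
    have "{\<omega> \<in> space step_space. \<exists>k\<le>n. c \<le> f (walk D \<epsilon> q \<omega> k)} \<in> sets step_space" by measurable
    then show ?thesis by (simp add: A_def)
  qed
  have "c * emeasure step_space (A q n) \<le> (\<integral>\<^sup>+\<omega>. f (walk D \<epsilon> q \<omega> n) \<partial>step_space)"
    using q
  proof (induction n arbitrary: q)
    case 0
    show ?case by (cases "c \<le> f q") (simp_all add: A_def step_space.emeasure_space_1)
  next
    case (Suc n)
    show ?case
    \<comment> \<open>If the level is reached at time 0, the submartingale bound \<open>f q\<close>
      suffices, the event having measure at most 1. Otherwise the event concerns only the walk
      restarted after one step, and the induction hypothesis applies to it.\<close>
    proof (cases "c \<le> f q")
      case True
      have "c * emeasure step_space (A q (Suc n)) \<le> c * 1"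
        by (intro mult_left_mono step_space.emeasure_le_1) auto
      also have "\<dots> \<le> f q" using True by simp
      finally show ?thesis using 1[OF Suc.prems] by (rule order_trans)
    next
      case False
      have ex: "(\<exists>k\<le>Suc n. P k) \<longleftrightarrow> P 0 \<or> (\<exists>k\<le>n. P (Suc k))" for P
        by (metis Suc_le_mono not0_implies_Suc zero_le)
      have ind: "(indicator (A q (Suc n)) (case_nat w \<omega>) :: ennreal) = indicator (A (walk_step D \<epsilon> q w) n) \<omega>" for w \<omega>
        using False by (simp add: A_def ex walk_case_nat indicator_def)
      have m: "(\<lambda>x. indicator (A (walk_step D \<epsilon> q (fst x)) n) (snd x) :: ennreal)
          \<in> borel_measurable (step_dist \<Otimes>\<^sub>M step_space)"
        unfolding A_def by measurable
      have "c * emeasure step_space (A q (Suc n)) =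
          c * (\<integral>\<^sup>+w. \<integral>\<^sup>+\<omega>. indicator (A (walk_step D \<epsilon> q w) n) \<omega> \<partial>step_space \<partial>step_dist)"
        using A by (subst nn_integral_indicator[symmetric], simp, subst nn_integral_step_space)
          (auto simp: ind)
      also have "\<dots> = (\<integral>\<^sup>+w. c * emeasure step_space (A (walk_step D \<epsilon> q w) n) \<partial>step_dist)"
        using A step_space.borel_measurable_nn_integral_fst[OF m]
        by (subst nn_integral_cmult[symmetric]) (simp_all)
      also have "\<dots> \<le> (\<integral>\<^sup>+\<omega>. f (walk D \<epsilon> q \<omega> (Suc n)) \<partial>step_space)"
        unfolding Suc_n by (intro nn_integral_mono_AE eventually_mono[OF AE_walk_step_in[OF Suc.prems]] Suc.IH)
      finally show ?thesis .
    qed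
  qed
  then show "c * emeasure step_space {\<omega>. \<exists>k\<le>n. c \<le> f (walk D \<epsilon> q \<omega> k)} \<le> (\<integral>\<^sup>+\<omega>. f (walk D \<epsilon> q \<omega> n) \<partial>step_space)"
    by (simp add: A_def)
qed

end

text \<open>The horizontal frame: the values at \<open>q\<close> of the vector fields \<open>X\<close> and \<open>Y\<close>.\<close>

definition X_vec :: "heis \<Rightarrow> heis" where "X_vec q = (1, 0, - fst (snd q) / 2)"
definition Y_vec :: "heis \<Rightarrow> heis" where "Y_vec q = (0, 1, fst q / 2)"

lemma hshift_frame: "hshift e q w = q + (e * fst w) *\<^sub>R X_vec q + (e * snd w) *\<^sub>R Y_vec q"
  by (simp add: hshift_eq X_vec_def Y_vec_def prod_eq_iff algebra_simps diff_divide_distrib)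

text \<open>For fixed \<open>e\<close> and \<open>q\<close> the displacement is linear in
  \<open>w\<close>, also in the vertical coordinate. Centred steps therefore make the walk a
  martingale in Euclidean coordinates.\<close>

lemma hshift_mean:
  "integrable step_dist (hshift e q)" "(\<integral>w. hshift e q w \<partial>step_dist) = q"
proof -
  show "integrable step_dist (hshift e q)"
    unfolding hshift_frame[abs_def]
    by (auto intro!: Bochner_Integration.integrable_add integrable_step_dist_moments)
  show "(\<integral>w. hshift e q w \<partial>step_dist) = q"
    using step.prob_space
    by (simp add: hshift_frame integrable_step_dist_moments step_dist_moments)
qed

section \<open>Martingale identities and almost sure convergence\<close>

context walk_domain
begin

lemma bounded_domain: obtains R where "\<And>p. p \<in> D \<Longrightarrow> norm p \<le> R" "0 < R"
  using D(2) bounded_pos by metis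

lemma borel_measurable_walk_step_dist: "walk_step D \<epsilon> q \<in> borel_measurable step_dist"
  by (subst measurable_cong_sets[of step_dist borel borel borel])
    (auto intro: borel_measurable_walk_step[of "\<lambda>_. q" borel "\<lambda>w. w", simplified])

lemma integrable_step_bounded_on_domain:
  fixes f :: "heis \<Rightarrow> 'b::{banach, second_countable_topology}"
  assumes f: "f \<in> borel_measurable borel" and "\<And>p. p \<in> D \<Longrightarrow> norm (f p) \<le> B" and q: "q \<in> D"
  shows "integrable step_dist (\<lambda>w. f (walk_step D \<epsilon> q w))"
proof (rule step.integrable_const_bound[of _ B])
  show "AE w in step_dist. norm (f (walk_step D \<epsilon> q w)) \<le> B"
    using AE_walk_step_in[OF q] by eventually_elim (rule assms)
  show "(\<lambda>w. f (walk_step D \<epsilon> q w)) \<in> borel_measurable step_dist"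
    by (rule measurable_compose[OF borel_measurable_walk_step_dist f])
qed

lemma borel_measurable_walk':
  "(\<lambda>\<omega>. walk D \<epsilon> q \<omega> n) \<in> borel_measurable step_space"
  by (rule borel_measurable_walk) auto

lemma integrable_walk_bounded_on_domain:
  fixes f :: "heis \<Rightarrow> heis \<Rightarrow> 'b::{banach, second_countable_topology}"
  assumes f: "(\<lambda>x. f (fst x) (snd x)) \<in> borel_measurable borel"
    and "\<And>p p'. p \<in> D \<Longrightarrow> p' \<in> D \<Longrightarrow> norm (f p p') \<le> B" and q: "q \<in> D"
  shows "integrable step_space (\<lambda>\<omega>. f (walk D \<epsilon> q \<omega> n) (walk D \<epsilon> q \<omega> m))"
proof (rule step_space.integrable_const_bound[of _ B])
  show "AE \<omega> in step_space. norm (f (walk D \<epsilon> q \<omega> n) (walk D \<epsilon> q \<omega> m)) \<le> B"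
    using AE_walk_in[OF q] by eventually_elim (simp add: assms)
  show "(\<lambda>\<omega>. f (walk D \<epsilon> q \<omega> n) (walk D \<epsilon> q \<omega> m)) \<in> borel_measurable step_space"
    using measurable_compose[OF borel_measurable_Pair[OF borel_measurable_walk' borel_measurable_walk'] f]
    by simp
qed

lemma norm_diff_square_le:
  fixes p p' :: "'b::real_normed_vector"
  assumes "norm p \<le> R" "norm p' \<le> R"
  shows "norm ((norm (p - p'))\<^sup>2) \<le> 4 * R\<^sup>2"
  using power_mono[of "norm (p - p')" "2 * R" 2] norm_triangle_ineq4[of p p'] assms by simp

lemma integrable_walk_square:
  assumes "q \<in> D"
  shows "integrable step_space (\<lambda>\<omega>. (norm (walk D \<epsilon> q \<omega> n))\<^sup>2)"
    and "integrable step_space (\<lambda>\<omega>. (norm (walk D \<epsilon> q \<omega> n - walk D \<epsilon> q \<omega> m))\<^sup>2)"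
    and "integrable step_space (\<lambda>\<omega>. walk D \<epsilon> q \<omega> n)"
proof -
  obtain R where R: "\<And>p. p \<in> D \<Longrightarrow> norm p \<le> R" "0 < R" using bounded_domain by metis
  show "integrable step_space (\<lambda>\<omega>. (norm (walk D \<epsilon> q \<omega> n))\<^sup>2)"
    using R by (intro integrable_walk_bounded_on_domain[where f = "\<lambda>p p'. (norm p)\<^sup>2" and B = "R\<^sup>2"] assms)
      (auto intro!: borel_measurable_continuous_onI continuous_intros simp del: split_paired_All)
  show "integrable step_space (\<lambda>\<omega>. walk D \<epsilon> q \<omega> n)"
    using R by (intro integrable_walk_bounded_on_domain[where f = "\<lambda>p p'. p" and B = "R"] assms)
      (auto intro!: borel_measurable_continuous_onI continuous_intros simp del: split_paired_All)
  show "integrable step_space (\<lambda>\<omega>. (norm (walk D \<epsilon> q \<omega> n - walk D \<epsilon> q \<omega> m))\<^sup>2)"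
    by (intro integrable_walk_bounded_on_domain[where f = "\<lambda>p p'. (norm (p - p'))\<^sup>2" and B = "4 * R\<^sup>2"]
        assms norm_diff_square_le R borel_measurable_continuous_onI continuous_intros)
qed

lemma borel_measurable_walk_expectation:
  fixes f :: "heis \<Rightarrow> heis \<Rightarrow> 'b::{banach, second_countable_topology}"
  assumes f: "(\<lambda>x. f (fst x) (snd x)) \<in> borel_measurable borel"
  shows "(\<lambda>q. \<integral>\<omega>. f (walk D \<epsilon> q \<omega> n) (walk D \<epsilon> q \<omega> m) \<partial>step_space) \<in> borel_measurable borel"
proof (rule step_space.borel_measurable_lebesgue_integral)
  have m: "(\<lambda>x. walk D \<epsilon> (fst x) (snd x) k) \<in> borel_measurable (borel \<Otimes>\<^sub>M step_space)" for k
    by (rule borel_measurable_walk) auto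
  show "(\<lambda>(q, \<omega>). f (walk D \<epsilon> q \<omega> n) (walk D \<epsilon> q \<omega> m)) \<in> borel_measurable (borel \<Otimes>\<^sub>M step_space)"
    using measurable_compose[OF borel_measurable_Pair[OF m m] f] by (simp add: case_prod_beta')
qed

text \<open>Two positions are allowed in \<open>f\<close> so that squared norms and squared
  increments are both covered. Knowing the inner expectation \<open>g\<close> on \<open>D\<close> is
  enough, because a step from \<open>D\<close> stays in \<open>D\<close> almost surely.\<close>

lemma walk_expectation_Suc:
  fixes f :: "heis \<Rightarrow> heis \<Rightarrow> 'b::{banach, second_countable_topology}"
  assumes f: "(\<lambda>x. f (fst x) (snd x)) \<in> borel_measurable borel"
    and B: "\<And>p p'. p \<in> D \<Longrightarrow> p' \<in> D \<Longrightarrow> norm (f p p') \<le> B" and q: "q \<in> D"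
    and eq: "\<And>p. p \<in> D \<Longrightarrow> (\<integral>\<omega>. f (walk D \<epsilon> p \<omega> n) (walk D \<epsilon> p \<omega> m) \<partial>step_space) = g p"
    and g: "g \<in> borel_measurable borel"
  shows "(\<integral>\<omega>. f (walk D \<epsilon> q \<omega> (Suc n)) (walk D \<epsilon> q \<omega> (Suc m)) \<partial>step_space) =
    (\<integral>w. g (walk_step D \<epsilon> q w) \<partial>step_dist)"
proof -
  note ws = borel_measurable_walk_step_dist
  have "(\<integral>\<omega>. f (walk D \<epsilon> q \<omega> (Suc n)) (walk D \<epsilon> q \<omega> (Suc m)) \<partial>step_space) =
    (\<integral>w. \<integral>\<omega>. f (walk D \<epsilon> (walk_step D \<epsilon> q w) \<omega> n) (walk D \<epsilon> (walk_step D \<epsilon> q w) \<omega> m) \<partial>step_space \<partial>step_dist)"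
    by (subst integral_step_space) (simp_all add: walk_case_nat integrable_walk_bounded_on_domain[OF f B q])
  also have "\<dots> = (\<integral>w. g (walk_step D \<epsilon> q w) \<partial>step_dist)"
  proof (rule integral_cong_AE)
    show "AE w in step_dist. (\<integral>\<omega>. f (walk D \<epsilon> (walk_step D \<epsilon> q w) \<omega> n) (walk D \<epsilon> (walk_step D \<epsilon> q w) \<omega> m) \<partial>step_space)
        = g (walk_step D \<epsilon> q w)"
      using AE_walk_step_in[OF q] by eventually_elim (rule eq)
  qed (use measurable_compose[OF ws borel_measurable_walk_expectation[OF f]] measurable_compose[OF ws g] in auto)
  finally show ?thesis .
qed

lemma walk_step_mean: "(\<integral>w. walk_step D \<epsilon> q w \<partial>step_dist) = q"
  unfolding walk_step_def by (rule hshift_mean)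

lemma walk_mean:
  assumes "q \<in> D"
  shows "(\<integral>\<omega>. walk D \<epsilon> q \<omega> n \<partial>step_space) = q"
  using assms
proof (induction n arbitrary: q)
  case (Suc n)
  obtain R where R: "\<And>p. p \<in> D \<Longrightarrow> norm p \<le> R" "0 < R" using bounded_domain by metis
  show ?case
    using walk_expectation_Suc[where f = "\<lambda>p p'. p" and B = R and n = n and g = "\<lambda>p. p", OF _ R(1) Suc.prems Suc.IH]
    by (simp add: walk_step_mean borel_measurable_continuous_onI continuous_on_fst)
qed simp

text \<open>Martingale increments are orthogonal to the past. Conditioning on the first step reduces
  the identity to \<open>N = 0\<close>, where the cross term has expectation
  \<open>2 * (q \<bullet> q)\<close> by \<open>walk_mean\<close>.\<close>

lemma walk_square_increment:
  assumes "q \<in> D"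
  shows "(\<integral>\<omega>. (norm (walk D \<epsilon> q \<omega> (n + N) - walk D \<epsilon> q \<omega> N))\<^sup>2 \<partial>step_space) =
    (\<integral>\<omega>. (norm (walk D \<epsilon> q \<omega> (n + N)))\<^sup>2 \<partial>step_space) - (\<integral>\<omega>. (norm (walk D \<epsilon> q \<omega> N))\<^sup>2 \<partial>step_space)"
  using assms
proof (induction N arbitrary: q)
  case 0
  have "(norm (walk D \<epsilon> q \<omega> n - q))\<^sup>2 = (norm (walk D \<epsilon> q \<omega> n))\<^sup>2 - 2 * (walk D \<epsilon> q \<omega> n \<bullet> q) + (norm q)\<^sup>2" for \<omega>
    by (simp add: power2_norm_eq_inner inner_diff_left inner_diff_right inner_commute)
  then have "(\<integral>\<omega>. (norm (walk D \<epsilon> q \<omega> n - q))\<^sup>2 \<partial>step_space) =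
     (\<integral>\<omega>. (norm (walk D \<epsilon> q \<omega> n))\<^sup>2 \<partial>step_space) - 2 * (q \<bullet> q) + (norm q)\<^sup>2"
    using integrable_walk_square[OF 0] walk_mean[OF 0, of n] by simp
  then show ?case by (simp add: power2_norm_eq_inner)
next
  case (Suc N)
  obtain R where R: "\<And>p. p \<in> D \<Longrightarrow> norm p \<le> R" "0 < R" using bounded_domain by metis
  have B: "norm ((norm p)\<^sup>2) \<le> R\<^sup>2" if "p \<in> D" for p
    using R(1)[OF that] by (simp add: power_mono)
  have B2: "norm ((norm (p - p'))\<^sup>2) \<le> 4 * R\<^sup>2" if "p \<in> D" "p' \<in> D" for p p'
    using that by (intro norm_diff_square_le R)
  define V where "V k p = (\<integral>\<omega>. (norm (walk D \<epsilon> p \<omega> k))\<^sup>2 \<partial>step_space)" for k p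
  have m1: "(\<lambda>x :: heis \<times> heis. (norm (fst x))\<^sup>2) \<in> borel_measurable borel"
    and m2: "(\<lambda>x :: heis \<times> heis. (norm (fst x - snd x))\<^sup>2) \<in> borel_measurable borel"
    by (auto intro!: borel_measurable_continuous_onI continuous_intros)
  have mV: "V k \<in> borel_measurable borel" for k
    unfolding V_def[abs_def] using borel_measurable_walk_expectation[where f = "\<lambda>p p'. (norm p)\<^sup>2"] m1 by simp
  have VB: "norm (V k p) \<le> R\<^sup>2" if "p \<in> D" for k p
  proof -
    have "norm (V k p) \<le> (\<integral>\<omega>. norm ((norm (walk D \<epsilon> p \<omega> k))\<^sup>2) \<partial>step_space)"
      unfolding V_def by (rule integral_norm_bound)
    also have "\<dots> \<le> (\<integral>\<omega>. R\<^sup>2 \<partial>step_space)"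
    proof (rule integral_mono_AE)
      show "AE \<omega> in step_space. norm ((norm (walk D \<epsilon> p \<omega> k))\<^sup>2) \<le> R\<^sup>2"
        using AE_walk_in[OF that] by eventually_elim (use B in blast)
    qed (use integrable_walk_square[OF that] in auto)
    finally show ?thesis by simp
  qed
  have V: "V (Suc k) q = (\<integral>w. V k (walk_step D \<epsilon> q w) \<partial>step_dist)" for k
    unfolding V_def[of "Suc k"]
    by (rule walk_expectation_Suc[where f = "\<lambda>p p'. (norm p)\<^sup>2", OF m1 B Suc.prems])
      (simp_all add: mV flip: V_def)
  have "(\<integral>\<omega>. (norm (walk D \<epsilon> q \<omega> (Suc (n + N)) - walk D \<epsilon> q \<omega> (Suc N)))\<^sup>2 \<partial>step_space) =
      (\<integral>w. V (n + N) (walk_step D \<epsilon> q w) - V N (walk_step D \<epsilon> q w) \<partial>step_dist)"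
    using mV Suc.IH
    by (intro walk_expectation_Suc[where f = "\<lambda>p p'. (norm (p - p'))\<^sup>2", OF m2 B2 Suc.prems])
      (auto simp flip: V_def)
  also have "\<dots> = V (Suc (n + N)) q - V (Suc N) q"
    unfolding V
    by (intro Bochner_Integration.integral_diff integrable_step_bounded_on_domain[OF mV VB Suc.prems])
  finally show ?case by (simp add: V_def)
qed

text \<open>For \<open>N = 0\<close> this is the maximal inequality for the submartingale given by
  the squared distance to the start. A later reference time is reached by conditioning on one step
  after another.\<close>

lemma walk_maximal_inequality:
  assumes "q \<in> D"
  shows "ennreal (c\<^sup>2) * emeasure step_space {\<omega>. \<exists>k\<le>n. c\<^sup>2 \<le> (norm (walk D \<epsilon> q \<omega> (k + N) - walk D \<epsilon> q \<omega> N))\<^sup>2}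
    \<le> (\<integral>\<^sup>+\<omega>. ennreal ((norm (walk D \<epsilon> q \<omega> (n + N) - walk D \<epsilon> q \<omega> N))\<^sup>2) \<partial>step_space)"
proof -
  define A where "A q N = {\<omega>. \<exists>k\<le>n. c\<^sup>2 \<le> (norm (walk D \<epsilon> q \<omega> (k + N) - walk D \<epsilon> q \<omega> N))\<^sup>2}" for q N
  have A: "A q N \<in> sets step_space" for q N
  proof -
    note [measurable] = borel_measurable_walk'
    have "{\<omega> \<in> space step_space. \<exists>k\<le>n. c\<^sup>2 \<le> (norm (walk D \<epsilon> q \<omega> (k + N) - walk D \<epsilon> q \<omega> N))\<^sup>2} \<in> sets step_space"
      by measurable
    then show ?thesis by (simp add: A_def)
  qed
  have "ennreal (c\<^sup>2) * emeasure step_space (A q N) \<le>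
    (\<integral>\<^sup>+\<omega>. ennreal ((norm (walk D \<epsilon> q \<omega> (n + N) - walk D \<epsilon> q \<omega> N))\<^sup>2) \<partial>step_space)"
    using assms
  proof (induction N arbitrary: q)
    case 0
    have f: "(\<lambda>p. ennreal ((norm (p - q))\<^sup>2)) \<in> borel_measurable borel"
      by (intro measurable_compose[OF _ measurable_ennreal] borel_measurable_continuous_onI continuous_intros)
    have sub: "ennreal ((norm (p - q))\<^sup>2) \<le> (\<integral>\<^sup>+w. ennreal ((norm (walk_step D \<epsilon> p w - q))\<^sup>2) \<partial>step_dist)"
      if p: "p \<in> D" for p
    proof -
      define h where "h w = walk_step D \<epsilon> p w - p" for w
      obtain R where R: "\<And>p. p \<in> D \<Longrightarrow> norm p \<le> R" "0 < R" using bounded_domain by metis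
      have i: "integrable step_dist h" "integrable step_dist (\<lambda>w. (norm (walk_step D \<epsilon> p w - q))\<^sup>2)"
      proof -
        have bd: "norm (p' - p'') \<le> 2 * R" if "p' \<in> D" "p'' \<in> D" for p' p''
          using norm_triangle_ineq4[of p' p''] R(1)[OF that(1)] R(1)[OF that(2)] by linarith
        show "integrable step_dist h"
          unfolding h_def
          by (rule integrable_step_bounded_on_domain[where f = "\<lambda>x. x - p" and B = "2 * R", OF _ bd[OF _ p] p])
            (intro borel_measurable_continuous_onI continuous_intros)
        show "integrable step_dist (\<lambda>w. (norm (walk_step D \<epsilon> p w - q))\<^sup>2)"
          by (rule integrable_step_bounded_on_domain[where f = "\<lambda>x. (norm (x - q))\<^sup>2" and B = "4 * R\<^sup>2", OF _ _ p])
            (intro norm_diff_square_le R \<open>q \<in> D\<close> borel_measurable_continuous_onI continuous_intros)+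
      qed
      have h0: "(\<integral>w. h w \<partial>step_dist) = 0"
        unfolding h_def using walk_step_mean[of p] step.prob_space
          integrable_step_bounded_on_domain[where f = "\<lambda>x. x", OF _ R(1) p]
        by (subst Bochner_Integration.integral_diff) auto
      \<comment> \<open>Jensen's inequality for the squared norm, by its supporting affine function
        at \<open>p - q\<close>; the linear term integrates to zero.\<close>
      have "(norm (p - q))\<^sup>2 = (\<integral>w. (norm (p - q))\<^sup>2 + 2 * (h w \<bullet> (p - q)) \<partial>step_dist)"
        using h0 i(1) step.prob_space by simp
      also have "\<dots> \<le> (\<integral>w. (norm (walk_step D \<epsilon> p w - q))\<^sup>2 \<partial>step_dist)"
      proof (rule integral_mono)
        show "(norm (p - q))\<^sup>2 + 2 * (h w \<bullet> (p - q)) \<le> (norm (walk_step D \<epsilon> p w - q))\<^sup>2" for w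
        proof -
          have *: "walk_step D \<epsilon> p w - q = h w + (p - q)" by (simp add: h_def)
          have "(norm (h w + v))\<^sup>2 = (norm (h w))\<^sup>2 + 2 * (h w \<bullet> v) + (norm v)\<^sup>2" for v
            by (simp add: power2_norm_eq_inner inner_add_left inner_add_right inner_commute)
          then show ?thesis unfolding * by simp
        qed
      qed (use i in auto)
      finally show ?thesis
        using i(2) by (simp add: nn_integral_eq_integral)
    qed
    have "{\<omega>. \<exists>k\<le>n. ennreal (c\<^sup>2) \<le> ennreal ((norm (walk D \<epsilon> q \<omega> k - q))\<^sup>2)} = A q 0"
      by (simp add: A_def)
    with doob_submartingale(2)[OF f sub 0, of "ennreal (c\<^sup>2)" n] show ?case by simp
  next
    case (Suc N)
    have ind: "indicator (A q (Suc N)) (case_nat w \<omega>) = (indicator (A (walk_step D \<epsilon> q w) N) \<omega> :: ennreal)" for w \<omega>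
      by (simp add: A_def indicator_def walk_case_nat)
    have m: "(\<lambda>x. indicator (A (walk_step D \<epsilon> q (fst x)) N) (snd x) :: ennreal)
          \<in> borel_measurable (step_dist \<Otimes>\<^sub>M step_space)"
    proof -
      have "(indicator (A q (Suc N)) :: _ \<Rightarrow> ennreal) \<in> borel_measurable step_space" using A by simp
      from measurable_compose[OF measurable_case_nat_step_space this] show ?thesis
        by (simp add: ind case_prod_beta')
    qed
    have "ennreal (c\<^sup>2) * emeasure step_space (A q (Suc N)) =
        ennreal (c\<^sup>2) * (\<integral>\<^sup>+w. \<integral>\<^sup>+\<omega>. indicator (A (walk_step D \<epsilon> q w) N) \<omega> \<partial>step_space \<partial>step_dist)"
      using A by (subst nn_integral_indicator[symmetric], simp, subst nn_integral_step_space)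
        (auto simp: ind)
    also have "\<dots> = (\<integral>\<^sup>+w. ennreal (c\<^sup>2) * emeasure step_space (A (walk_step D \<epsilon> q w) N) \<partial>step_dist)"
      using A step_space.borel_measurable_nn_integral_fst[OF m]
      by (subst nn_integral_cmult[symmetric]) simp_all
    also have "\<dots> \<le> (\<integral>\<^sup>+w. \<integral>\<^sup>+\<omega>. ennreal ((norm (walk D \<epsilon> (walk_step D \<epsilon> q w) \<omega> (n + N) - walk D \<epsilon> (walk_step D \<epsilon> q w) \<omega> N))\<^sup>2) \<partial>step_space \<partial>step_dist)"
      by (intro nn_integral_mono_AE eventually_mono[OF AE_walk_step_in[OF Suc.prems]] Suc.IH)
    also have "\<dots> = (\<integral>\<^sup>+\<omega>. ennreal ((norm (walk D \<epsilon> q \<omega> (n + Suc N) - walk D \<epsilon> q \<omega> (Suc N)))\<^sup>2) \<partial>step_space)"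
    proof -
      note [measurable] = borel_measurable_walk'
      show ?thesis by (subst nn_integral_step_space) (auto simp: walk_case_nat)
    qed
    finally show ?case .
  qed
  then show ?thesis by (simp add: A_def)
qed

text \<open>The second moments \<open>V\<close> increase to a finite limit \<open>L\<close>. By the
  maximal inequality and orthogonality, the walk leaves the ball of radius \<open>c\<close> about
  its position at time \<open>N\<close> at some later time with probability at most
  \<open>(L - V N) / c\<^sup>2\<close>. This tends to zero, so almost every path is Cauchy.\<close>

lemma AE_walk_convergent:
  assumes q: "q \<in> D"
  shows "AE \<omega> in step_space. convergent (walk D \<epsilon> q \<omega>)"
proof -
  obtain R where R: "\<And>p. p \<in> D \<Longrightarrow> norm p \<le> R" "0 < R" using bounded_domain by metis
  define V where "V k = (\<integral>\<omega>. (norm (walk D \<epsilon> q \<omega> k))\<^sup>2 \<partial>step_space)" for k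
  have incr: "V N \<le> V (n + N)" for n N
  proof -
    have "0 \<le> (\<integral>\<omega>. (norm (walk D \<epsilon> q \<omega> (n + N) - walk D \<epsilon> q \<omega> N))\<^sup>2 \<partial>step_space)"
      by (rule integral_nonneg_AE) simp
    then show ?thesis using walk_square_increment[OF q, of n N] by (simp add: V_def)
  qed
  then have inc: "incseq V" by (intro incseq_SucI) (use incr[of _ 1] in simp)
  have VB: "V k \<le> R\<^sup>2" for k
  proof -
    have "V k \<le> (\<integral>\<omega>. R\<^sup>2 \<partial>step_space)"
      unfolding V_def
    proof (rule integral_mono_AE)
      show "AE \<omega> in step_space. (norm (walk D \<epsilon> q \<omega> k))\<^sup>2 \<le> R\<^sup>2"
        using AE_walk_in[OF q] by eventually_elim (simp add: R(1) power_mono)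
    qed (use integrable_walk_square[OF q] in auto)
    then show ?thesis by simp
  qed
  obtain L where L: "V \<longlonglongrightarrow> L" "\<And>k. V k \<le> L"
    using incseq_convergent[OF inc, of "R\<^sup>2"] VB by blast
  have small: "AE \<omega> in step_space. \<exists>N. \<forall>k. norm (walk D \<epsilon> q \<omega> (k + N) - walk D \<epsilon> q \<omega> N) < c" if c: "0 < c" for c
  proof -
    define A where "A N n = {\<omega>. \<exists>k\<le>n. c\<^sup>2 \<le> (norm (walk D \<epsilon> q \<omega> (k + N) - walk D \<epsilon> q \<omega> N))\<^sup>2}" for N n
    have A: "A N n \<in> sets step_space" for N n
    proof -
      note [measurable] = borel_measurable_walk'
      have "{\<omega> \<in> space step_space. \<exists>k\<le>n. c\<^sup>2 \<le> (norm (walk D \<epsilon> q \<omega> (k + N) - walk D \<epsilon> q \<omega> N))\<^sup>2} \<in> sets step_space"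
        by measurable
      then show ?thesis by (simp add: A_def)
    qed
    define B where "B N = (\<Union>n. A N n)" for N
    have B: "B N \<in> sets step_space" for N unfolding B_def using A by auto
    have "c\<^sup>2 * measure step_space (A N n) \<le> L - V N" for N n
    proof -
      have "ennreal (c\<^sup>2 * measure step_space (A N n)) \<le> ennreal (V (n + N) - V N)"
        using walk_maximal_inequality[OF q, of c n N] integrable_walk_square(2)[OF q] walk_square_increment[OF q, of n N]
        by (simp add: A_def V_def nn_integral_eq_integral step_space.emeasure_eq_measure ennreal_mult)
      then have "c\<^sup>2 * measure step_space (A N n) \<le> V (n + N) - V N"
        using incr[of N n] by (simp add: ennreal_le_iff)
      then show ?thesis using L(2)[of "n + N"] by simp
    qed
    note A_le = this
    have A_lim: "(\<lambda>n. c\<^sup>2 * measure step_space (A N n)) \<longlonglongrightarrow> c\<^sup>2 * measure step_space (B N)" for N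
      unfolding B_def using A
      by (intro tendsto_mult_left step_space.finite_Lim_measure_incseq)
        (auto simp: incseq_def A_def intro: order_trans)
    have BN: "c\<^sup>2 * measure step_space (B N) \<le> L - V N" for N
      using LIMSEQ_le_const2[OF A_lim] A_le by blast
    have "measure step_space (\<Inter>N. B N) \<le> 0"
    proof (rule LIMSEQ_le_const)
      show "(\<lambda>N. (L - V N) / c\<^sup>2) \<longlonglongrightarrow> 0"
        using tendsto_divide[OF tendsto_diff[OF tendsto_const L(1)] tendsto_const, of "c\<^sup>2" L] c by simp
      have "measure step_space (\<Inter>N. B N) \<le> measure step_space (B N)" for N
        using B by (intro step_space.finite_measure_mono) auto
      also have "measure step_space (B N) \<le> (L - V N) / c\<^sup>2" for N
        using BN[of N] c by (simp add: field_simps)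
      finally show "\<exists>N. \<forall>n\<ge>N. measure step_space (\<Inter>N. B N) \<le> (L - V n) / c\<^sup>2" by blast
    qed
    moreover have "(\<Inter>N. B N) \<in> sets step_space" using B by auto
    ultimately have "(\<Inter>N. B N) \<in> null_sets step_space"
      by (simp add: null_sets_def step_space.emeasure_eq_measure measure_le_0_iff)
    then have "AE \<omega> in step_space. \<omega> \<notin> (\<Inter>N. B N)" by (rule AE_not_in)
    then show ?thesis
    proof eventually_elim
      case (elim \<omega>)
      then obtain N where N: "\<omega> \<notin> B N" by auto
      have "norm (walk D \<epsilon> q \<omega> (k + N) - walk D \<epsilon> q \<omega> N) < c" for k
      proof -
        have "\<omega> \<notin> A N k" using N by (auto simp: B_def)
        then have "(norm (walk D \<epsilon> q \<omega> (k + N) - walk D \<epsilon> q \<omega> N))\<^sup>2 < c\<^sup>2"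
          by (auto simp: A_def not_le)
        then show ?thesis by (rule power_less_imp_less_base) (use c in simp)
      qed
      then show ?case by blast
    qed
  qed
  \<comment> \<open>Countably many tolerances suffice for the Cauchy property and keep the
    exceptional set null.\<close>
  have "AE \<omega> in step_space. \<forall>m::nat. \<exists>N. \<forall>k. norm (walk D \<epsilon> q \<omega> (k + N) - walk D \<epsilon> q \<omega> N) < inverse (real (Suc m))"
    unfolding AE_all_countable by (intro allI small) auto
  then show ?thesis
  proof eventually_elim
    case (elim \<omega>)
    have "Cauchy (walk D \<epsilon> q \<omega>)"
    proof (rule metric_CauchyI)
      fix e :: real assume "0 < e"
      then obtain m where m: "inverse (real (Suc m)) < e / 2"
        using reals_Archimedean[of "e / 2"] by auto
      obtain N where N: "\<And>k. norm (walk D \<epsilon> q \<omega> (k + N) - walk D \<epsilon> q \<omega> N) < inverse (real (Suc m))"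
        using elim by blast
      have *: "dist (walk D \<epsilon> q \<omega> n) (walk D \<epsilon> q \<omega> N) < e / 2" if "N \<le> n" for n
        using N[of "n - N"] m that by (simp add: dist_norm)
      then show "\<exists>M. \<forall>m\<ge>M. \<forall>n\<ge>M. dist (walk D \<epsilon> q \<omega> m) (walk D \<epsilon> q \<omega> n) < e"
        using dist_triangle_half_l by blast
    qed
    then show ?case by (rule Cauchy_convergent)
  qed
qed

text \<open>Near an interior limit the step length is at least some \<open>min \<epsilon> m\<close>,
  while the gauge distance of consecutive positions tends to zero. All late steps
  \<open>\<omega> n\<close> would then be shorter than 1/2, which almost surely does not
  happen.\<close>

lemma AE_exit_pt_frontier:
  assumes q: "q \<in> D"
  shows "AE \<omega> in step_space. exit_pt D \<epsilon> q \<omega> \<in> frontier D"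
  using AE_walk_convergent[OF q] AE_walk_in[OF q] AE_step_space_long_steps
proof eventually_elim
  case (elim \<omega>)
  define l where "l = exit_pt D \<epsilon> q \<omega>"
  have l: "walk D \<epsilon> q \<omega> \<longlonglongrightarrow> l"
    using elim(1) by (simp add: l_def exit_pt_def convergent_LIMSEQ_iff)
  then have "l \<in> closure D"
    using elim(2) unfolding closure_sequential by blast
  moreover have "l \<notin> D"
  proof
    assume "l \<in> D"
    then obtain r where r: "0 < r" "cball l r \<subseteq> D" using D(1) open_contains_cball by blast
    then have disj: "cball l r \<inter> frontier D = {}" using frontier_disjoint by blast
    obtain m where m: "0 < m" "\<And>p. p \<in> cball l r \<Longrightarrow> m \<le> hsetdist p (frontier D)"
      using hsetdist_pos_on_compact[OF compact_frontier frontier_nonempty compact_cball disj] by metis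
    have "(\<lambda>n. hdist (walk D \<epsilon> q \<omega> n) (walk D \<epsilon> q \<omega> (Suc n))) \<longlonglongrightarrow> hdist l l"
    proof -
      have "continuous_on UNIV (\<lambda>x. hdist (fst x) (snd x))" by (intro continuous_intros)
      from continuous_on_tendsto_compose[OF this tendsto_Pair[OF l LIMSEQ_Suc[OF l]]]
      show ?thesis by simp
    qed
    moreover have "hdist l l = 0" by (simp add: hdist_def)
    ultimately have "(\<lambda>n. hdist (walk D \<epsilon> q \<omega> n) (walk D \<epsilon> q \<omega> (Suc n))) \<longlonglongrightarrow> 0" by simp
    from order_tendstoD(2)[OF this, of "min \<epsilon> m / 2"] have "\<forall>\<^sub>F n in sequentially. hdist (walk D \<epsilon> q \<omega> n) (walk D \<epsilon> q \<omega> (Suc n)) < min \<epsilon> m / 2"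
      using eps m(1) by simp
    moreover have "\<forall>\<^sub>F n in sequentially. walk D \<epsilon> q \<omega> n \<in> cball l r"
      using tendstoD[OF l r(1)] by eventually_elim (simp add: dist_commute)
    ultimately have "\<forall>\<^sub>F n in sequentially. norm (\<omega> n) < 1/2"
    proof eventually_elim
      case (elim n)
      let ?e = "min \<epsilon> (hsetdist (walk D \<epsilon> q \<omega> n) (frontier D))"
      have e: "min \<epsilon> m \<le> ?e" using m(2)[OF elim(2)] by auto
      have "min \<epsilon> m * norm (\<omega> n) \<le> \<bar>?e\<bar> * norm (\<omega> n)"
        using e by (intro mult_right_mono) auto
      also have "\<dots> < min \<epsilon> m / 2"
        using elim(1) by (simp add: walk_Suc walk_step_def hdist_hshift)
      finally have "min \<epsilon> m * norm (\<omega> n) < min \<epsilon> m * (1/2)" by simp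
      then show ?case using eps m(1) by (subst (asm) mult_less_cancel_left_pos) auto
    qed
    then show False
      using elim(3) unfolding eventually_sequentially not_le[symmetric] by blast
  qed
  ultimately show ?case
    using D(1) by (simp add: l_def frontier_def interior_open)
qed

end

subsection \<open>Boundary behaviour and compactness\<close>

lemma norm_hmul_hinv_le: "norm (p \<star> hinv q) \<le> (1 + norm q) * norm (p - q)"
proof -
  have "p \<star> hinv q = (p - q) + (0, 0, (fst q * fst (snd (p - q)) - fst (snd q) * fst (p - q)) / 2)"
    by (simp add: hmul_eq hinv_eq prod_eq_iff algebra_simps)
  also have "norm \<dots> \<le> norm (p - q) + \<bar>fst q * fst (snd (p - q)) - fst (snd q) * fst (p - q)\<bar> / 2"
    by (rule norm_triangle_le) (simp add: norm_Pair)
  finally show ?thesis using norm_hmul_commutator_le[of q "p - q"] by (simp add: algebra_simps)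
qed

lemma ball_infdist_frontier_subset:
  fixes p :: "'a::euclidean_space"
  assumes "p \<in> D" "frontier D \<noteq> {}"
  shows "ball p (infdist p (frontier D)) \<subseteq> D"
proof
  fix p' assume p': "p' \<in> ball p (infdist p (frontier D))"
  show "p' \<in> D"
  proof (rule ccontr)
    assume "p' \<notin> D"
    moreover have "0 < infdist p (frontier D)" using p' by (simp add: order.strict_trans1[OF zero_le_dist])
    ultimately have "p \<in> ball p (infdist p (frontier D)) \<inter> D" "p' \<in> ball p (infdist p (frontier D)) - D"
      using p' assms(1) by auto
    then have "ball p (infdist p (frontier D)) \<inter> frontier D \<noteq> {}"
      by (intro connected_Int_frontier) blast+
    then obtain x where "x \<in> frontier D" "dist p x < infdist p (frontier D)" by auto
    then show False using infdist_le[of x "frontier D" p] by simp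
  qed
qed

lemma infdist_lessE:
  assumes "A \<noteq> {}" "infdist p A < d"
  obtains a where "a \<in> A" "dist p a < d"
  using assms by (auto simp: infdist_notempty cINF_less_iff)

locale boundary_walk =
  fixes D :: "heis set" and F :: "heis \<Rightarrow> real"
  assumes D: "open D" "bounded D" "D \<noteq> {}" and F: "continuous_on (frontier D) F"
begin

lemma walk_domain: "0 < e \<Longrightarrow> walk_domain D e"
  using D by unfold_locales

text \<open>Off the frontier \<open>F\<close> is arbitrary. Its extension by zero is Borel
  measurable and bounded on the whole space and agrees with \<open>F\<close> at almost every exit
  point of a walk from \<open>D\<close>.\<close>

definition boundary_data :: "heis \<Rightarrow> real" where
  "boundary_data p = indicator (frontier D) p *\<^sub>R F p"

lemma borel_measurable_boundary_data [measurable]: "boundary_data \<in> borel_measurable borel"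
  unfolding boundary_data_def[abs_def]
  by (rule borel_measurable_continuous_on_indicator[OF _ F]) simp

definition bound :: real where
  "bound = (SUP p\<in>frontier D. \<bar>F p\<bar>)"

sublocale domain: walk_domain D 1
  by (rule walk_domain) simp

lemma F_le_bound: "p \<in> frontier D \<Longrightarrow> \<bar>F p\<bar> \<le> bound"
  unfolding bound_def
  by (intro cSUP_upper compact_imp_bounded bounded_imp_bdd_above compact_continuous_image
      domain.compact_frontier continuous_on_rabs F)

lemma bound_nonneg: "0 \<le> bound"
  using domain.frontier_nonempty F_le_bound abs_ge_zero order_trans by blast

lemma boundary_data_le: "\<bar>boundary_data p\<bar> \<le> bound"
  using F_le_bound bound_nonneg by (simp add: boundary_data_def indicator_def)

lemma u_eps_eq: "u_eps D F e q = (\<integral>\<omega>. boundary_data (exit_pt D e q \<omega>) \<partial>step_space)"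
  unfolding u_eps_def set_lebesgue_integral_def boundary_data_def
  by (intro Bochner_Integration.integral_cong) (auto simp: indicator_def)

lemma integrable_boundary_data_exit_pt:
  assumes "0 < e"
  shows "integrable step_space (\<lambda>\<omega>. boundary_data (exit_pt D e q \<omega>))"
proof -
  interpret walk_domain D e using assms by (rule walk_domain)
  have "exit_pt D e q \<in> borel_measurable step_space"
    using borel_measurable_exit_pt[of "\<lambda>_. q" step_space "\<lambda>\<omega>. \<omega>"] by simp
  then show ?thesis
    using boundary_data_le
    by (intro step_space.integrable_const_bound[where B = bound]
        measurable_compose[OF _ borel_measurable_boundary_data]) auto
qed

lemma u_eps_le_bound:
  assumes "0 < e"
  shows "\<bar>u_eps D F e q\<bar> \<le> bound"
proof -
  have "\<bar>u_eps D F e q\<bar> \<le> (\<integral>\<omega>. \<bar>boundary_data (exit_pt D e q \<omega>)\<bar> \<partial>step_space)"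
    unfolding u_eps_eq by (rule integral_abs_bound)
  also have "\<dots> \<le> (\<integral>\<omega>. bound \<partial>step_space)"
    using integrable_boundary_data_exit_pt[OF assms] boundary_data_le by (intro integral_mono) auto
  finally show ?thesis by simp
qed

lemma borel_measurable_u_eps:
  assumes "0 < e"
  shows "u_eps D F e \<in> borel_measurable borel"
proof -
  interpret walk_domain D e using assms by (rule walk_domain)
  have m: "(\<lambda>x. exit_pt D e (fst x) (snd x)) \<in> borel_measurable (borel \<Otimes>\<^sub>M step_space)"
    by (rule borel_measurable_exit_pt) auto
  show ?thesis
    unfolding u_eps_eq[abs_def] using measurable_compose[OF m borel_measurable_boundary_data]
    by (intro step_space.borel_measurable_lebesgue_integral) (simp add: case_prod_beta')
qed

text \<open>The second hypothesis makes the first step have the full length \<open>e\<close>, so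
  conditioning on it produces the unmodified average.\<close>

lemma u_eps_mean_value:
  assumes "0 < e" "e \<le> hsetdist q (frontier D)"
  shows "u_eps D F e q = disc_avg e (u_eps D F e) q"
proof -
  have "u_eps D F e q = (\<integral>w. u_eps D F e (walk_step D e q w) \<partial>step_dist)"
    unfolding u_eps_eq
    by (subst integral_step_space) (simp_all add: exit_pt_case_nat integrable_boundary_data_exit_pt assms(1))
  then show ?thesis
    using assms(2) by (simp add: walk_step_def disc_avg_def min_def)
qed

text \<open>Exits near \<open>p\<close> contribute little by continuity of \<open>F\<close>; the
  remaining exits cost at most \<open>2 * bound\<close> each and are improbable by
  walk-regularity.\<close>

lemma boundary_estimate:
  assumes "walk_regular D" and p: "p \<in> frontier D" and "0 < \<eta>"
  obtains \<delta> \<epsilon> where "0 < \<delta>" "0 < \<epsilon>"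
    "\<And>e q. 0 < e \<Longrightarrow> e < \<epsilon> \<Longrightarrow> q \<in> D \<Longrightarrow> dist p q < \<delta> \<Longrightarrow> \<bar>u_eps D F e q - F p\<bar> \<le> \<eta>"
proof -
  obtain d where d: "0 < d" "\<And>p'. p' \<in> frontier D \<Longrightarrow> dist p' p < d \<Longrightarrow> dist (F p') (F p) < \<eta> / 2"
    using F p \<open>0 < \<eta>\<close> unfolding continuous_on_iff by (metis half_gt_zero)
  obtain r where r: "0 < r" "hball p r \<subseteq> ball p d" using hball_subset_ball[OF d(1)] by metis
  \<comment> \<open>The probability of a distant exit is to cost at most \<open>\<eta> / 2\<close>;
    the summand 1 guards against \<open>bound = 0\<close>.\<close>
  define \<zeta> where "\<zeta> = \<eta> / (4 * (bound + 1))"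
  have \<zeta>: "0 < \<zeta>" "2 * bound * \<zeta> \<le> \<eta> / 2"
    using \<open>0 < \<eta>\<close> bound_nonneg by (auto simp: \<zeta>_def field_simps)
  have "walk_regular_at D p" using assms(1) p by (simp add: walk_regular_def)
  from this[unfolded walk_regular_at_def, rule_format, OF \<zeta>(1) r(1)]
  obtain s \<epsilon> where s: "0 < s" "0 < \<epsilon>"
    "\<forall>e q. 0 < e \<and> e < \<epsilon> \<and> q \<in> hball p s \<inter> D \<longrightarrow>
       measure step_space {\<omega>\<in>space step_space. exit_pt D e q \<omega> \<in> hball p r} \<ge> 1 - \<zeta>"
    by blast
  have "p \<in> hball p s" using s(1) by (simp add: hball_def hdist_def koranyi_eq_0_iff[THEN iffD2])
  then obtain \<delta> where \<delta>: "0 < \<delta>" "ball p \<delta> \<subseteq> hball p s"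
    using open_hball by (metis open_contains_ball)
  show thesis
  proof (rule that[OF \<delta>(1) s(2)])
    fix e q assume e: "0 < e" "e < \<epsilon>" and q: "q \<in> D" "dist p q < \<delta>"
    interpret walk_domain D e using e(1) by (rule walk_domain)
    have m: "exit_pt D e q \<in> borel_measurable step_space"
      using borel_measurable_exit_pt[of "\<lambda>_. q" step_space "\<lambda>\<omega>. \<omega>"] by simp
    define A where "A = {\<omega>\<in>space step_space. exit_pt D e q \<omega> \<in> hball p r}"
    have A: "A \<in> sets step_space"
      using measurable_sets[OF m borel_open[OF open_hball[of p r]]] by (simp add: A_def vimage_def)
    have Ac: "UNIV - A \<in> sets step_space" using sets.compl_sets[OF A] by simp
    have "q \<in> hball p s \<inter> D" using \<delta>(2) q by auto
    then have PA: "1 - \<zeta> \<le> measure step_space A"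
      unfolding A_def using s(3) e by blast
    have "u_eps D F e q - F p = (\<integral>\<omega>. boundary_data (exit_pt D e q \<omega>) - F p \<partial>step_space)"
      using integrable_boundary_data_exit_pt[OF e(1), of q] by (simp add: u_eps_eq)
    then have "\<bar>u_eps D F e q - F p\<bar> \<le> (\<integral>\<omega>. \<bar>boundary_data (exit_pt D e q \<omega>) - F p\<bar> \<partial>step_space)"
      using integral_abs_bound by metis
    also have "\<dots> \<le> (\<integral>\<omega>. \<eta> / 2 + 2 * bound * indicator (space step_space - A) \<omega> \<partial>step_space)"
    proof (rule integral_mono_AE)
      show "AE \<omega> in step_space. \<bar>boundary_data (exit_pt D e q \<omega>) - F p\<bar> \<le> \<eta> / 2 + 2 * bound * indicator (space step_space - A) \<omega>"
        using AE_exit_pt_frontier[OF q(1)]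
      proof eventually_elim
        case (elim \<omega>)
        show ?case
        proof (cases "\<omega> \<in> A")
          case True
          then have "exit_pt D e q \<omega> \<in> ball p d" using r(2) by (auto simp: A_def)
          then have "dist (exit_pt D e q \<omega>) p < d" by (simp add: dist_commute)
          from d(2)[OF elim this] show ?thesis
            using True elim by (simp add: boundary_data_def dist_real_def)
        next
          case False
          have "\<bar>F (exit_pt D e q \<omega>) - F p\<bar> \<le> 2 * bound"
            using F_le_bound[OF elim] F_le_bound[OF p] by linarith
          then show ?thesis
            using False elim \<open>0 < \<eta>\<close> by (simp add: boundary_data_def)
        qed
      qed
      show "integrable step_space (\<lambda>\<omega>. \<eta> / 2 + 2 * bound * indicator (space step_space - A) \<omega>)"
        using Ac by (intro Bochner_Integration.integrable_add integrable_mult_right integrable_real_indicator)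
          (auto simp: step_space.emeasure_eq_measure)
    qed (use integrable_boundary_data_exit_pt[OF e(1)] in auto)
    also have "\<dots> = \<eta> / 2 + 2 * bound * measure step_space (space step_space - A)"
      using Ac by (subst Bochner_Integration.integral_add)
        (auto simp: step_space.emeasure_eq_measure)
    also have "measure step_space (space step_space - A) \<le> \<zeta>"
      using PA A step_space.prob_compl[OF A] by simp
    finally show "\<bar>u_eps D F e q - F p\<bar> \<le> \<eta>"
      using \<zeta>(2) bound_nonneg mult_left_mono[of "measure step_space (space step_space - A)" \<zeta> "2 * bound"]
      by (simp add: mult_left_mono)
  qed
qed

text \<open>Finitely many balls of half the admissible radius cover the compact frontier. A point
  close to \<open>p\<close> then lies in the full ball of the centre \<open>c\<close> belonging to
  \<open>p\<close>, and the oscillation of \<open>F\<close> between \<open>p\<close> and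
  \<open>c\<close> accounts for the other half of \<open>\<eta>\<close>.\<close>

lemma boundary_estimate_uniform:
  assumes "walk_regular D" and "0 < \<eta>"
  obtains \<delta> \<epsilon> where "0 < \<delta>" "0 < \<epsilon>"
    "\<And>e q p. 0 < e \<Longrightarrow> e < \<epsilon> \<Longrightarrow> q \<in> D \<Longrightarrow> p \<in> frontier D \<Longrightarrow> dist p q < \<delta> \<Longrightarrow>
      \<bar>u_eps D F e q - F p\<bar> \<le> \<eta>"
proof -
  define P where "P p \<delta> \<epsilon> \<longleftrightarrow> 0 < \<delta> \<and> 0 < \<epsilon> \<and>
     (\<forall>e q. 0 < e \<and> e < \<epsilon> \<and> q \<in> D \<and> dist p q < \<delta> \<longrightarrow> \<bar>u_eps D F e q - F p\<bar> \<le> \<eta> / 2) \<and>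
     (\<forall>p'\<in>frontier D. dist p p' < \<delta> \<longrightarrow> \<bar>F p' - F p\<bar> \<le> \<eta> / 2)" for p \<delta> \<epsilon>
  have "\<exists>\<delta> \<epsilon>. P p \<delta> \<epsilon>" if p: "p \<in> frontier D" for p
  proof -
    obtain \<delta> \<epsilon> where 1: "0 < \<delta>" "0 < \<epsilon>"
       "\<And>e q. 0 < e \<Longrightarrow> e < \<epsilon> \<Longrightarrow> q \<in> D \<Longrightarrow> dist p q < \<delta> \<Longrightarrow> \<bar>u_eps D F e q - F p\<bar> \<le> \<eta> / 2"
      using boundary_estimate[OF assms(1) p half_gt_zero[OF assms(2)]] by metis
    obtain d where d: "0 < d" "\<And>p'. p' \<in> frontier D \<Longrightarrow> dist p' p < d \<Longrightarrow> dist (F p') (F p) < \<eta> / 2"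
      using F p \<open>0 < \<eta>\<close> unfolding continuous_on_iff by (metis half_gt_zero)
    have "P p (min \<delta> d) \<epsilon>"
      unfolding P_def
    proof (intro conjI allI impI ballI)
      fix p' assume "p' \<in> frontier D" "dist p p' < min \<delta> d"
      with d(2)[of p'] show "\<bar>F p' - F p\<bar> \<le> \<eta> / 2" by (simp add: dist_commute dist_real_def)
    qed (use 1 d(1) in auto)
    then show ?thesis by blast
  qed
  then obtain \<delta> \<epsilon> where "\<And>p. p \<in> frontier D \<Longrightarrow> P p (\<delta> p) (\<epsilon> p)" by metis
  then have *: "p \<in> frontier D \<Longrightarrow> 0 < \<delta> p" "p \<in> frontier D \<Longrightarrow> 0 < \<epsilon> p"
     "p \<in> frontier D \<Longrightarrow> 0 < e \<Longrightarrow> e < \<epsilon> p \<Longrightarrow> q \<in> D \<Longrightarrow> dist p q < \<delta> p \<Longrightarrow> \<bar>u_eps D F e q - F p\<bar> \<le> \<eta> / 2"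
     "p \<in> frontier D \<Longrightarrow> p' \<in> frontier D \<Longrightarrow> dist p p' < \<delta> p \<Longrightarrow> \<bar>F p' - F p\<bar> \<le> \<eta> / 2"
    for p e q p'
    unfolding P_def by blast+
  have "frontier D \<subseteq> (\<Union>p\<in>frontier D. ball p (\<delta> p / 2))" using *(1) by force
  then obtain C where C: "C \<subseteq> frontier D" "finite C" "frontier D \<subseteq> (\<Union>p\<in>C. ball p (\<delta> p / 2))"
    using compactE_image[OF domain.compact_frontier, of "frontier D" "\<lambda>p. ball p (\<delta> p / 2)"] by blast
  then have "C \<noteq> {}" using domain.frontier_nonempty by auto
  show thesis
  proof (rule that[of "Min ((\<lambda>p. \<delta> p / 2) ` C)" "Min (\<epsilon> ` C)"])
    show "0 < Min ((\<lambda>p. \<delta> p / 2) ` C)" "0 < Min (\<epsilon> ` C)"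
      using C(1,2) \<open>C \<noteq> {}\<close> *(1,2) by auto
    fix e q p assume e: "0 < e" "e < Min (\<epsilon> ` C)" and q: "q \<in> D" and p: "p \<in> frontier D"
      and pq: "dist p q < Min ((\<lambda>p. \<delta> p / 2) ` C)"
    obtain c where c: "c \<in> C" "dist c p < \<delta> c / 2" using C(3) p by auto
    then have cf: "c \<in> frontier D" using C(1) by blast
    have "e < \<epsilon> c" "dist p q < \<delta> c / 2" using e(2) pq c(1) C(2) \<open>C \<noteq> {}\<close> by auto
    moreover from this have "dist c q < \<delta> c" using c(2) dist_triangle[of c q p] by simp
    ultimately have "\<bar>u_eps D F e q - F c\<bar> \<le> \<eta> / 2" using *(3)[OF cf e(1)] q by blast
    moreover have "\<bar>F p - F c\<bar> \<le> \<eta> / 2"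
      using *(4)[OF cf p] c(2) *(1)[OF cf] by simp
    ultimately show "\<bar>u_eps D F e q - F p\<bar> \<le> \<eta>" by linarith
  qed
qed

text \<open>Left translations commute with the walk away from the boundary, so the interior oscillation
  of \<open>u_eps\<close> is controlled through the maximum principle by its oscillation in a boundary strip.\<close>

lemma asymptotic_equicontinuity:
  assumes "walk_regular D" and "0 < \<eta>"
  obtains \<delta> \<epsilon> where "0 < \<delta>" "0 < \<epsilon>"
    "\<And>e q q'. 0 < e \<Longrightarrow> e < \<epsilon> \<Longrightarrow> q \<in> D \<Longrightarrow> q' \<in> D \<Longrightarrow> dist q q' < \<delta> \<Longrightarrow>
      \<bar>u_eps D F e q - u_eps D F e q'\<bar> \<le> \<eta>"
proof -
  obtain d \<epsilon>\<^sub>1 where d: "0 < d" "0 < \<epsilon>\<^sub>1"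
    "\<And>e q p. 0 < e \<Longrightarrow> e < \<epsilon>\<^sub>1 \<Longrightarrow> q \<in> D \<Longrightarrow> p \<in> frontier D \<Longrightarrow> dist p q < d \<Longrightarrow> \<bar>u_eps D F e q - F p\<bar> \<le> \<eta> / 2"
    using boundary_estimate_uniform[OF assms(1) half_gt_zero[OF assms(2)]] by metis
  have strip: "\<bar>u_eps D F e q - u_eps D F e q'\<bar> \<le> \<eta>"
    if "0 < e" "e < \<epsilon>\<^sub>1" "q \<in> D" "q' \<in> D" "infdist q (frontier D) < d / 2" "dist q q' < d / 4" for e q q'
  proof -
    note h = that
    obtain p where p: "p \<in> frontier D" "dist q p < d / 2"
      using infdist_lessE[OF domain.frontier_nonempty h(5)] by metis
    then have "dist p q < d" "dist p q' < d"
      using dist_triangle[of p q' q] h(6) d(1) by (simp_all add: dist_commute)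
    then show ?thesis
      using d(3)[OF h(1,2,3) p(1)] d(3)[OF h(1,2,4) p(1)] by linarith
  qed
  obtain R where R: "\<And>p. p \<in> D \<Longrightarrow> norm p \<le> R" "0 < R" using domain.bounded_domain by metis
  \<comment> \<open>\<open>E\<close> is where the maximum principle is applied. The larger compact
    set \<open>K\<close> contains both \<open>E\<close> and its translate by less than
    \<open>d / 4\<close>, and keeps a positive gauge distance \<open>m\<close> from the frontier, so
    the mean value property holds at both points.\<close>
  define E where "E = {p\<in>D. d / 2 \<le> infdist p (frontier D)}"
  define K where "K = {p. d / 4 \<le> infdist p (frontier D)} \<inter> closure D"
  have "compact K"
    unfolding K_def using D(2)
    by (intro closed_Int_compact closed_Collect_le continuous_intros) (simp_all add: compact_closure)
  moreover have "K \<inter> frontier D = {}" using d(1) by (auto simp: K_def)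
  ultimately obtain m where m: "0 < m" "\<And>p. p \<in> K \<Longrightarrow> m \<le> hsetdist p (frontier D)"
    using hsetdist_pos_on_compact[OF domain.compact_frontier domain.frontier_nonempty] by metis
  define \<epsilon> where "\<epsilon> = min \<epsilon>\<^sub>1 (min m (d / (8 * (1 + R))))"
  \<comment> \<open>One factor \<open>1 + R\<close> is lost in bounding the translation
    \<open>g\<close> by \<open>norm (q' - q)\<close>, the other in bounding its effect on a point of
    \<open>D\<close>. The result is a displacement below \<open>d / 4\<close>.\<close>
  define \<delta> where "\<delta> = d / (4 * (1 + R)\<^sup>2)"
  have "0 < \<delta>" using d(1) R(2) by (simp add: \<delta>_def)
  have "1 \<le> (1 + R)\<^sup>2" using R(2) by (simp add: one_le_power)
  then have "d / (4 * (1 + R)\<^sup>2) \<le> d / (4 * 1)"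
    using d(1) by (intro divide_left_mono mult_left_mono) auto
  then have "\<delta> \<le> d / 4" by (simp add: \<delta>_def)
  show thesis
  proof (rule that[of \<delta> \<epsilon>])
    show "0 < \<epsilon>" using d m R(2) by (simp add: \<epsilon>_def)
    show "0 < \<delta>" by fact
    fix e q q' assume e: "0 < e" "e < \<epsilon>" and q: "q \<in> D" "q' \<in> D" "dist q q' < \<delta>"
    have e1: "e < \<epsilon>\<^sub>1" "e \<le> m" "(1 + R) * e < d / 8"
    proof -
      show "e < \<epsilon>\<^sub>1" "e \<le> m" using e(2) by (simp_all add: \<epsilon>_def)
      have "e < d / (8 * (1 + R))" using e(2) by (simp add: \<epsilon>_def)
      then have "e * (8 * (1 + R)) < d" using R(2) by (subst (asm) pos_less_divide_eq) auto
      then show "(1 + R) * e < d / 8" by (simp add: algebra_simps)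
    qed
    define g where "g = q' \<star> hinv q"
    have gq: "g \<star> q = q'" by (simp add: g_def hmul_assoc)
    have g: "dist (g \<star> p) p < d / 4" if "p \<in> D" for p
    proof -
      have "norm g \<le> (1 + norm q) * norm (q' - q)" unfolding g_def by (rule norm_hmul_hinv_le)
      also have "\<dots> \<le> (1 + R) * norm (q' - q)" using R(1)[OF q(1)] by (intro mult_right_mono) auto
      also have "\<dots> < (1 + R) * \<delta>"
        using q(3) R(2) by (intro mult_strict_left_mono) (auto simp: dist_norm norm_minus_commute)
      finally have "norm g < (1 + R) * \<delta>" .
      then have "(1 + R) * norm g < (1 + R) * ((1 + R) * \<delta>)" using R(2) by (intro mult_strict_left_mono) auto
      also have "\<dots> = d / 4"
      proof -
        have "4 * (1 + R)\<^sup>2 \<noteq> 0" using R(2) by simp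
        then have "\<delta> * (4 * (1 + R)\<^sup>2) = d"
          using nonzero_eq_divide_eq[of "4 * (1 + R)\<^sup>2" \<delta> d] \<delta>_def by blast
        then show ?thesis by (simp add: power2_eq_square algebra_simps)
      qed
      finally have "(1 + R) * norm g < d / 4" .
      moreover have "(1 + norm p) * norm g \<le> (1 + R) * norm g"
        using R(1)[OF that] by (intro mult_right_mono) auto
      ultimately show ?thesis using norm_hmul_diff_right[of g p] by (simp add: dist_norm)
    qed
    have near: "p' \<in> D" if "p \<in> E" "dist p' p < d / 2" for p p'
    proof -
      have "p \<in> D" "d / 2 \<le> infdist p (frontier D)" using that(1) by (simp_all add: E_def)
      moreover from this have "p' \<in> ball p (infdist p (frontier D))"
        using that(2) by (simp add: dist_commute)
      ultimately show ?thesis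
        using ball_infdist_frontier_subset[OF _ domain.frontier_nonempty] by blast
    qed
    define U where "U = u_eps D F e"
    have U: "U \<in> borel_measurable borel" "\<And>p. \<bar>U p\<bar> \<le> bound"
      unfolding U_def using borel_measurable_u_eps[OF e(1)] u_eps_le_bound[OF e(1)] by auto
    \<comment> \<open>At \<open>q\<close> this is the difference to be estimated, since
      \<open>g \<star> q = q'\<close>. Because steps act from the right, both terms satisfy the mean
      value property with the same increments.\<close>
    define v where "v p = U p - U (g \<star> p)" for p
    have Ug: "(\<lambda>p. U (g \<star> p)) \<in> borel_measurable borel"
      by (intro measurable_compose[OF _ U(1)] borel_measurable_continuous_onI continuous_intros)
    have v: "v \<in> borel_measurable borel" "\<And>p. \<bar>v p\<bar> \<le> 2 * bound"
    proof -
      show "v \<in> borel_measurable borel" unfolding v_def[abs_def] using U(1) Ug by simp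
      show "\<bar>v p\<bar> \<le> 2 * bound" for p using U(2)[of p] U(2)[of "g \<star> p"] by (simp add: v_def)
    qed
    have mean: "v p = disc_avg e v p" if p: "p \<in> E" for p
    proof -
      have pD: "p \<in> D" "d / 2 \<le> infdist p (frontier D)" using p by (auto simp: E_def)
      have gp: "dist (g \<star> p) p < d / 4" using g pD(1) .
      have "p \<in> K" using pD d(1) closure_subset by (auto simp: K_def)
      moreover have "g \<star> p \<in> K"
      proof -
        have "g \<star> p \<in> D" using near[OF p] gp d(1) by simp
        moreover have "infdist p (frontier D) \<le> infdist (g \<star> p) (frontier D) + dist p (g \<star> p)"
          by (rule infdist_triangle)
        ultimately show ?thesis
          using gp pD(2) closure_subset by (auto simp: K_def dist_commute)
      qed
      ultimately have "U p = disc_avg e U p" "U (g \<star> p) = disc_avg e U (g \<star> p)"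
        unfolding U_def by - (rule u_eps_mean_value[OF e(1) order_trans[OF e1(2) m(2)]], assumption)+
      moreover have "integrable step_dist (\<lambda>w. U (hshift e p w))" "integrable step_dist (\<lambda>w. U (g \<star> hshift e p w))"
        by (rule integrable_step_dist_bounded[where B = bound, OF borel_measurable_hshift_apply[OF U(1)]],
            simp only: real_norm_def U(2),
            rule integrable_step_dist_bounded[where B = bound, OF borel_measurable_hshift_apply[OF Ug]],
            simp only: real_norm_def U(2))
      ultimately show ?thesis
        unfolding v_def by (simp add: disc_avg_def hshift_hmul)
    qed
    \<comment> \<open>A step from \<open>E\<close> and its translate both remain in
      \<open>D\<close>. If the step leaves \<open>E\<close>, it ends close enough to the frontier
      for \<open>strip\<close> to apply.\<close>
    have bdry: "hshift e p w \<in> E \<or> \<bar>v (hshift e p w)\<bar> \<le> \<eta>" if p: "p \<in> E" and w: "norm w < 1" for p w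
    proof -
      have pD: "p \<in> D" using p by (simp add: E_def)
      have "dist (hshift e p w) p \<le> (1 + norm p) * \<bar>e\<bar>" using w by (intro dist_hshift_le) simp
      also have "\<dots> \<le> (1 + R) * e" using R(1)[OF pD] e(1) by (simp add: mult_right_mono)
      finally have 1: "dist (hshift e p w) p < d / 8" using e1(3) by simp
      then have 2: "hshift e p w \<in> D" using near[OF p] d(1) by simp
      then have 3: "dist (g \<star> hshift e p w) (hshift e p w) < d / 4" by (rule g)
      then have "dist (g \<star> hshift e p w) p < d / 2"
        using 1 d(1) dist_triangle[of "g \<star> hshift e p w" p "hshift e p w"] by simp
      then have 4: "g \<star> hshift e p w \<in> D" by (rule near[OF p])
      show ?thesis
      proof (cases "hshift e p w \<in> E")
        case False
        then have "infdist (hshift e p w) (frontier D) < d / 2" using 2 by (auto simp: E_def)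
        from strip[OF e(1) e1(1) 2 4 this] 3 show ?thesis
          by (simp add: v_def U_def dist_commute)
      qed simp
    qed
    have bE: "bounded E" using D(2) by (rule bounded_subset) (auto simp: E_def)
    show "\<bar>u_eps D F e q - u_eps D F e q'\<bar> \<le> \<eta>"
    proof (cases "q \<in> E")
      case True
      have "v q \<le> \<eta>"
        by (rule disc_avg_maximum_principle[OF e(1) v bE _ _ True])
          (use mean bdry in \<open>force+\<close>)
      moreover have "- v q \<le> \<eta>"
      proof (rule disc_avg_maximum_principle[OF e(1) _ _ bE _ _ True])
        show "(\<lambda>p. - v p) \<in> borel_measurable borel" using v(1) by simp
        show "\<bar>- v p\<bar> \<le> 2 * bound" for p using v(2)[of p] by simp
        show "- v p \<le> disc_avg e (\<lambda>p. - v p) p" if "p \<in> E" for p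
          using mean[OF that] by (simp add: disc_avg_def)
        show "hshift e p w \<in> E \<or> - v (hshift e p w) \<le> \<eta>" if "p \<in> E" "norm w < 1" for p w
          using bdry[OF that] by auto
      qed
      ultimately show ?thesis by (simp add: v_def U_def gq)
    next
      case False
      then have "infdist q (frontier D) < d / 2" using q(1) by (auto simp: E_def)
      then show ?thesis
        using strip[OF e(1) e1(1) q(1,2)] q(3) \<open>\<delta> \<le> d / 4\<close> by simp
    qed
  qed
qed

text \<open>An Arzela-Ascoli argument in which equicontinuity is available only for small
  \<open>e\<close>: a diagonal sequence converges on a countable dense set, and
  \<open>asymptotic_equicontinuity\<close> makes it uniformly Cauchy from some index on.\<close>

lemma convergent_subsequence:
  assumes "walk_regular D" and e: "\<And>i. 0 < e i" "e \<longlonglongrightarrow> 0"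
  obtains k u where "strict_mono (k :: nat \<Rightarrow> nat)"
    "uniform_limit D (\<lambda>i. u_eps D F (e (k i))) u sequentially"
    "continuous_on (closure D) u" "\<And>p. p \<in> frontier D \<Longrightarrow> u p = F p"
proof -
  obtain B :: "heis set" where B: "countable B" "\<And>X. open X \<Longrightarrow> X \<noteq> {} \<Longrightarrow> \<exists>d\<in>B. d \<in> X"
    using countable_dense_exists by metis
  obtain k where k: "strict_mono (k :: nat \<Rightarrow> nat)"
    and conv: "\<And>x. x \<in> B \<inter> D \<Longrightarrow> \<exists>l. (\<lambda>n. u_eps D F (e (k n)) x) \<longlonglongrightarrow> l"
    using function_convergent_subsequence[of "B \<inter> D" "\<lambda>n. u_eps D F (e n)" bound] B(1) u_eps_le_bound[OF e(1)]
    by (metis countable_Int1 real_norm_def)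
  define f where "f n = u_eps D F (e (k n))" for n
  have ek: "(\<lambda>n. e (k n)) \<longlonglongrightarrow> 0"
    using LIMSEQ_subseq_LIMSEQ[OF e(2) k] by (simp add: o_def)
  have "uniformly_Cauchy_on D f"
    unfolding uniformly_Cauchy_on_def
  proof (intro allI impI)
    fix \<eta> :: real assume "0 < \<eta>"
    then have "0 < \<eta> / 4" by simp
    from asymptotic_equicontinuity[OF assms(1) this] obtain \<delta> \<epsilon> where \<delta>: "0 < \<delta>" "0 < \<epsilon>"
      "\<And>e q q'. 0 < e \<Longrightarrow> e < \<epsilon> \<Longrightarrow> q \<in> D \<Longrightarrow> q' \<in> D \<Longrightarrow> dist q q' < \<delta> \<Longrightarrow>
         \<bar>u_eps D F e q - u_eps D F e q'\<bar> \<le> \<eta> / 4" by metis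
    \<comment> \<open>Compactness reduces uniform convergence to the finitely many centres extracted
      from this cover, where the sequence converges pointwise.\<close>
    have "closure D \<subseteq> (\<Union>x\<in>B \<inter> D. ball x \<delta>)"
    proof
      fix y assume "y \<in> closure D"
      then have "ball y \<delta> \<inter> D \<noteq> {}" using \<delta>(1)
        by (metis centre_in_ball open_Int_closure_eq_empty open_ball disjoint_iff)
      then obtain x where "x \<in> B" "x \<in> ball y \<delta> \<inter> D" using B(2)[of "ball y \<delta> \<inter> D"] D(1) by blast
      then show "y \<in> (\<Union>x\<in>B \<inter> D. ball x \<delta>)" by (auto simp: dist_commute)
    qed
    then obtain C where C: "C \<subseteq> B \<inter> D" "finite C" "closure D \<subseteq> (\<Union>x\<in>C. ball x \<delta>)"
      using compactE_image[of "closure D" "B \<inter> D" "\<lambda>x. ball x \<delta>"] D(2) by (metis compact_closure open_ball)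
    have "\<exists>N. \<forall>m\<ge>N. \<forall>n\<ge>N. dist (f m x) (f n x) < \<eta> / 4" if "x \<in> C" for x
    proof -
      have "Cauchy (\<lambda>n. f n x)" using conv[of x] that C(1) by (auto simp: f_def intro: LIMSEQ_imp_Cauchy)
      then show ?thesis using \<open>0 < \<eta> / 4\<close> unfolding Cauchy_def by blast
    qed
    then obtain N where N: "\<And>x m n. x \<in> C \<Longrightarrow> N x \<le> m \<Longrightarrow> N x \<le> n \<Longrightarrow> dist (f m x) (f n x) < \<eta> / 4"
      by metis
    obtain N0 where N0: "\<And>n. N0 \<le> n \<Longrightarrow> e (k n) < \<epsilon>"
      using order_tendstoD(2)[OF ek \<delta>(2)] unfolding eventually_sequentially by auto
    show "\<exists>M. \<forall>x\<in>D. \<forall>m\<ge>M. \<forall>n\<ge>M. dist (f m x) (f n x) < \<eta>"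
    proof (intro exI ballI allI impI)
      fix x m n assume x: "x \<in> D" and mn: "Max (insert N0 (N ` C)) \<le> m" "Max (insert N0 (N ` C)) \<le> n"
      obtain c where c: "c \<in> C" "dist c x < \<delta>" using C(3) x closure_subset[of D] by auto
      have "N0 \<le> m" "N0 \<le> n" "N c \<le> m" "N c \<le> n" using mn C(2) c(1) by auto
      moreover have "c \<in> D" using C(1) c(1) by blast
      ultimately have "\<bar>f m c - f m x\<bar> \<le> \<eta> / 4" "\<bar>f n c - f n x\<bar> \<le> \<eta> / 4" "\<bar>f m c - f n c\<bar> < \<eta> / 4"
        using \<delta>(3)[OF e(1) N0 _ x c(2)] N[OF c(1)] by (auto simp: f_def dist_real_def)
      then show "dist (f m x) (f n x) < \<eta>" using \<open>0 < \<eta>\<close> unfolding dist_real_def by linarith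
    qed
  qed
  then obtain u\<^sub>0 where u0: "uniform_limit D f u\<^sub>0 sequentially"
    using Cauchy_uniformly_convergent uniformly_convergent_on_def by blast
  have lim: "(\<lambda>n. f n x) \<longlonglongrightarrow> u\<^sub>0 x" if "x \<in> D" for x
    using tendsto_uniform_limitI[OF u0 that] .
  \<comment> \<open>The interior limit is completed by the boundary data. Continuity at frontier
    points comes from \<open>boundary_estimate\<close> along \<open>D\<close> and from continuity of
    \<open>F\<close> along the frontier.\<close>
  define u where "u x = (if x \<in> D then u\<^sub>0 x else F x)" for x
  have uF: "u p = F p" if "p \<in> frontier D" for p
    using that domain.frontier_disjoint by (auto simp: u_def)
  have "continuous_on (closure D) u"
    unfolding continuous_on_iff
  proof (intro ballI allI impI)
    fix x and \<eta> :: real assume x: "x \<in> closure D" and "0 < \<eta>"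
    then have \<eta>: "0 < \<eta> / 2" by simp
    show "\<exists>d>0. \<forall>y\<in>closure D. dist y x < d \<longrightarrow> dist (u y) (u x) < \<eta>"
    proof (cases "x \<in> D")
      case True
      obtain r where r: "0 < r" "ball x r \<subseteq> D" using D(1) True by (metis open_contains_ball)
      obtain \<delta> \<epsilon> where \<delta>: "0 < \<delta>" "0 < \<epsilon>"
        "\<And>e q q'. 0 < e \<Longrightarrow> e < \<epsilon> \<Longrightarrow> q \<in> D \<Longrightarrow> q' \<in> D \<Longrightarrow> dist q q' < \<delta> \<Longrightarrow>
         \<bar>u_eps D F e q - u_eps D F e q'\<bar> \<le> \<eta> / 2" using asymptotic_equicontinuity[OF assms(1) \<eta>] by metis
      have "dist (u y) (u x) < \<eta>" if "dist y x < min \<delta> r" for y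
      proof -
        have y: "y \<in> D" using r(2) that by (auto simp: dist_commute)
        have "\<bar>u\<^sub>0 y - u\<^sub>0 x\<bar> \<le> \<eta> / 2"
        proof (rule tendsto_upperbound)
          show "(\<lambda>n. \<bar>f n y - f n x\<bar>) \<longlonglongrightarrow> \<bar>u\<^sub>0 y - u\<^sub>0 x\<bar>" by (intro tendsto_intros lim y True)
          show "\<forall>\<^sub>F n in sequentially. \<bar>f n y - f n x\<bar> \<le> \<eta> / 2"
            using order_tendstoD(2)[OF ek \<delta>(2)]
            by eventually_elim (use \<delta>(3)[OF e(1) _ y True] that in \<open>simp add: f_def\<close>)
        qed simp
        then show ?thesis using y True \<open>0 < \<eta>\<close> by (simp add: u_def dist_real_def)
      qed
      then show ?thesis using \<delta>(1) r(1) by (intro exI[of _ "min \<delta> r"]) auto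
    next
      case False
      then have xf: "x \<in> frontier D" using x D(1) by (simp add: frontier_def interior_open)
      obtain \<delta> \<epsilon> where \<delta>: "0 < \<delta>" "0 < \<epsilon>"
         "\<And>e q. 0 < e \<Longrightarrow> e < \<epsilon> \<Longrightarrow> q \<in> D \<Longrightarrow> dist x q < \<delta> \<Longrightarrow> \<bar>u_eps D F e q - F x\<bar> \<le> \<eta> / 2"
        using boundary_estimate[OF assms(1) xf \<eta>] by metis
      obtain d where d: "0 < d" "\<And>p'. p' \<in> frontier D \<Longrightarrow> dist p' x < d \<Longrightarrow> dist (F p') (F x) < \<eta>"
        using F xf \<open>0 < \<eta>\<close> unfolding continuous_on_iff by metis
      have "dist (u y) (u x) < \<eta>" if y: "y \<in> closure D" "dist y x < min \<delta> d" for y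
      proof (cases "y \<in> D")
        case True
        have "\<bar>u\<^sub>0 y - F x\<bar> \<le> \<eta> / 2"
        proof (rule tendsto_upperbound)
          show "(\<lambda>n. \<bar>f n y - F x\<bar>) \<longlonglongrightarrow> \<bar>u\<^sub>0 y - F x\<bar>" by (intro tendsto_intros lim True)
          show "\<forall>\<^sub>F n in sequentially. \<bar>f n y - F x\<bar> \<le> \<eta> / 2"
            using order_tendstoD(2)[OF ek \<delta>(2)]
            by eventually_elim (use \<delta>(3)[OF e(1) _ True] y(2) in \<open>simp add: f_def dist_commute\<close>)
        qed simp
        then show ?thesis using True False \<open>0 < \<eta>\<close> by (simp add: u_def dist_real_def)
      next
        case False
        then have "y \<in> frontier D" using y(1) D(1) by (simp add: frontier_def interior_open)
        then show ?thesis using d(2) y(2) uF xf by simp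
      qed
      then show ?thesis using \<delta>(1) d(1) by (intro exI[of _ "min \<delta> d"]) auto
    qed
  qed
  moreover have "uniform_limit D (\<lambda>i. u_eps D F (e (k i))) u sequentially"
    using u0 unfolding f_def[abs_def] by (rule uniform_limit_cong'[THEN iffD1, rotated 2]) (auto simp: u_def)
  ultimately show thesis using that k uF by blast
qed

end

subsection \<open>Second-order calculus and the comparison principle\<close>

definition hlap :: "(heis \<Rightarrow>\<^sub>L heis \<Rightarrow>\<^sub>L real) \<Rightarrow> heis \<Rightarrow> real" where
  "hlap A q = A (X_vec q) (X_vec q) + A (Y_vec q) (Y_vec q)"

lemma has_derivative_line:
  fixes f :: "'a::real_normed_vector \<Rightarrow> real"
  assumes "(f has_derivative f') (at (c x))" "(c has_vector_derivative v) (at x)"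
  shows "((\<lambda>s. f (c s)) has_real_derivative f' v) (at x)"
proof -
  have "((\<lambda>s. f (c s)) has_derivative (\<lambda>h. f' (h *\<^sub>R v))) (at x)"
    using has_derivative_compose[OF assms(2)[unfolded has_vector_derivative_def] assms(1)] .
  moreover have "f' (h *\<^sub>R v) = f' v * h" for h
    using has_derivative_linear[OF assms(1)] by (simp add: linear_cmul)
  ultimately show ?thesis by (simp add: has_field_derivative_def)
qed

lemma has_vector_derivative_coordinate:
  "((\<lambda>s. (s, y, z)) has_vector_derivative (1, 0, 0)) (at (s :: real))"
  "((\<lambda>s. (x, s, z)) has_vector_derivative (0, 1, 0)) (at (s :: real))"
  "((\<lambda>s. (x, y, s)) has_vector_derivative (0, 0, 1)) (at (s :: real))"
  for x y z :: real
  unfolding has_vector_derivative_def by (auto intro!: derivative_eq_intros simp: zero_prod_def)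

lemma X_field_eq:
  assumes "(f has_derivative f') (at q)"
  shows "X_field f q = f' (X_vec q)"
proof -
  obtain x y z where q: "q = (x, y, z)" by (cases q)
  have d1: "((\<lambda>s. f (s, y, z)) has_real_derivative f' (1, 0, 0)) (at x)"
    using assms unfolding q by (rule has_derivative_line) (rule has_vector_derivative_coordinate)
  have d3: "((\<lambda>s. f (x, y, s)) has_real_derivative f' (0, 0, 1)) (at z)"
    using assms unfolding q by (rule has_derivative_line) (rule has_vector_derivative_coordinate)
  have "X_vec q = (1, 0, 0) + (- y / 2) *\<^sub>R (0, 0, 1)" by (simp add: X_vec_def q)
  then have "f' (X_vec q) = f' (1, 0, 0) + (- y / 2) * f' (0, 0, 1)"
    using has_derivative_linear[OF assms] by (simp only: linear_add linear_cmul real_scaleR_def)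
  then show ?thesis
    using DERIV_imp_deriv[OF d1] DERIV_imp_deriv[OF d3] by (simp add: X_field_def q)
qed

lemma Y_field_eq:
  assumes "(f has_derivative f') (at q)"
  shows "Y_field f q = f' (Y_vec q)"
proof -
  obtain x y z where q: "q = (x, y, z)" by (cases q)
  have d2: "((\<lambda>s. f (x, s, z)) has_real_derivative f' (0, 1, 0)) (at y)"
    using assms unfolding q by (rule has_derivative_line) (rule has_vector_derivative_coordinate)
  have d3: "((\<lambda>s. f (x, y, s)) has_real_derivative f' (0, 0, 1)) (at z)"
    using assms unfolding q by (rule has_derivative_line) (rule has_vector_derivative_coordinate)
  have "Y_vec q = (0, 1, 0) + (x / 2) *\<^sub>R (0, 0, 1)" by (simp add: Y_vec_def q)
  then have "f' (Y_vec q) = f' (0, 1, 0) + (x / 2) * f' (0, 0, 1)"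
    using has_derivative_linear[OF assms] by (simp only: linear_add linear_cmul real_scaleR_def)
  then show ?thesis
    using DERIV_imp_deriv[OF d2] DERIV_imp_deriv[OF d3] by (simp add: Y_field_def q)
qed

text \<open>The condition of \<open>C2_on\<close> with its witnesses exposed, so that estimates can
  name the derivatives.\<close>

definition C2_data where
  "C2_data S f f' f'' \<longleftrightarrow> (\<forall>x\<in>S. (f has_derivative blinfun_apply (f' x)) (at x)) \<and>
     (\<forall>x\<in>S. (f' has_derivative blinfun_apply (f'' x)) (at x)) \<and> continuous_on S f''"

lemma C2_on_iff_C2_data: "C2_on S f \<longleftrightarrow> (\<exists>f' f''. C2_data S f f' f'')"
  by (simp add: C2_on_def C2_data_def)

text \<open>The product rule for \<open>f' p (X_vec p)\<close> also yields \<open>f'\<close> applied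
  to the derivative of \<open>X_vec\<close> along itself. This vanishes: the coefficient of
  \<open>X_vec\<close> varies only with \<open>y\<close>, a direction in which \<open>X_vec\<close>
  has no component. The same holds for \<open>Y_vec\<close> with \<open>x\<close>.\<close>

lemma hlaplacian_eq_hlap:
  assumes S: "open S" "q \<in> S" and f: "C2_data S f f' f''"
  shows "hlaplacian f q = hlap (f'' q) q"
proof -
  have d1: "(f has_derivative blinfun_apply (f' p)) (at p)" and d2: "(f' has_derivative blinfun_apply (f'' p)) (at p)"
    if "p \<in> S" for p using f that by (auto simp: C2_data_def simp del: split_paired_All)
  have dX: "(X_vec has_derivative (\<lambda>h. (0, 0, - fst (snd h) / 2))) (at q)"
    and dY: "(Y_vec has_derivative (\<lambda>h. (0, 0, fst h / 2))) (at q)"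
    unfolding X_vec_def[abs_def] Y_vec_def[abs_def] by (auto intro!: derivative_eq_intros)
  have "((\<lambda>p. f' p (X_vec p)) has_derivative (\<lambda>h. f'' q h (X_vec q) + f' q (0, 0, - fst (snd h) / 2))) (at q)"
    by (rule derivative_eq_intros d2 S(2) dX refl | simp add: add.commute)+
  then have "(X_field f has_derivative (\<lambda>h. f'' q h (X_vec q) + f' q (0, 0, - fst (snd h) / 2))) (at q)"
    by (rule has_derivative_transform_within_open[OF _ S]) (simp add: X_field_eq[OF d1])
  from X_field_eq[OF this] have X: "X_field (X_field f) q = f'' q (X_vec q) (X_vec q)"
    by (simp add: X_vec_def zero_prod_def[symmetric] blinfun.zero_right)
  have "((\<lambda>p. f' p (Y_vec p)) has_derivative (\<lambda>h. f'' q h (Y_vec q) + f' q (0, 0, fst h / 2))) (at q)"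
    by (rule derivative_eq_intros d2 S(2) dY refl | simp add: add.commute)+
  then have "(Y_field f has_derivative (\<lambda>h. f'' q h (Y_vec q) + f' q (0, 0, fst h / 2))) (at q)"
    by (rule has_derivative_transform_within_open[OF _ S]) (simp add: Y_field_eq[OF d1])
  from Y_field_eq[OF this] have Y: "Y_field (Y_field f) q = f'' q (Y_vec q) (Y_vec q)"
    by (simp add: Y_vec_def zero_prod_def[symmetric] blinfun.zero_right)
  show ?thesis by (simp add: hlaplacian_def hlap_def X Y)
qed

lemma C2_data_line:
  assumes "C2_data S f f' f''" "q + t *\<^sub>R v \<in> S"
  shows "((\<lambda>t. f (q + t *\<^sub>R v)) has_real_derivative f' (q + t *\<^sub>R v) v) (at t)"
    and "((\<lambda>t. f' (q + t *\<^sub>R v) v) has_real_derivative f'' (q + t *\<^sub>R v) v v) (at t)"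
proof -
  have c: "((\<lambda>t. q + t *\<^sub>R v) has_vector_derivative v) (at t)"
    unfolding has_vector_derivative_def by (auto intro!: derivative_eq_intros)
  have f1: "(f has_derivative f' (q + t *\<^sub>R v)) (at (q + t *\<^sub>R v))"
    and f2: "(f' has_derivative f'' (q + t *\<^sub>R v)) (at (q + t *\<^sub>R v))"
    using assms unfolding C2_data_def by blast+
  show "((\<lambda>t. f (q + t *\<^sub>R v)) has_real_derivative f' (q + t *\<^sub>R v) v) (at t)"
    by (rule has_derivative_line[OF f1 c])
  have "((\<lambda>p. f' p v) has_derivative (\<lambda>h. f'' (q + t *\<^sub>R v) h v)) (at (q + t *\<^sub>R v))"
    by (rule derivative_eq_intros f2 refl | simp add: blinfun.zero_right)+
  from has_derivative_line[OF this c]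
  show "((\<lambda>t. f' (q + t *\<^sub>R v) v) has_real_derivative f'' (q + t *\<^sub>R v) v v) (at t)" .
qed

lemma C2_data_taylor:
  fixes f :: "'a::real_normed_vector \<Rightarrow> real"
  assumes f: "C2_data S f f' f''" and S: "\<And>t. 0 \<le> t \<Longrightarrow> t \<le> 1 \<Longrightarrow> q + t *\<^sub>R v \<in> S"
  obtains t where "0 \<le> t" "t \<le> 1"
    "f (q + v) = f q + f' q v + f'' (q + t *\<^sub>R v) v v / 2"
proof -
  define diff where "diff m = (if m = 0 then (\<lambda>t. f (q + t *\<^sub>R v)) else
      if m = 1 then (\<lambda>t. f' (q + t *\<^sub>R v) v) else (\<lambda>t. f'' (q + t *\<^sub>R v) v v))" for m :: nat
  have "\<exists>t>0. t < 1 \<and> f (q + 1 *\<^sub>R v) = (\<Sum>m<2. diff m 0 / fact m * 1 ^ m) + diff 2 t / fact 2 * 1 ^ 2"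
  proof (rule Maclaurin)
    show "\<forall>m t. m < 2 \<and> 0 \<le> t \<and> t \<le> 1 \<longrightarrow> (diff m has_real_derivative diff (Suc m) t) (at t)"
      using C2_data_line[OF f S] by (auto simp: diff_def less_2_cases_iff)
  qed (auto simp: diff_def)
  then obtain t where t: "0 < t" "t < 1"
    "f (q + 1 *\<^sub>R v) = (\<Sum>m<2. diff m 0 / fact m * 1 ^ m) + diff 2 t / fact 2 * 1 ^ 2"
    by blast
  show thesis
    by (rule that[of t]) (use t in \<open>simp_all add: diff_def numeral_2_eq_2\<close>)
qed

lemma second_derivative_nonpos_at_max:
  fixes g :: "real \<Rightarrow> real"
  assumes "0 < r" and g: "\<And>t. \<bar>t\<bar> < r \<Longrightarrow> (g has_real_derivative g' t) (at t)"
    and g': "(g' has_real_derivative D) (at 0)"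
    and max: "\<And>t. \<bar>t\<bar> < r \<Longrightarrow> g t \<le> g 0"
  shows "D \<le> 0"
proof (rule ccontr)
  assume "\<not> D \<le> 0"
  have "g' 0 = 0"
    by (rule DERIV_local_max[OF g[of 0] \<open>0 < r\<close>]) (use max \<open>0 < r\<close> in auto)
  obtain d where d: "0 < d" "\<And>h. 0 < h \<Longrightarrow> h < d \<Longrightarrow> g' 0 < g' (0 + h)"
    using DERIV_pos_inc_right[OF g'] \<open>\<not> D \<le> 0\<close> by auto
  define s where "s = min d r / 2"
  have s: "0 < s" "s < d" "s < r" using d(1) \<open>0 < r\<close> by (auto simp: s_def)
  obtain z where z: "0 < z" "z < s" "g s - g 0 = (s - 0) * g' z"
    using MVT2[of 0 s g g'] g s by (metis abs_of_nonneg less_eq_real_def order.strict_trans1)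
  have "0 < g' z" using d(2)[of z] z s \<open>g' 0 = 0\<close> by simp
  then have "g 0 < g s" using z s by (metis diff_gt_0_iff_gt diff_zero mult_pos_pos)
  then show False using max[of s] s by simp
qed

text \<open>Adding \<open>k * h\<close> to \<open>u - v\<close> makes the sub-Laplacian equal to the
  positive constant \<open>4 * k\<close>, so the maximum over the closure cannot lie in
  \<open>D\<close>. On the frontier \<open>u\<close> and \<open>v\<close> agree, and
  \<open>k\<close> tends to zero.\<close>

lemma dirichlet_solution_le:
  assumes D: "open D" "bounded D" and u: "dirichlet_solution D F u" and v: "dirichlet_solution D F v"
    and q: "q \<in> closure D"
  shows "u q \<le> v q"
proof -
  obtain u' u'' v' v'' where uu: "C2_data D u u' u''" and vv: "C2_data D v v' v''"
    using u v by (auto simp: dirichlet_solution_def C2_on_iff_C2_data)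
  define h where "h p = (fst p)\<^sup>2 + (fst (snd p))\<^sup>2" for p :: heis
  have K: "compact (closure D)" using D(2) by (simp add: compact_closure)
  have ch: "continuous_on S h" for S unfolding h_def by (intro continuous_intros)
  have cw: "continuous_on (closure D) (\<lambda>p. u p - v p)"
    using u v by (auto simp: dirichlet_solution_def intro!: continuous_intros)
  obtain H where H: "\<And>p. p \<in> closure D \<Longrightarrow> h p \<le> H"
    using continuous_attains_sup[OF K _ ch] q by (metis empty_iff)
  have h0: "0 \<le> h p" for p by (simp add: h_def)
  have "u q - v q \<le> k * H" if k: "0 < k" for k
  proof -
    define g where "g p = u p - v p + k * h p" for p
    have "continuous_on (closure D) g" unfolding g_def by (intro continuous_intros cw ch)
    then obtain p where p: "p \<in> closure D" "\<And>y. y \<in> closure D \<Longrightarrow> g y \<le> g p"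
      using continuous_attains_sup[OF K] q by (metis empty_iff)
    have "p \<notin> D"
    proof
      assume pD: "p \<in> D"
      have "u'' p e e - v'' p e e + 2 * k * h e \<le> 0" for e
      proof -
        have "open ((\<lambda>t. p + t *\<^sub>R e) -` D)" by (intro open_vimage D continuous_intros)
        moreover have "0 \<in> (\<lambda>t. p + t *\<^sub>R e) -` D" using pD by simp
        ultimately obtain r where r: "0 < r" "ball 0 r \<subseteq> (\<lambda>t. p + t *\<^sub>R e) -` D"
          by (metis open_contains_ball)
        then have rD: "p + t *\<^sub>R e \<in> D" if "\<bar>t\<bar> < r" for t using that by (auto simp: dist_real_def)
        show ?thesis
        proof (rule second_derivative_nonpos_at_max[OF r(1)])
          fix t assume t: "\<bar>t\<bar> < r"
          show "((\<lambda>t. g (p + t *\<^sub>R e)) has_real_derivative u' (p + t *\<^sub>R e) e - v' (p + t *\<^sub>R e) e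
             + k * (2 * (fst p + t * fst e) * fst e + 2 * (fst (snd p) + t * fst (snd e)) * fst (snd e))) (at t)"
            unfolding g_def h_def using C2_data_line[OF uu rD[OF t]] C2_data_line[OF vv rD[OF t]]
            by (auto intro!: derivative_eq_intros simp: algebra_simps)
          show "g (p + t *\<^sub>R e) \<le> g (p + 0 *\<^sub>R e)"
            using p(2)[of "p + t *\<^sub>R e"] rD[OF t] closure_subset by auto
        next
          have *: "p + 0 *\<^sub>R e \<in> D" using pD by simp
          show "((\<lambda>t. u' (p + t *\<^sub>R e) e - v' (p + t *\<^sub>R e) e
             + k * (2 * (fst p + t * fst e) * fst e + 2 * (fst (snd p) + t * fst (snd e)) * fst (snd e)))
             has_real_derivative u'' p e e - v'' p e e + 2 * k * h e) (at 0)"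
            using C2_data_line(2)[OF uu *] C2_data_line(2)[OF vv *]
            by (auto intro!: derivative_eq_intros simp: h_def algebra_simps power2_eq_square)
        qed
      qed
      \<comment> \<open>Both frame vectors have unit horizontal part, hence \<open>h = 1\<close>,
        and together they contribute \<open>4 * k\<close>.\<close>
      from this[of "X_vec p"] this[of "Y_vec p"]
      have "hlap (u'' p) p - hlap (v'' p) p + 4 * k \<le> 0"
        by (simp add: hlap_def h_def X_vec_def Y_vec_def)
      moreover have "hlap (u'' p) p = 0" "hlap (v'' p) p = 0"
        using u v pD hlaplacian_eq_hlap[OF D(1) pD] uu vv by (auto simp: dirichlet_solution_def)
      ultimately show False using k by simp
    qed
    then have pf: "p \<in> frontier D" using p(1) D(1) by (simp add: frontier_def interior_open)
    have "u q - v q \<le> g q" using k h0 by (simp add: g_def)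
    also have "\<dots> \<le> g p" using p(2) q by blast
    also have "\<dots> = k * h p" using u v pf by (simp add: g_def dirichlet_solution_def)
    also have "\<dots> \<le> k * H" using H[OF p(1)] k by simp
    finally show ?thesis .
  qed
  note main = this
  have "u q - v q \<le> 0 + d" if "0 < d" for d
  proof -
    have "0 \<le> H" using H[OF q] h0[of q] by simp
    then have "d / (H + 1) * H \<le> d" "0 < d / (H + 1)" using that by (simp_all add: field_simps)
    then show ?thesis using main[of "d / (H + 1)"] by simp
  qed
  then have "u q - v q \<le> 0" by (rule field_le_epsilon)
  then show ?thesis by simp
qed

lemma C2_data_cong_open:
  assumes "open S" "C2_data S f f' f''" "\<And>x. x \<in> S \<Longrightarrow> f x = g x"
  shows "C2_data S g f' f''"
  using assms unfolding C2_data_def by (metis has_derivative_transform_within_open)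

text \<open>The local witnesses must be replaced by globally defined ones.
  \<open>frechet_derivative\<close> is a canonical choice, and uniqueness of derivatives identifies
  it with each local witness.\<close>

lemma C2_on_local:
  fixes f :: "'a::euclidean_space \<Rightarrow> 'b::real_normed_vector"
  assumes "\<And>x. x \<in> S \<Longrightarrow> \<exists>U. open U \<and> x \<in> U \<and> C2_on U f"
  shows "C2_on S f"
proof -
  define f' where "f' x = Blinfun (frechet_derivative f (at x))" for x
  define f'' where "f'' x = Blinfun (frechet_derivative f' (at x))" for x
  have loc: "(f has_derivative blinfun_apply (f' x)) (at x) \<and> (f' has_derivative blinfun_apply (f'' x)) (at x)
    \<and> continuous (at x) f''" if x: "x \<in> S" for x
  proof -
    obtain U g' g'' where U: "open U" "x \<in> U" and g: "C2_data U f g' g''"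
      using assms[OF x] by (auto simp: C2_on_iff_C2_data)
    have eq: "f' y = g' y" if "y \<in> U" for y
    proof -
      have "frechet_derivative f (at y) = blinfun_apply (g' y)"
        using g that unfolding C2_data_def by (metis frechet_derivative_at)
      then show ?thesis by (simp add: f'_def blinfun_apply_inverse)
    qed
    have d: "(f' has_derivative blinfun_apply (g'' y)) (at y)" if "y \<in> U" for y
      using g that eq U(1) unfolding C2_data_def
      by (metis (no_types, lifting) has_derivative_transform_within_open)
    have eq2: "f'' y = g'' y" if "y \<in> U" for y
    proof -
      have "frechet_derivative f' (at y) = blinfun_apply (g'' y)"
        using d[OF that] by (metis frechet_derivative_at)
      then show ?thesis by (simp add: f''_def blinfun_apply_inverse)
    qed
    have "continuous_on U f''"
      using g eq2 unfolding C2_data_def by (metis continuous_on_cong)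
    then show ?thesis
      using U g d eq eq2 unfolding C2_data_def by (metis continuous_on_eq_continuous_at)
  qed
  have "continuous_on S f''"
    using loc by (intro continuous_at_imp_continuous_on) blast
  then show ?thesis
    using loc unfolding C2_on_def by blast
qed

text \<open>A calculus of functions that are of class \<open>C\<^sup>2\<close> in the first variable, with derivatives jointly
  continuous in both variables; kernels \<open>k (hinv q \<star> p)\<close> are built from these.\<close>

definition C2_param :: "(heis \<Rightarrow> heis \<Rightarrow> real) \<Rightarrow> (heis \<Rightarrow> heis \<Rightarrow> heis \<Rightarrow>\<^sub>L real) \<Rightarrow>
    (heis \<Rightarrow> heis \<Rightarrow> heis \<Rightarrow>\<^sub>L heis \<Rightarrow>\<^sub>L real) \<Rightarrow> bool" where
  "C2_param f f' f'' \<longleftrightarrow>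
     (\<forall>q p. ((\<lambda>q. f q p) has_derivative blinfun_apply (f' q p)) (at q)) \<and>
     (\<forall>q p. ((\<lambda>q. f' q p) has_derivative blinfun_apply (f'' q p)) (at q)) \<and>
     continuous_on UNIV (\<lambda>x. f (fst x) (snd x)) \<and>
     continuous_on UNIV (\<lambda>x. f' (fst x) (snd x)) \<and>
     continuous_on UNIV (\<lambda>x. f'' (fst x) (snd x))"

lemma C2_param_imp_C2_data:
  assumes "C2_param f f' f''"
  shows "C2_data UNIV (\<lambda>q. f q p) (\<lambda>q. f' q p) (\<lambda>q. f'' q p)"
proof -
  have "continuous_on UNIV (\<lambda>q. (q, p))" by (intro continuous_intros)
  moreover have c: "continuous_on UNIV (\<lambda>x. f'' (fst x) (snd x))" using assms by (simp add: C2_param_def)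
  ultimately have "continuous_on UNIV (\<lambda>q. f'' (fst (q, p)) (snd (q, p)))"
    using continuous_on_compose2[OF c] by blast
  then have "continuous_on UNIV (\<lambda>q. f'' q p)" by simp
  then show ?thesis using assms unfolding C2_param_def C2_data_def by blast
qed

lemma C2_param_const:
  assumes "continuous_on UNIV g"
  shows "C2_param (\<lambda>q p. g p) (\<lambda>q p. 0) (\<lambda>q p. 0)"
  unfolding C2_param_def
  by (auto intro!: derivative_eq_intros continuous_intros continuous_on_compose2[OF assms])

lemma C2_param_linear:
  assumes "bounded_linear l"
  shows "C2_param (\<lambda>q p. l q) (\<lambda>q p. Blinfun l) (\<lambda>q p. 0)"
  unfolding C2_param_def using bounded_linear_Blinfun_apply[OF assms] assms
  by (auto intro!: continuous_intros linear_continuous_on_compose[of _ _ l] bounded_linear.linear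
      simp: bounded_linear_imp_has_derivative zero_blinfun.rep_eq)

lemma C2_param_add:
  assumes "C2_param f f' f''" "C2_param g g' g''"
  shows "C2_param (\<lambda>q p. f q p + g q p) (\<lambda>q p. f' q p + g' q p) (\<lambda>q p. f'' q p + g'' q p)"
  using assms unfolding C2_param_def
  by (auto intro!: has_derivative_add continuous_on_add simp: plus_blinfun.rep_eq)

text \<open>The composition with \<open>blinfun_scaleR_left (g' q p)\<close> is the rank-one map
  sending \<open>h\<close> to \<open>f' q p h *\<^sub>R g' q p\<close>; two such terms form the
  mixed part of the second derivative.\<close>

lemma C2_param_mult:
  assumes "C2_param f f' f''" "C2_param g g' g''"
  shows "C2_param (\<lambda>q p. f q p * g q p) (\<lambda>q p. f q p *\<^sub>R g' q p + g q p *\<^sub>R f' q p)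
     (\<lambda>q p. (f q p *\<^sub>R g'' q p + (blinfun_scaleR_left (g' q p) o\<^sub>L f' q p)) +
            (g q p *\<^sub>R f'' q p + (blinfun_scaleR_left (f' q p) o\<^sub>L g' q p)))"
proof -
  have f: "((\<lambda>q. f q p) has_derivative blinfun_apply (f' q p)) (at q)"
      "((\<lambda>q. f' q p) has_derivative blinfun_apply (f'' q p)) (at q)"
    and g: "((\<lambda>q. g q p) has_derivative blinfun_apply (g' q p)) (at q)"
      "((\<lambda>q. g' q p) has_derivative blinfun_apply (g'' q p)) (at q)" for q p
    using assms unfolding C2_param_def by blast+
  have [continuous_intros]: "continuous_on UNIV (\<lambda>x. f (fst x) (snd x))" "continuous_on UNIV (\<lambda>x. g (fst x) (snd x))"
     "continuous_on UNIV (\<lambda>x. f' (fst x) (snd x))" "continuous_on UNIV (\<lambda>x. g' (fst x) (snd x))"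
     "continuous_on UNIV (\<lambda>x. f'' (fst x) (snd x))" "continuous_on UNIV (\<lambda>x. g'' (fst x) (snd x))"
    using assms unfolding C2_param_def by blast+
  have "((\<lambda>q. f q p * g q p) has_derivative blinfun_apply (f q p *\<^sub>R g' q p + g q p *\<^sub>R f' q p)) (at q)" for q p
    using has_derivative_mult[OF f(1)[of p q] g(1)[of p q]]
    by (rule has_derivative_eq_rhs) (rule ext, simp add: blinfun.add_left blinfun.scaleR_left mult.commute)
  moreover have "((\<lambda>q. f q p *\<^sub>R g' q p + g q p *\<^sub>R f' q p) has_derivative
     blinfun_apply ((f q p *\<^sub>R g'' q p + (blinfun_scaleR_left (g' q p) o\<^sub>L f' q p)) +
            (g q p *\<^sub>R f'' q p + (blinfun_scaleR_left (f' q p) o\<^sub>L g' q p)))) (at q)" for q p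
    using has_derivative_add[OF has_derivative_scaleR[OF f(1)[of p q] g(2)[of p q]] has_derivative_scaleR[OF g(1)[of p q] f(2)[of p q]]]
    by (rule has_derivative_eq_rhs) (rule ext, simp add: blinfun.add_left blinfun.scaleR_left)
  moreover have "continuous_on UNIV (\<lambda>x. (f (fst x) (snd x) *\<^sub>R g'' (fst x) (snd x) + (blinfun_scaleR_left (g' (fst x) (snd x)) o\<^sub>L f' (fst x) (snd x))) +
            (g (fst x) (snd x) *\<^sub>R f'' (fst x) (snd x) + (blinfun_scaleR_left (f' (fst x) (snd x)) o\<^sub>L g' (fst x) (snd x))))"
    by (intro continuous_intros bounded_linear.continuous_on[OF bounded_linear_blinfun_scaleR_left])
  ultimately show ?thesis
    unfolding C2_param_def by (intro conjI allI continuous_intros) auto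
qed

lemma C2_param_compose:
  assumes "C2_param f f' f''" and k: "\<And>t. (k has_real_derivative k' t) (at t)"
    "\<And>t. (k' has_real_derivative k'' t) (at t)" "continuous_on UNIV k''"
  shows "C2_param (\<lambda>q p. k (f q p)) (\<lambda>q p. k' (f q p) *\<^sub>R f' q p)
     (\<lambda>q p. k' (f q p) *\<^sub>R f'' q p + (blinfun_scaleR_left (f' q p) o\<^sub>L (k'' (f q p) *\<^sub>R f' q p)))"
proof -
  have f: "((\<lambda>q. f q p) has_derivative blinfun_apply (f' q p)) (at q)"
      "((\<lambda>q. f' q p) has_derivative blinfun_apply (f'' q p)) (at q)" for q p
    using assms unfolding C2_param_def by blast+
  have cf [continuous_intros]: "continuous_on UNIV (\<lambda>x. f (fst x) (snd x))"
     "continuous_on UNIV (\<lambda>x. f' (fst x) (snd x))" "continuous_on UNIV (\<lambda>x. f'' (fst x) (snd x))"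
    using assms unfolding C2_param_def by blast+
  have kf: "((\<lambda>q. k (f q p)) has_derivative (\<lambda>h. k' (f q p) * f' q p h)) (at q)"
    "((\<lambda>q. k' (f q p)) has_derivative (\<lambda>h. k'' (f q p) * f' q p h)) (at q)" for q p
    using has_derivative_compose[OF f(1)[of p q] k(1)[unfolded has_field_derivative_def]]
      has_derivative_compose[OF f(1)[of p q] k(2)[unfolded has_field_derivative_def]] by auto
  have "continuous_on UNIV k" "continuous_on UNIV k'"
    using k(1,2) by (auto intro!: DERIV_continuous_on simp: has_field_derivative_at_within)
  then have ck [continuous_intros]: "continuous_on UNIV (\<lambda>x. k (f (fst x) (snd x)))"
     "continuous_on UNIV (\<lambda>x. k' (f (fst x) (snd x)))" "continuous_on UNIV (\<lambda>x. k'' (f (fst x) (snd x)))"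
    using k(3) cf(1) by (auto intro: continuous_on_compose2)
  have "((\<lambda>q. k (f q p)) has_derivative blinfun_apply (k' (f q p) *\<^sub>R f' q p)) (at q)" for q p
    by (rule has_derivative_eq_rhs[OF kf(1)]) (rule ext, simp add: blinfun.scaleR_left)
  moreover have "((\<lambda>q. k' (f q p) *\<^sub>R f' q p) has_derivative
     blinfun_apply (k' (f q p) *\<^sub>R f'' q p + (blinfun_scaleR_left (f' q p) o\<^sub>L (k'' (f q p) *\<^sub>R f' q p)))) (at q)" for q p
    by (rule has_derivative_eq_rhs[OF has_derivative_scaleR[OF kf(2) f(2)]])
      (rule ext, simp add: blinfun.add_left blinfun.scaleR_left)
  moreover have "continuous_on UNIV (\<lambda>x. k' (f (fst x) (snd x)) *\<^sub>R f'' (fst x) (snd x) +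
      (blinfun_scaleR_left (f' (fst x) (snd x)) o\<^sub>L (k'' (f (fst x) (snd x)) *\<^sub>R f' (fst x) (snd x))))"
    by (intro continuous_intros bounded_linear.continuous_on[OF bounded_linear_blinfun_scaleR_left])
  ultimately show ?thesis
    unfolding C2_param_def by (intro conjI allI continuous_intros) auto
qed

subsection \<open>Averages: symmetry and second-order expansion\<close>

lemma nn_integral_lborel_translate:
  fixes c :: "'a::euclidean_space"
  assumes [measurable]: "f \<in> borel_measurable borel"
  shows "(\<integral>\<^sup>+x. f (c + x) \<partial>lborel) = (\<integral>\<^sup>+x. f x \<partial>lborel)"
proof -
  have "(\<integral>\<^sup>+x. f x \<partial>lborel) = (\<integral>\<^sup>+x. f x \<partial>distr lborel borel ((+) c))"
    by (simp only: lborel_distr_plus)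
  also have "\<dots> = (\<integral>\<^sup>+x. f (c + x) \<partial>lborel)"
    by (subst nn_integral_distr) auto
  finally show ?thesis ..
qed

text \<open>Both kinds of translation are compositions of a shear in the third coordinate with a Euclidean
  translation, hence preserve Lebesgue measure.\<close>

lemma distr_lborel_shear:
  fixes \<kappa> :: "real \<times> real \<Rightarrow> real"
  assumes \<kappa>: "continuous_on UNIV \<kappa>"
  shows "distr lborel borel (\<lambda>q :: heis. c + (fst q, fst (snd q), snd (snd q) + \<kappa> (fst q, fst (snd q)))) = lborel"
    (is "distr _ _ (\<lambda>q. c + ?T q) = _")
proof (rule measure_eqI)
  have T: "?T \<in> borel_measurable borel"
    by (intro borel_measurable_continuous_onI continuous_intros continuous_on_compose2[OF \<kappa>]) auto
  then have cT: "(\<lambda>q. c + ?T q) \<in> borel_measurable borel" by simp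
  fix A :: "heis set" assume "A \<in> sets (distr lborel borel (\<lambda>q. c + ?T q))"
  then have A: "A \<in> sets borel" by simp
  define f :: "heis \<Rightarrow> ennreal" where "f x = indicator A (c + x)" for x
  have f [measurable]: "f \<in> borel_measurable borel"
    unfolding f_def using A by measurable
  have *: "(\<integral>\<^sup>+q. g q \<partial>lborel) = (\<integral>\<^sup>+x. \<integral>\<^sup>+y. \<integral>\<^sup>+z. g (x, y, z) \<partial>lborel \<partial>lborel \<partial>lborel)"
    if g: "g \<in> borel_measurable borel" for g :: "heis \<Rightarrow> ennreal"
  proof -
    have g1: "g \<in> borel_measurable (lborel \<Otimes>\<^sub>M lborel)"
      using g by (simp add: lborel_prod)
    have "(\<integral>\<^sup>+q. g q \<partial>lborel) = (\<integral>\<^sup>+q. g q \<partial>(lborel \<Otimes>\<^sub>M lborel))" by (simp only: lborel_prod)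
    also have "\<dots> = (\<integral>\<^sup>+x. \<integral>\<^sup>+p. g (x, p) \<partial>lborel \<partial>lborel)"
      by (rule lborel.nn_integral_fst[OF g1, symmetric])
    also have "\<dots> = (\<integral>\<^sup>+x. \<integral>\<^sup>+y. \<integral>\<^sup>+z. g (x, y, z) \<partial>lborel \<partial>lborel \<partial>lborel)"
    proof (rule nn_integral_cong)
      fix x :: real
      have "(\<lambda>p. g (x, p)) \<in> borel_measurable borel"
        by (intro measurable_compose[OF _ g] borel_measurable_continuous_onI continuous_intros)
      then have gx: "(\<lambda>p. g (x, p)) \<in> borel_measurable (lborel \<Otimes>\<^sub>M lborel)"
        by (simp add: lborel_prod)
      have "(\<integral>\<^sup>+p. g (x, p) \<partial>lborel) = (\<integral>\<^sup>+p. g (x, p) \<partial>(lborel \<Otimes>\<^sub>M lborel))" by (simp only: lborel_prod)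
      also have "\<dots> = (\<integral>\<^sup>+y. \<integral>\<^sup>+z. g (x, y, z) \<partial>lborel \<partial>lborel)"
        by (rule lborel.nn_integral_fst[OF gx, symmetric])
      finally show "(\<integral>\<^sup>+p. g (x, p) \<partial>lborel) = (\<integral>\<^sup>+y. \<integral>\<^sup>+z. g (x, y, z) \<partial>lborel \<partial>lborel)" .
    qed
    finally show ?thesis .
  qed
  have "emeasure (distr lborel borel (\<lambda>q. c + ?T q)) A = (\<integral>\<^sup>+q. indicator A (c + ?T q) \<partial>lborel)"
    using A cT by (subst nn_integral_indicator[symmetric], simp, subst nn_integral_distr) auto
  also have "\<dots> = (\<integral>\<^sup>+q. f (?T q) \<partial>lborel)" by (simp add: f_def)
  also have "\<dots> = (\<integral>\<^sup>+x. \<integral>\<^sup>+y. \<integral>\<^sup>+z. f (x, y, \<kappa> (x, y) + z) \<partial>lborel \<partial>lborel \<partial>lborel)"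
    using measurable_compose[OF T f] by (subst *) (auto simp: add.commute)
  also have "\<dots> = (\<integral>\<^sup>+x. \<integral>\<^sup>+y. \<integral>\<^sup>+z. f (x, y, z) \<partial>lborel \<partial>lborel \<partial>lborel)"
    by (intro nn_integral_cong nn_integral_lborel_translate measurable_compose[OF _ f]
        borel_measurable_continuous_onI continuous_intros)
  also have "\<dots> = (\<integral>\<^sup>+q. f q \<partial>lborel)" by (rule *[OF f, symmetric])
  also have "\<dots> = (\<integral>\<^sup>+q. indicator A q \<partial>lborel)"
    unfolding f_def using A by (intro nn_integral_lborel_translate) auto
  also have "\<dots> = emeasure lborel A" using A by simp
  finally show "emeasure (distr lborel borel (\<lambda>q. c + ?T q)) A = emeasure lborel A" .
qed simp

lemma distr_lborel_hmul_right: "distr lborel borel (\<lambda>q. q \<star> h) = lborel"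
proof -
  have "(\<lambda>q. q \<star> h) = (\<lambda>q. h + (fst q, fst (snd q), snd (snd q) + (fst q * fst (snd h) - fst (snd q) * fst h) / 2))"
    by (simp add: fun_eq_iff hmul_eq prod_eq_iff)
  then show ?thesis
    using distr_lborel_shear[of "\<lambda>x. (fst x * fst (snd h) - snd x * fst h) / 2" h]
    by (simp add: continuous_intros)
qed

lemma distr_lborel_hmul_left: "distr lborel borel (\<lambda>q. h \<star> q) = lborel"
proof -
  have "(\<lambda>q. h \<star> q) = (\<lambda>q. h + (fst q, fst (snd q), snd (snd q) + (fst h * fst (snd q) - fst (snd h) * fst q) / 2))"
    by (simp add: fun_eq_iff hmul_eq prod_eq_iff)
  then show ?thesis
    using distr_lborel_shear[of "\<lambda>x. (fst h * snd x - fst (snd h) * fst x) / 2" h]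
    by (simp add: continuous_intros)
qed

lemma borel_measurable_hmul_const:
  "(\<lambda>q. q \<star> h) \<in> borel_measurable borel" "(\<lambda>q. h \<star> q) \<in> borel_measurable borel"
  by (intro borel_measurable_continuous_onI continuous_intros)+

lemma lborel_integral_hmul:
  fixes f :: "heis \<Rightarrow> real"
  assumes f: "f \<in> borel_measurable borel"
  shows "(\<integral>q. f (q \<star> h) \<partial>lborel) = (\<integral>q. f q \<partial>lborel)" "(\<integral>q. f (h \<star> q) \<partial>lborel) = (\<integral>q. f q \<partial>lborel)"
    and "integrable lborel (\<lambda>q. f (q \<star> h)) \<longleftrightarrow> integrable lborel f"
    and "integrable lborel (\<lambda>q. f (h \<star> q)) \<longleftrightarrow> integrable lborel f"
proof -
  note m = borel_measurable_hmul_const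
  show "(\<integral>q. f (q \<star> h) \<partial>lborel) = (\<integral>q. f q \<partial>lborel)"
    using integral_distr[of "\<lambda>q. q \<star> h" lborel borel f] m f by (simp add: distr_lborel_hmul_right)
  show "(\<integral>q. f (h \<star> q) \<partial>lborel) = (\<integral>q. f q \<partial>lborel)"
    using integral_distr[of "\<lambda>q. h \<star> q" lborel borel f] m f by (simp add: distr_lborel_hmul_left)
  show "integrable lborel (\<lambda>q. f (q \<star> h)) \<longleftrightarrow> integrable lborel f"
    using integrable_distr_eq[of "\<lambda>q. q \<star> h" lborel borel f] m f by (simp add: distr_lborel_hmul_right)
  show "integrable lborel (\<lambda>q. f (h \<star> q)) \<longleftrightarrow> integrable lborel f"
    using integrable_distr_eq[of "\<lambda>q. h \<star> q" lborel borel f] m f by (simp add: distr_lborel_hmul_left)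
qed

lemma hshift_uminus: "hshift e (hshift e q (- w)) w = q"
  by (simp add: hshift_def hmul_assoc) (simp add: hmul_eq prod_eq_iff)

interpretation disc_lborel: pair_sigma_finite step_dist "lborel :: heis measure"
  by unfold_locales

text \<open>After exchanging the integrals, each fixed step is undone by a right translation, which
  preserves Lebesgue measure. This replaces \<open>w\<close> by \<open>- w\<close> and moves the
  shift onto \<open>\<phi>\<close>; the disc is symmetric under that reflection.\<close>

lemma disc_avg_selfadjoint:
  assumes v: "v \<in> borel_measurable borel" "\<And>q. \<bar>v q\<bar> \<le> M" and \<phi>: "integrable lborel \<phi>" "\<phi> \<in> borel_measurable borel"
  shows "(\<integral>q. \<phi> q * disc_avg e v q \<partial>lborel) = (\<integral>q. v q * disc_avg e \<phi> q \<partial>lborel)"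
proof -
  have hm: "(\<lambda>x. hshift e (snd x) (fst x)) \<in> borel_measurable borel"
    by (intro borel_measurable_continuous_onI continuous_intros)
  have s2: "(\<lambda>x :: (real \<times> real) \<times> heis. snd x) \<in> borel_measurable borel"
    by (intro borel_measurable_continuous_onI continuous_intros)
  have sets: "sets (step_dist \<Otimes>\<^sub>M (lborel :: heis measure)) = sets borel"
  proof -
    have "sets (step_dist \<Otimes>\<^sub>M (lborel :: heis measure)) = sets (borel \<Otimes>\<^sub>M borel)"
      by (rule sets_pair_measure_cong) simp_all
    then show ?thesis by (simp only: borel_prod)
  qed
  define G where "G x = \<phi> (snd x) * v (hshift e (snd x) (fst x))" for x
  define H where "H x = \<phi> (hshift e (snd x) (fst x)) * v (snd x)" for x
  have mG: "G \<in> borel_measurable (step_dist \<Otimes>\<^sub>M lborel)" and mH: "H \<in> borel_measurable (step_dist \<Otimes>\<^sub>M lborel)"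
    unfolding measurable_cong_sets[OF sets refl] G_def[abs_def] H_def[abs_def]
    using measurable_compose[OF s2 \<phi>(2)] measurable_compose[OF hm v(1)] measurable_compose[OF hm \<phi>(2)] measurable_compose[OF s2 v(1)]
    by simp_all
  have bnd: "\<bar>a * v q\<bar> \<le> M * \<bar>a\<bar>" for a q
    using mult_left_mono[OF v(2)[of q], of "\<bar>a\<bar>"] by (simp add: abs_mult mult.commute)
  have vh: "(\<lambda>q. v (hshift e q w)) \<in> borel_measurable borel" and ph: "(\<lambda>q. \<phi> (hshift e q w)) \<in> borel_measurable borel" for w
    by (intro measurable_compose[OF _ v(1)] measurable_compose[OF _ \<phi>(2)] borel_measurable_continuous_onI continuous_intros)+
  have phi_int: "integrable lborel (\<lambda>q. \<phi> (hshift e q w))" for w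
    using lborel_integral_hmul(3)[OF \<phi>(2)] \<phi>(1) by (simp add: hshift_def)
  have phi_val: "(\<integral>q. \<bar>\<phi> (hshift e q w)\<bar> \<partial>lborel) = (\<integral>q. \<bar>\<phi> q\<bar> \<partial>lborel)" for w
    using lborel_integral_hmul(1)[of "\<lambda>q. \<bar>\<phi> q\<bar>"] \<phi>(2) by (simp add: hshift_def)
  have iG: "integrable lborel (\<lambda>q. G (w, q))" and iH: "integrable lborel (\<lambda>q. H (w, q))" for w
  proof -
    show "integrable lborel (\<lambda>q. G (w, q))"
      using \<phi> vh bnd by (intro Bochner_Integration.integrable_bound[OF integrable_mult_right[OF integrable_abs[OF \<phi>(1)], of M]])
        (auto simp: G_def intro!: AE_I2 order_trans[OF bnd] mult_right_mono)
    show "integrable lborel (\<lambda>q. H (w, q))"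
      using ph v bnd by (intro Bochner_Integration.integrable_bound[OF integrable_mult_right[OF integrable_abs[OF phi_int], of M w]])
        (auto simp: H_def intro!: AE_I2 order_trans[OF bnd] mult_right_mono)
  qed
  have M0: "0 \<le> M" using v(2)[of 0] by simp
  have bG: "\<bar>\<integral>q. norm (G (w, q)) \<partial>lborel\<bar> \<le> M * (\<integral>q. \<bar>\<phi> q\<bar> \<partial>lborel)"
    and bH: "\<bar>\<integral>q. norm (H (w, q)) \<partial>lborel\<bar> \<le> M * (\<integral>q. \<bar>\<phi> q\<bar> \<partial>lborel)" for w
  proof -
    have "(\<integral>q. norm (G (w, q)) \<partial>lborel) \<le> (\<integral>q. M * \<bar>\<phi> q\<bar> \<partial>lborel)"
      using iG[of w] \<phi>(1) by (intro integral_mono) (auto simp: G_def bnd)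
    moreover have "0 \<le> (\<integral>q. norm (G (w, q)) \<partial>lborel)" by (intro integral_nonneg_AE) simp
    ultimately show "\<bar>\<integral>q. norm (G (w, q)) \<partial>lborel\<bar> \<le> M * (\<integral>q. \<bar>\<phi> q\<bar> \<partial>lborel)" by simp
    have "(\<integral>q. norm (H (w, q)) \<partial>lborel) \<le> (\<integral>q. M * \<bar>\<phi> (hshift e q w)\<bar> \<partial>lborel)"
      using iH[of w] phi_int by (intro integral_mono) (auto simp: H_def bnd)
    moreover have "0 \<le> (\<integral>q. norm (H (w, q)) \<partial>lborel)" by (intro integral_nonneg_AE) simp
    ultimately show "\<bar>\<integral>q. norm (H (w, q)) \<partial>lborel\<bar> \<le> M * (\<integral>q. \<bar>\<phi> q\<bar> \<partial>lborel)" using phi_val by simp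
  qed
  have intG: "integrable (step_dist \<Otimes>\<^sub>M lborel) G" and intH: "integrable (step_dist \<Otimes>\<^sub>M lborel) H"
  proof -
    have "(\<lambda>w. \<integral>q. norm (G (w, q)) \<partial>lborel) \<in> borel_measurable step_dist"
      using mG by (intro lborel.borel_measurable_lebesgue_integral) (simp add: case_prod_beta')
    then have "integrable step_dist (\<lambda>w. \<integral>q. norm (G (w, q)) \<partial>lborel)"
      using bG by (intro step.integrable_const_bound[where B = "M * (\<integral>q. \<bar>\<phi> q\<bar> \<partial>lborel)"]) auto
    then show "integrable (step_dist \<Otimes>\<^sub>M lborel) G"
      using iG by (intro disc_lborel.Fubini_integrable mG) auto
    have "(\<lambda>w. \<integral>q. norm (H (w, q)) \<partial>lborel) \<in> borel_measurable step_dist"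
      using mH by (intro lborel.borel_measurable_lebesgue_integral) (simp add: case_prod_beta')
    then have "integrable step_dist (\<lambda>w. \<integral>q. norm (H (w, q)) \<partial>lborel)"
      using bH by (intro step.integrable_const_bound[where B = "M * (\<integral>q. \<bar>\<phi> q\<bar> \<partial>lborel)"]) auto
    then show "integrable (step_dist \<Otimes>\<^sub>M lborel) H"
      using iH by (intro disc_lborel.Fubini_integrable mH) auto
  qed
  have "(\<integral>q. \<phi> q * disc_avg e v q \<partial>lborel) = (\<integral>q. \<integral>w. G (w, q) \<partial>step_dist \<partial>lborel)"
    by (simp add: G_def disc_avg_def)
  also have "\<dots> = (\<integral>w. \<integral>q. G (w, q) \<partial>lborel \<partial>step_dist)"
    using disc_lborel.Fubini_integral[of "\<lambda>w q. G (w, q)"] intG by (simp add: case_prod_beta')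
  also have "\<dots> = (\<integral>w. \<integral>q. H (- w, q) \<partial>lborel \<partial>step_dist)"
  proof (rule Bochner_Integration.integral_cong[OF refl])
    fix w
    have "(\<integral>q. G (w, q) \<partial>lborel) = (\<integral>q. G (w, hshift e q (- w)) \<partial>lborel)"
      using lborel_integral_hmul(1)[of "\<lambda>q. G (w, q)" "(e * fst (- w), e * snd (- w), 0)"] \<phi>(2) vh
      by (simp add: G_def hshift_def)
    also have "\<dots> = (\<integral>q. H (- w, q) \<partial>lborel)" by (simp add: G_def H_def hshift_uminus)
    finally show "(\<integral>q. G (w, q) \<partial>lborel) = (\<integral>q. H (- w, q) \<partial>lborel)" .
  qed
  also have "\<dots> = (\<integral>w. \<integral>q. H (w, q) \<partial>lborel \<partial>step_dist)"
  proof (rule integral_step_dist_reflect(4))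
    have "(\<lambda>w. \<integral>q. H (w, q) \<partial>lborel) \<in> borel_measurable step_dist"
      using mH by (intro lborel.borel_measurable_lebesgue_integral) (simp add: case_prod_beta')
    then show "(\<lambda>w. \<integral>q. H (w, q) \<partial>lborel) \<in> borel_measurable borel"
      by (simp cong: measurable_cong_sets)
  qed
  also have "\<dots> = (\<integral>q. \<integral>w. H (w, q) \<partial>step_dist \<partial>lborel)"
    using disc_lborel.Fubini_integral[of "\<lambda>w q. H (w, q)"] intH by (simp add: case_prod_beta')
  also have "\<dots> = (\<integral>q. v q * disc_avg e \<phi> q \<partial>lborel)"
    by (simp add: H_def disc_avg_def mult.commute)
  finally show ?thesis .
qed

section \<open>Taylor expansion of averages and its passage to the limit\<close>

lemma blinfun2_diff_le:
  fixes A B :: "heis \<Rightarrow>\<^sub>L heis \<Rightarrow>\<^sub>L real"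
  assumes "norm (A - B) \<le> \<omega>"
  shows "\<bar>A v v - B v v\<bar> \<le> \<omega> * (norm v)\<^sup>2"
proof -
  have "\<bar>A v v - B v v\<bar> = norm ((A - B) v v)" by (simp add: blinfun.diff_left)
  also have "\<dots> \<le> norm ((A - B) v) * norm v" by (rule norm_blinfun)
  also have "\<dots> \<le> (norm (A - B) * norm v) * norm v" by (intro mult_right_mono norm_blinfun) simp
  also have "\<dots> \<le> (\<omega> * norm v) * norm v" using assms by (intro mult_right_mono) auto
  finally show ?thesis by (simp add: power2_eq_square mult.assoc)
qed

text \<open>In the second-order Taylor polynomial \<open>P\<close> the linear and mixed terms have
  mean zero and the two squares have mean \<open>step_var\<close>. The error is governed by the
  oscillation \<open>\<omega>\<close> of \<open>f''\<close> over the points within reach of one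
  step, since the step direction \<open>V w\<close> has norm at most
  \<open>1 + norm q\<close>.\<close>

lemma disc_avg_taylor:
  assumes f: "C2_data S f f' f''" "f \<in> borel_measurable borel" and e: "0 \<le> e"
    and S: "\<And>p. dist p q \<le> (1 + norm q) * e \<Longrightarrow> p \<in> S \<and> norm (f'' p - f'' q) \<le> \<omega>"
  shows "\<bar>disc_avg e f q - f q - e\<^sup>2 * step_var * hlap (f'' q) q / 2\<bar> \<le> e\<^sup>2 * \<omega> * (1 + norm q)\<^sup>2 / 2"
proof -
  define V where "V w = fst w *\<^sub>R X_vec q + snd w *\<^sub>R Y_vec q" for w :: "real \<times> real"
  define A where "A = f'' q"
  have shift: "hshift e q w = q + e *\<^sub>R V w" for w
    by (simp add: hshift_frame V_def scaleR_add_right)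
  have VB: "norm (V w) \<le> 1 + norm q" if "norm w < 1" for w
    using dist_hshift_le[of w 1 q] that by (simp add: hshift_frame V_def dist_norm add.assoc)
  define P where "P w = f q + e * f' q (V w) + e\<^sup>2 * A (V w) (V w) / 2" for w
  have \<omega>: "0 \<le> \<omega>" using S[of q] e by (simp add: order_trans[OF norm_ge_zero])
  have err: "\<bar>f (hshift e q w) - P w\<bar> \<le> e\<^sup>2 * \<omega> * (1 + norm q)\<^sup>2 / 2" if w: "norm w < 1" for w
  proof -
    have near: "dist (q + t *\<^sub>R (e *\<^sub>R V w)) q \<le> (1 + norm q) * e" if "0 \<le> t" "t \<le> 1" for t
    proof -
      have "dist (q + t *\<^sub>R (e *\<^sub>R V w)) q = t * (e * norm (V w))"
        using that e by (simp add: dist_norm)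
      also have "\<dots> \<le> 1 * (e * (1 + norm q))"
        using that e VB[OF w] by (intro mult_mono) auto
      finally show ?thesis by (simp add: mult.commute)
    qed
    obtain t where t: "0 \<le> t" "t \<le> 1"
      "f (q + e *\<^sub>R V w) = f q + f' q (e *\<^sub>R V w) + f'' (q + t *\<^sub>R (e *\<^sub>R V w)) (e *\<^sub>R V w) (e *\<^sub>R V w) / 2"
      using C2_data_taylor[OF f(1), of q "e *\<^sub>R V w"] S near by metis
    have "f (hshift e q w) - P w = e\<^sup>2 / 2 * (f'' (q + t *\<^sub>R (e *\<^sub>R V w)) (V w) (V w) - A (V w) (V w))"
      using t(3) by (simp add: shift P_def blinfun.scaleR_right blinfun.scaleR_left power2_eq_square algebra_simps)
    then have "\<bar>f (hshift e q w) - P w\<bar> = e\<^sup>2 / 2 * \<bar>f'' (q + t *\<^sub>R (e *\<^sub>R V w)) (V w) (V w) - A (V w) (V w)\<bar>"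
      by (simp only: abs_mult abs_divide) simp
    also have "\<dots> \<le> e\<^sup>2 / 2 * (\<omega> * (norm (V w))\<^sup>2)"
      unfolding A_def using S[OF near[OF t(1,2)]] by (intro mult_left_mono blinfun2_diff_le) auto
    also have "\<dots> \<le> e\<^sup>2 / 2 * (\<omega> * (1 + norm q)\<^sup>2)"
      using VB[OF w] \<omega> by (intro mult_left_mono power_mono) auto
    finally show ?thesis by (simp add: mult.assoc)
  qed
  have P: "P w = f q + (e * f' q (X_vec q)) * fst w + (e * f' q (Y_vec q)) * snd w
      + (e\<^sup>2 * A (X_vec q) (X_vec q) / 2) * (fst w)\<^sup>2 + (e\<^sup>2 * A (Y_vec q) (Y_vec q) / 2) * (snd w)\<^sup>2
      + (e\<^sup>2 * (A (X_vec q) (Y_vec q) + A (Y_vec q) (X_vec q)) / 2) * (fst w * snd w)" for w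
    by (simp add: P_def V_def blinfun.add_right blinfun.add_left blinfun.scaleR_right blinfun.scaleR_left
        power2_eq_square algebra_simps add_divide_distrib)
  have iP: "integrable step_dist P"
    unfolding P[abs_def] by (intro Bochner_Integration.integrable_add integrable_mult_right integrable_step_dist_moments) simp
  have vP: "(\<integral>w. P w \<partial>step_dist) = f q + e\<^sup>2 * step_var * hlap (f'' q) q / 2"
    unfolding P using step.prob_space
    by (simp add: integrable_step_dist_moments step_dist_moments(1-3) step_var_eq)
      (simp add: hlap_def A_def algebra_simps add_divide_distrib)
  have fm: "(\<lambda>w. f (hshift e q w)) \<in> borel_measurable borel"
    by (rule borel_measurable_hshift_apply[OF f(2)])
  have Pm: "P \<in> borel_measurable borel"
    unfolding P[abs_def] by (intro borel_measurable_continuous_onI continuous_intros)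
  have i: "integrable step_dist (\<lambda>w. f (hshift e q w) - P w)"
    using fm Pm err by (intro integrable_step_dist_bounded[where B = "e\<^sup>2 * \<omega> * (1 + norm q)\<^sup>2 / 2"]) auto
  then have fi: "integrable step_dist (\<lambda>w. f (hshift e q w))"
    using Bochner_Integration.integrable_add[OF i iP] by simp
  have "disc_avg e f q - f q - e\<^sup>2 * step_var * hlap (f'' q) q / 2 = (\<integral>w. f (hshift e q w) - P w \<partial>step_dist)"
    using fi iP by (simp add: disc_avg_def vP)
  also have "\<bar>\<dots>\<bar> \<le> (\<integral>w. \<bar>f (hshift e q w) - P w\<bar> \<partial>step_dist)" by (rule integral_abs_bound)
  also have "\<dots> \<le> (\<integral>w. e\<^sup>2 * \<omega> * (1 + norm q)\<^sup>2 / 2 \<partial>step_dist)"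
  proof (rule integral_mono_AE)
    show "AE w in step_dist. \<bar>f (hshift e q w) - P w\<bar> \<le> e\<^sup>2 * \<omega> * (1 + norm q)\<^sup>2 / 2"
      using AE_step_dist by eventually_elim (rule err)
  qed (use i in auto)
  also have "\<dots> = e\<^sup>2 * \<omega> * (1 + norm q)\<^sup>2 / 2" using step.prob_space by simp
  finally show ?thesis .
qed

lemma disc_avg_difference_quotient:
  assumes f: "C2_data S f f' f''" "f \<in> borel_measurable borel" and S: "open S" "q \<in> S"
    and e: "\<And>i. 0 < e i" "e \<longlonglongrightarrow> 0"
  shows "(\<lambda>i. (disc_avg (e i) f q - f q) / (e i)\<^sup>2) \<longlonglongrightarrow> step_var * hlap (f'' q) q / 2"
proof (rule LIMSEQ_I)
  fix \<eta> :: real assume "0 < \<eta>"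
  \<comment> \<open>With this oscillation the error in \<open>disc_avg_taylor\<close> is at most
    \<open>(e i)\<^sup>2 * (\<eta> / 2)\<close>.\<close>
  define \<omega> where "\<omega> = \<eta> / (1 + norm q)\<^sup>2"
  have q1: "0 < 1 + norm q" by (simp add: add_pos_nonneg)
  have "0 < \<omega>" using \<open>0 < \<eta>\<close> q1 by (simp add: \<omega>_def)
  have "isCont f'' q" using f(1) S by (simp add: C2_data_def continuous_on_eq_continuous_at)
  then obtain d1 where d1: "0 < d1" "\<And>p. dist p q < d1 \<Longrightarrow> dist (f'' p) (f'' q) < \<omega>"
    using \<open>0 < \<omega>\<close> unfolding continuous_at_eps_delta dist_norm by metis
  obtain d2 where d2: "0 < d2" "ball q d2 \<subseteq> S" using S by (metis open_contains_ball)
  have "0 < min d1 d2 / (1 + norm q)" using d1(1) d2(1) q1 by simp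
  from order_tendstoD(2)[OF e(2) this]
  obtain N where N: "\<And>i. N \<le> i \<Longrightarrow> e i < min d1 d2 / (1 + norm q)"
    unfolding eventually_sequentially by blast
  show "\<exists>N. \<forall>i\<ge>N. norm ((disc_avg (e i) f q - f q) / (e i)\<^sup>2 - step_var * hlap (f'' q) q / 2) < \<eta>"
  proof (intro exI allI impI)
    fix i assume "N \<le> i"
    have small: "(1 + norm q) * e i < min d1 d2"
      using N[OF \<open>N \<le> i\<close>] q1 by (simp only: pos_less_divide_eq mult.commute)
    have "p \<in> S \<and> norm (f'' p - f'' q) \<le> \<omega>" if "dist p q \<le> (1 + norm q) * e i" for p
      using that small d1(2)[of p] d2(2) by (auto simp: dist_norm norm_minus_commute)
    from disc_avg_taylor[OF f less_imp_le[OF e(1)] this]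
    have "\<bar>disc_avg (e i) f q - f q - (e i)\<^sup>2 * step_var * hlap (f'' q) q / 2\<bar> \<le> (e i)\<^sup>2 * (\<eta> / 2)"
      using q1 by (simp add: \<omega>_def)
    then have "\<bar>disc_avg (e i) f q - f q - (e i)\<^sup>2 * step_var * hlap (f'' q) q / 2\<bar> / (e i)\<^sup>2 \<le> \<eta> / 2"
      using e(1)[of i] by (simp add: pos_divide_le_eq mult.commute)
    moreover have "\<bar>disc_avg (e i) f q - f q - (e i)\<^sup>2 * step_var * hlap (f'' q) q / 2\<bar> / (e i)\<^sup>2
        = \<bar>(disc_avg (e i) f q - f q) / (e i)\<^sup>2 - step_var * hlap (f'' q) q / 2\<bar>"
    proof -
      have "(disc_avg (e i) f q - f q) / (e i)\<^sup>2 - step_var * hlap (f'' q) q / 2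
         = (disc_avg (e i) f q - f q - (e i)\<^sup>2 * step_var * hlap (f'' q) q / 2) / (e i)\<^sup>2"
        using e(1)[of i] by (simp add: diff_divide_distrib)
      then show ?thesis by (simp only: abs_divide) simp
    qed
    ultimately show "norm ((disc_avg (e i) f q - f q) / (e i)\<^sup>2 - step_var * hlap (f'' q) q / 2) < \<eta>"
      using \<open>0 < \<eta>\<close> by simp
  qed
qed

lemma hlap_bound: "\<bar>hlap A q\<bar> \<le> 2 * norm A * (1 + norm q)\<^sup>2"
proof -
  have *: "\<bar>A v v\<bar> \<le> norm A * (1 + norm q)\<^sup>2" if "norm v \<le> 1 + norm q" for v
  proof -
    have "\<bar>A v v\<bar> \<le> norm A * (norm v)\<^sup>2" using blinfun2_diff_le[of A 0 "norm A" v] by simp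
    also have "\<dots> \<le> norm A * (1 + norm q)\<^sup>2" using that by (intro mult_left_mono power_mono) auto
    finally show ?thesis .
  qed
  have "norm (X_vec q) \<le> 1 + norm q" "norm (Y_vec q) \<le> 1 + norm q"
    using dist_hshift_le[of "(1, 0)" 1 q] dist_hshift_le[of "(0, 1)" 1 q]
    by (simp_all add: hshift_frame dist_norm norm_Pair)
  then show ?thesis using *[of "X_vec q"] *[of "Y_vec q"] unfolding hlap_def by linarith
qed

text \<open>Supplies the dominating constant for the difference quotients in
  \<open>weak_laplacian\<close>. Bounding the oscillation of \<open>f''\<close> by
  \<open>2 * C\<close> gives the order \<open>e\<^sup>2\<close> uniformly on
  \<open>K\<close>.\<close>

lemma disc_avg_difference_bound:
  assumes f: "C2_data S f f' f''" "f \<in> borel_measurable borel" and S: "open S" "compact K" "K \<subseteq> S"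
  obtains B \<epsilon> where "0 < \<epsilon>" "\<And>e q. q \<in> K \<Longrightarrow> 0 \<le> e \<Longrightarrow> e < \<epsilon> \<Longrightarrow> \<bar>disc_avg e f q - f q\<bar> \<le> B * e\<^sup>2"
proof -
  obtain r where r: "0 < r" "(\<Union>q\<in>K. cball q r) \<subseteq> S"
    using compact_subset_open_imp_cball_epsilon_subset[OF S(2,1,3)] .
  have "compact (\<Union>q\<in>K. cball q r)" using S(2) by (rule compact_minkowski_sum_cball)
  moreover have "continuous_on (\<Union>q\<in>K. cball q r) f''"
    using f(1) r(2) continuous_on_subset unfolding C2_data_def by blast
  ultimately have "bounded (f'' ` (\<Union>q\<in>K. cball q r))" by (intro compact_imp_bounded compact_continuous_image)
  then obtain C where C: "\<And>q. q \<in> (\<Union>q\<in>K. cball q r) \<Longrightarrow> norm (f'' q) \<le> C"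
    unfolding bounded_iff by blast
  obtain R where R: "0 < R" "\<And>q. q \<in> K \<Longrightarrow> norm q \<le> R"
    using compact_imp_bounded[OF S(2)] bounded_pos by metis
  show thesis
  proof (rule that[of "r / (1 + R)" "step_var * C * (1 + R)\<^sup>2 + C * (1 + R)\<^sup>2"])
    show "0 < r / (1 + R)" using r(1) R(1) by simp
    fix e q assume q: "q \<in> K" and e: "0 \<le> e" "e < r / (1 + R)"
    have qR: "1 + norm q \<le> 1 + R" using R(2)[OF q] by simp
    have "q \<in> (\<Union>q\<in>K. cball q r)" using q r(1) by force
    from C[OF this] have Cq: "norm (f'' q) \<le> C" .
    then have C0: "0 \<le> C" using norm_ge_zero order_trans by blast
    have "e * (1 + R) < r" using e(2) R(1) by (simp only: pos_less_divide_eq)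
    then have er: "(1 + norm q) * e \<le> r"
      using mult_right_mono[OF qR e(1)] by (simp add: mult.commute)
    have "p \<in> S \<and> norm (f'' p - f'' q) \<le> 2 * C" if "dist p q \<le> (1 + norm q) * e" for p
    proof -
      have "p \<in> (\<Union>q\<in>K. cball q r)" using that er q by (force simp: dist_commute)
      then have "p \<in> S" "norm (f'' p) \<le> C" using r(2) C[of p] by blast+
      then show ?thesis using Cq norm_triangle_ineq4[of "f'' p" "f'' q"] by simp
    qed
    from disc_avg_taylor[OF f e(1) this]
    have 1: "\<bar>disc_avg e f q - f q - e\<^sup>2 * step_var * hlap (f'' q) q / 2\<bar> \<le> e\<^sup>2 * C * (1 + norm q)\<^sup>2"
      by simp
    have pq: "(1 + norm q)\<^sup>2 \<le> (1 + R)\<^sup>2" using qR by (intro power_mono) auto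
    have "\<bar>hlap (f'' q) q\<bar> \<le> 2 * C * (1 + R)\<^sup>2"
      using Cq C0 pq by (intro order_trans[OF hlap_bound] mult_mono) auto
    then have "e\<^sup>2 * step_var / 2 * \<bar>hlap (f'' q) q\<bar> \<le> e\<^sup>2 * step_var / 2 * (2 * C * (1 + R)\<^sup>2)"
      using step_var_pos by (intro mult_left_mono) auto
    then have "\<bar>e\<^sup>2 * step_var * hlap (f'' q) q / 2\<bar> \<le> e\<^sup>2 * step_var * C * (1 + R)\<^sup>2"
      using step_var_pos by (simp add: abs_mult mult.assoc)
    moreover have "e\<^sup>2 * C * (1 + norm q)\<^sup>2 \<le> e\<^sup>2 * C * (1 + R)\<^sup>2"
      using pq C0 by (intro mult_left_mono) auto
    ultimately have "\<bar>disc_avg e f q - f q\<bar> \<le> e\<^sup>2 * step_var * C * (1 + R)\<^sup>2 + e\<^sup>2 * C * (1 + R)\<^sup>2"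
      using 1 by linarith
    then show "\<bar>disc_avg e f q - f q\<bar> \<le> (step_var * C * (1 + R)\<^sup>2 + C * (1 + R)\<^sup>2) * e\<^sup>2"
      by (simp add: algebra_simps)
  qed
qed

lemma integrable_bounded_support:
  fixes f :: "'a::euclidean_space \<Rightarrow> real"
  assumes "f \<in> borel_measurable borel" "\<And>x. \<bar>f x\<bar> \<le> B" "\<And>x. T < norm x \<Longrightarrow> f x = 0"
  shows "integrable lborel f"
proof (rule Bochner_Integration.integrable_bound)
  show "integrable lborel (\<lambda>x :: 'a. B * indicator (cball 0 T) x)"
    by (intro integrable_mult_right integrable_real_indicator) (simp_all add: emeasure_bounded_finite[simplified])
  show "AE x in lborel. norm (f x) \<le> norm (B * indicator (cball 0 T) x)"
  proof (rule AE_I2)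
    fix x
    show "norm (f x) \<le> norm (B * indicator (cball 0 T) x)"
      using assms(2)[of x] assms(3)[of x] by (cases "norm x \<le> T") (auto simp: indicator_def)
  qed
qed (use assms in simp)

lemma disc_avg_bound:
  assumes "f \<in> borel_measurable borel" "\<And>p. \<bar>f p\<bar> \<le> B"
  shows "\<bar>disc_avg e f q\<bar> \<le> B"
proof -
  have i: "integrable step_dist (\<lambda>w. f (hshift e q w))"
    by (rule integrable_step_dist_bounded[where B = B, OF borel_measurable_hshift_apply[OF assms(1)]])
      (simp only: real_norm_def assms(2))
  have "\<bar>disc_avg e f q\<bar> \<le> (\<integral>w. \<bar>f (hshift e q w)\<bar> \<partial>step_dist)"
    unfolding disc_avg_def by (rule integral_abs_bound)
  also have "\<dots> \<le> (\<integral>w. B \<partial>step_dist)" using i by (intro integral_mono) (simp_all add: assms(2))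
  finally show ?thesis using step.prob_space by simp
qed

text \<open>Viewing \<open>q\<close> as a step back from \<open>p = hshift e q w\<close> bounds its
  displacement in terms of \<open>norm p\<close>. If \<open>norm p \<le> T\<close>, then
  \<open>norm q\<close> would be at most \<open>T + (1 + T) * e\<close>.\<close>

lemma disc_avg_support:
  assumes "\<And>p. T < norm p \<Longrightarrow> f p = 0" "0 \<le> e" "T + (1 + T) * e < norm q"
  shows "disc_avg e f q = 0"
proof -
  have "AE w in step_dist. f (hshift e q w) = 0"
    using AE_step_dist
  proof eventually_elim
    case (elim w)
    define p where "p = hshift e q w"
    have q: "q = hshift e p (- w)" using hshift_uminus[of e q "- w"] by (simp add: p_def)
    have "T < norm p"
    proof (rule ccontr)
      assume "\<not> T < norm p"
      then have "norm p \<le> T" by simp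
      have "norm q \<le> norm p + dist q p" by (metis dist_norm norm_triangle_sub)
      also have "dist q p \<le> (1 + norm p) * \<bar>e\<bar>"
        unfolding q using elim by (intro dist_hshift_le) simp
      also have "\<dots> \<le> (1 + T) * e" using \<open>norm p \<le> T\<close> assms(2) by (simp add: mult_right_mono)
      finally show False using assms(3) \<open>norm p \<le> T\<close> by simp
    qed
    then show ?case using assms(1) by (simp add: p_def)
  qed
  then show ?thesis unfolding disc_avg_def by (rule integral_eq_zero_AE)
qed

lemma continuous_on_hlap:
  assumes "continuous_on S A"
  shows "continuous_on S (\<lambda>q. hlap (A q) q)"
proof -
  have "continuous_on S X_vec" "continuous_on S Y_vec"
    unfolding X_vec_def Y_vec_def by (intro continuous_intros; simp)+
  then show ?thesis unfolding hlap_def by (intro continuous_intros assms)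
qed

lemma C2_data_continuous_on: "C2_data S f f' f'' \<Longrightarrow> continuous_on S f"
  unfolding C2_data_def by (meson continuous_at_imp_continuous_on has_derivative_continuous)

text \<open>Averaging is symmetric with respect to Lebesgue measure, so its generator can be moved onto a
  smooth test function.\<close>

lemma weak_laplacian:
  assumes \<phi>: "C2_data UNIV \<phi> \<phi>' \<phi>''" "\<And>p. T < norm p \<Longrightarrow> \<phi> p = 0" and T: "0 < T" "T < T'"
    and v: "\<And>i. v i \<in> borel_measurable borel" "\<And>i q. \<bar>v i q\<bar> \<le> M"
    and e: "\<And>i. 0 < e i" "e \<longlonglongrightarrow> 0"
    and w: "w \<in> borel_measurable borel" and lim: "\<And>p. norm p \<le> T' \<Longrightarrow> (\<lambda>i. v i p) \<longlonglongrightarrow> w p"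
  shows "(\<lambda>i. (\<integral>q. \<phi> q * (disc_avg (e i) (v i) q - v i q) \<partial>lborel) / (e i)\<^sup>2)
    \<longlonglongrightarrow> step_var / 2 * (\<integral>q. w q * hlap (\<phi>'' q) q \<partial>lborel)"
proof -
  have c: "continuous_on UNIV \<phi>" using \<phi>(1) by (rule C2_data_continuous_on)
  then have m: "\<phi> \<in> borel_measurable borel" by (rule borel_measurable_continuous_onI)
  have "compact (\<phi> ` cball 0 T)"
    by (intro compact_continuous_image continuous_on_subset[OF c]) auto
  then have "bounded (\<phi> ` cball 0 T)" by (rule compact_imp_bounded)
  then obtain B0 where "\<forall>x\<in>\<phi> ` cball 0 T. norm x \<le> B0" unfolding bounded_iff by blast
  then have B0: "norm (\<phi> p) \<le> B0" if "p \<in> cball 0 T" for p using that by blast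
  have B0': "\<bar>\<phi> p\<bar> \<le> max 0 B0" for p
    using B0[of p] \<phi>(2)[of p] by (cases "norm p \<le> T") auto
  have i\<phi>: "integrable lborel \<phi>"
    by (rule integrable_bounded_support[OF m B0' \<phi>(2)])
  have M0: "0 \<le> M" using v(2)[of 0 0] by simp
  obtain \<epsilon> B where \<epsilon>: "0 < \<epsilon>" "\<And>e q. q \<in> cball 0 T' \<Longrightarrow> 0 \<le> e \<Longrightarrow> e < \<epsilon> \<Longrightarrow> \<bar>disc_avg e \<phi> q - \<phi> q\<bar> \<le> B * e\<^sup>2"
    using disc_avg_difference_bound[OF \<phi>(1) m open_UNIV compact_cball subset_UNIV] by metis
  have "0 < min \<epsilon> ((T' - T) / (1 + T))" using \<epsilon>(1) T by simp
  from order_tendstoD(2)[OF e(2) this]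
  obtain N where N: "\<And>i. N \<le> i \<Longrightarrow> e i < min \<epsilon> ((T' - T) / (1 + T))"
    unfolding eventually_sequentially by blast
  have supp: "disc_avg (e i) \<phi> q - \<phi> q = 0" if "N \<le> i" "T' < norm q" for i q
  proof -
    have "e i < (T' - T) / (1 + T)" using N[OF that(1)] by simp
    then have "e i * (1 + T) < T' - T" using T(1) by (simp only: pos_less_divide_eq)
    then have "T + (1 + T) * e i < norm q" using that(2) by (simp add: mult.commute)
    then show ?thesis using disc_avg_support[OF \<phi>(2) less_imp_le[OF e(1)]] \<phi>(2)[of q] T that(2) by simp
  qed
  \<comment> \<open>From index \<open>N\<close> on the steps are too short for the average of
    \<open>\<phi>\<close> to reach beyond radius \<open>T'\<close>, and the quadratic bound
    holds.\<close>
  define s where "s i q = v (i + N) q * ((disc_avg (e (i + N)) \<phi> q - \<phi> q) / (e (i + N))\<^sup>2)" for i q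
  have "(\<lambda>i. (\<integral>q. s i q \<partial>lborel)) \<longlonglongrightarrow> (\<integral>q. w q * (step_var * hlap (\<phi>'' q) q / 2) \<partial>lborel)"
  proof (rule integral_dominated_convergence[where w = "\<lambda>q. M * max 0 B * indicator (cball 0 T') q"])
    have "(\<lambda>q. hlap (\<phi>'' q) q) \<in> borel_measurable borel"
      using \<phi>(1) by (intro borel_measurable_continuous_onI continuous_on_hlap) (simp add: C2_data_def)
    then show "(\<lambda>q. w q * (step_var * hlap (\<phi>'' q) q / 2)) \<in> borel_measurable lborel" using w by simp
    show "s i \<in> borel_measurable lborel" for i
      unfolding s_def[abs_def] using v(1)[of "i + N"] m borel_measurable_disc_avg[OF m] by simp
    show "integrable lborel (\<lambda>q :: heis. M * max 0 B * indicator (cball 0 T') q)"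
      by (intro integrable_mult_right integrable_real_indicator) (simp_all add: emeasure_bounded_finite[simplified])
    show "AE q in lborel. (\<lambda>i. s i q) \<longlonglongrightarrow> w q * (step_var * hlap (\<phi>'' q) q / 2)"
    proof (rule AE_I2)
      fix q
      have dq: "(\<lambda>i. (disc_avg (e (i + N)) \<phi> q - \<phi> q) / (e (i + N))\<^sup>2) \<longlonglongrightarrow> step_var * hlap (\<phi>'' q) q / 2"
        by (rule disc_avg_difference_quotient[OF \<phi>(1) m open_UNIV UNIV_I e(1) LIMSEQ_ignore_initial_segment[OF e(2)]])
      show "(\<lambda>i. s i q) \<longlonglongrightarrow> w q * (step_var * hlap (\<phi>'' q) q / 2)"
      proof (cases "norm q \<le> T'")
        case True
        show ?thesis
          unfolding s_def by (intro tendsto_mult dq LIMSEQ_ignore_initial_segment[OF lim[OF True]])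
      next
        case False
        then have z: "disc_avg (e (i + N)) \<phi> q - \<phi> q = 0" for i using supp[of "i + N" q] by simp
        \<comment> \<open>Convergence of \<open>v\<close> is known only inside the ball. Outside it
          all quotients vanish, and so does their limit.\<close>
        have z0: "step_var * hlap (\<phi>'' q) q / 2 = 0"
          using dq unfolding z by (simp add: LIMSEQ_const_iff)
        show ?thesis unfolding s_def z z0 by simp
      qed
    qed
    show "AE q in lborel. norm (s i q) \<le> M * max 0 B * indicator (cball 0 T') q" for i
    proof (rule AE_I2)
      fix q
      show "norm (s i q) \<le> M * max 0 B * indicator (cball 0 T') q"
      proof (cases "norm q \<le> T'")
        case True
        have "\<bar>disc_avg (e (i + N)) \<phi> q - \<phi> q\<bar> \<le> B * (e (i + N))\<^sup>2"
          using \<epsilon>(2)[of q "e (i + N)"] N[of "i + N"] True e(1)[of "i + N"] by simp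
        also have "\<dots> \<le> max 0 B * (e (i + N))\<^sup>2" by (intro mult_right_mono) auto
        finally have "\<bar>(disc_avg (e (i + N)) \<phi> q - \<phi> q) / (e (i + N))\<^sup>2\<bar> \<le> max 0 B"
          using e(1)[of "i + N"] by (simp add: abs_divide pos_divide_le_eq)
        then have "\<bar>v (i + N) q\<bar> * \<bar>(disc_avg (e (i + N)) \<phi> q - \<phi> q) / (e (i + N))\<^sup>2\<bar> \<le> M * max 0 B"
          using v(2) M0 by (intro mult_mono) auto
        then show ?thesis using True by (simp add: s_def abs_mult)
      next
        case False
        then show ?thesis using supp[of "i + N" q] by (simp add: s_def)
      qed
    qed
  qed
  moreover have "(\<integral>q. s i q \<partial>lborel) = (\<integral>q. \<phi> q * (disc_avg (e (i + N)) (v (i + N)) q - v (i + N) q) \<partial>lborel) / (e (i + N))\<^sup>2" for i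
  proof -
    let ?e = "e (i + N)" and ?v = "v (i + N)"
    have vB: "\<bar>a\<bar> * \<bar>?v q\<bar> \<le> max 0 B0 * M" if "\<bar>a\<bar> \<le> max 0 B0" for a q
      using that v(2) by (intro mult_mono) auto
    have mA: "disc_avg ?e ?v \<in> borel_measurable borel" by (rule borel_measurable_disc_avg[OF v(1)])
    have bA: "\<bar>disc_avg ?e ?v q\<bar> \<le> M" for q by (rule disc_avg_bound[OF v])
    have i1: "integrable lborel (\<lambda>q. \<phi> q * disc_avg ?e ?v q)"
    proof (rule integrable_bounded_support[where B = "max 0 B0 * M" and T = T])
      show "\<bar>\<phi> x * disc_avg ?e ?v x\<bar> \<le> max 0 B0 * M" for x
        unfolding abs_mult using B0' bA by (intro mult_mono) auto
    qed (use m mA \<phi>(2) in simp_all)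
    have i2: "integrable lborel (\<lambda>q. \<phi> q * ?v q)"
      by (rule integrable_bounded_support[where B = "max 0 B0 * M" and T = T])
        (use m v(1) \<phi>(2) vB[OF B0'] in \<open>simp_all add: abs_mult\<close>)
    have i3: "integrable lborel (\<lambda>q. ?v q * disc_avg ?e \<phi> q)"
    proof (rule integrable_bounded_support[where B = "max 0 B0 * M" and T = "T + (1 + T) * ?e"])
      show "\<bar>?v x * disc_avg ?e \<phi> x\<bar> \<le> max 0 B0 * M" for x
        unfolding abs_mult by (subst mult.commute) (rule vB[OF disc_avg_bound[OF m B0']])
    qed (use v(1) borel_measurable_disc_avg[OF m] disc_avg_support[OF \<phi>(2) less_imp_le[OF e(1)]] in simp_all)
    have "(\<integral>q. \<phi> q * (disc_avg ?e ?v q - ?v q) \<partial>lborel) = (\<integral>q. \<phi> q * disc_avg ?e ?v q \<partial>lborel) - (\<integral>q. \<phi> q * ?v q \<partial>lborel)"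
      using i1 i2 by (simp add: right_diff_distrib)
    also have "\<dots> = (\<integral>q. ?v q * disc_avg ?e \<phi> q \<partial>lborel) - (\<integral>q. \<phi> q * ?v q \<partial>lborel)"
      by (simp only: disc_avg_selfadjoint[OF v i\<phi> m])
    also have "\<dots> = (\<integral>q. ?v q * (disc_avg ?e \<phi> q - \<phi> q) \<partial>lborel)"
      using i3 i2 by (simp add: right_diff_distrib mult.commute)
    finally show ?thesis by (simp add: s_def)
  qed
  ultimately have "(\<lambda>i. (\<integral>q. \<phi> q * (disc_avg (e (i + N)) (v (i + N)) q - v (i + N) q) \<partial>lborel) / (e (i + N))\<^sup>2)
     \<longlonglongrightarrow> (\<integral>q. w q * (step_var * hlap (\<phi>'' q) q / 2) \<partial>lborel)" by simp
  also have "(\<lambda>q. w q * (step_var * hlap (\<phi>'' q) q / 2)) = (\<lambda>q. step_var / 2 * (w q * hlap (\<phi>'' q) q))" by auto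
  finally have "(\<lambda>i. (\<integral>q. \<phi> q * (disc_avg (e (i + N)) (v (i + N)) q - v (i + N) q) \<partial>lborel) / (e (i + N))\<^sup>2)
     \<longlonglongrightarrow> step_var / 2 * (\<integral>q. w q * hlap (\<phi>'' q) q \<partial>lborel)" by simp
  then show ?thesis by (rule LIMSEQ_offset)
qed

section \<open>Functions of the Koranyi gauge\<close>

definition hor2 :: "heis \<Rightarrow> real" where
  "hor2 p = (fst p)\<^sup>2 + (fst (snd p))\<^sup>2"

text \<open>The fourth power of the gauge is a polynomial, whereas the gauge itself is not smooth at
  the origin.\<close>

definition kor4 :: "heis \<Rightarrow> real" where
  "kor4 p = (hor2 p)\<^sup>2 + 16 * (snd (snd p))\<^sup>2"

lemma kor4_eq: "kor4 p = koranyi p ^ 4"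
  by (simp add: kor4_def hor2_def koranyi_power4)

text \<open>The scale \<open>\<sigma>\<close> has the dimension of a squared gauge. This is the
  origin of the support radius \<open>3 * sqrt \<sigma>\<close> that recurs below.\<close>

lemma norm_le_of_kor4:
  assumes "kor4 p \<le> \<sigma>\<^sup>2" "0 \<le> \<sigma>" "\<sigma> \<le> 1"
  shows "norm p \<le> 3 * sqrt \<sigma>"
proof -
  have "koranyi p ^ 4 \<le> sqrt \<sigma> ^ 4"
    using assms(1,2) power_mult[of "sqrt \<sigma>" 2 2] by (simp add: kor4_eq)
  then have "koranyi p \<le> sqrt \<sigma>" using power_mono_iff[of "koranyi p" "sqrt \<sigma>" 4] assms(2) by simp
  moreover have "sqrt \<sigma> \<le> 1" using assms(3) by simp
  ultimately show ?thesis using norm_le_koranyi[of p] by linarith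
qed

text \<open>Both functions are polynomials in the coordinates of \<open>q\<close> and
  \<open>p\<close>. Hiding the derivatives behind existential quantifiers lets the closure rules
  assemble them.\<close>

lemma C2_param_left_translate:
  "\<exists>f' f''. C2_param (\<lambda>q p. hor2 (hinv q \<star> p)) f' f''"
  "\<exists>f' f''. C2_param (\<lambda>q p. kor4 (hinv q \<star> p)) f' f''"
proof -
  have add: "\<exists>f' f''. C2_param (\<lambda>q p. f q p + g q p) f' f''"
    and mult: "\<exists>f' f''. C2_param (\<lambda>q p. f q p * g q p) f' f''"
    if "\<exists>f' f''. C2_param f f' f''" "\<exists>f' f''. C2_param g f' f''" for f g
    using that C2_param_add C2_param_mult by blast+
  have const: "\<exists>f' f''. C2_param (\<lambda>q p. g p) f' f''" if "continuous_on UNIV g" for g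
    using C2_param_const[OF that] by blast
  have lin: "\<exists>f' f''. C2_param (\<lambda>q p. l q) f' f''" if "bounded_linear l" for l
    using C2_param_linear[OF that] by blast
  have l: "bounded_linear (\<lambda>q :: heis. - fst q)" "bounded_linear (\<lambda>q :: heis. - fst (snd q))"
    "bounded_linear (\<lambda>q :: heis. - snd (snd q))" "bounded_linear (\<lambda>q :: heis. fst (snd q) / 2)"
    by (intro bounded_linear_minus bounded_linear_fst bounded_linear_compose[OF bounded_linear_fst bounded_linear_snd]
        bounded_linear_compose[OF bounded_linear_snd bounded_linear_snd]
        bounded_linear_compose[OF bounded_linear_divide[of 2]
          bounded_linear_compose[OF bounded_linear_fst bounded_linear_snd]])+
  have a: "\<exists>f' f''. C2_param (\<lambda>q p. - fst q + fst p) f' f''"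
    by (intro add lin l const continuous_intros)
  have b: "\<exists>f' f''. C2_param (\<lambda>q p. - fst (snd q) + fst (snd p)) f' f''"
    by (intro add lin l const continuous_intros)
  have c: "\<exists>f' f''. C2_param (\<lambda>q p. (- snd (snd q) + snd (snd p)) + (- fst q * (fst (snd p) / 2) + fst (snd q) / 2 * fst p)) f' f''"
    by (intro add mult lin l const continuous_intros) auto
  have r: "(\<lambda>q p. hor2 (hinv q \<star> p)) = (\<lambda>q p. (- fst q + fst p) * (- fst q + fst p) +
      (- fst (snd q) + fst (snd p)) * (- fst (snd q) + fst (snd p)))"
    by (rule ext, rule ext) (simp add: hor2_def hmul_eq hinv_eq power2_eq_square)
  show h: "\<exists>f' f''. C2_param (\<lambda>q p. hor2 (hinv q \<star> p)) f' f''"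
    unfolding r by (intro add mult a b)
  have k: "(\<lambda>q p. kor4 (hinv q \<star> p)) = (\<lambda>q p. hor2 (hinv q \<star> p) * hor2 (hinv q \<star> p) +
     16 * (((- snd (snd q) + snd (snd p)) + (- fst q * (fst (snd p) / 2) + fst (snd q) / 2 * fst p)) *
     ((- snd (snd q) + snd (snd p)) + (- fst q * (fst (snd p) / 2) + fst (snd q) / 2 * fst p))))"
    by (rule ext, rule ext) (simp add: kor4_def hmul_eq hinv_eq power2_eq_square diff_divide_distrib add_divide_distrib algebra_simps)
  show "\<exists>f' f''. C2_param (\<lambda>q p. kor4 (hinv q \<star> p)) f' f''"
    unfolding k by (intro add mult h c const continuous_intros)
qed

text \<open>The horizontal gradient of \<open>kor4\<close> has squared length
  \<open>16 * hor2 p * kor4 p\<close>, and its sub-Laplacian is \<open>24 * hor2 p\<close>; the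
  formula is the resulting chain rule. It is computed through the fields \<open>X\<close> and
  \<open>Y\<close>, the second derivative from the parameter calculus being known only
  abstractly.\<close>

lemma radial_C2_data:
  assumes k: "\<And>t. (k has_real_derivative k' t) (at t)"
    "\<And>t. (k' has_real_derivative k'' t) (at t)" "continuous_on UNIV k''"
  obtains \<phi>' \<phi>'' where "C2_data UNIV (\<lambda>p. k (kor4 p)) \<phi>' \<phi>''"
    "\<And>p. hlap (\<phi>'' p) p = 8 * hor2 p * (2 * kor4 p * k'' (kor4 p) + 3 * k' (kor4 p))"
proof -
  obtain f' f'' where "C2_param (\<lambda>q p. kor4 (hinv q \<star> p)) f' f''" using C2_param_left_translate by blast
  from C2_param_imp_C2_data[OF C2_param_compose[OF this k], of 0]
  obtain \<phi>' \<phi>'' where C2: "C2_data UNIV (\<lambda>q. k (kor4 (hinv q \<star> 0))) \<phi>' \<phi>''" by blast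
  \<comment> \<open>Fixing the second variable at the origin gives \<open>kor4\<close> at the
    inverse of \<open>q\<close>, and \<open>kor4\<close> is even.\<close>
  have "kor4 (hinv q \<star> 0) = kor4 q" for q by (simp add: kor4_def hor2_def hinv_eq)
  with C2 have C2: "C2_data UNIV (\<lambda>q. k (kor4 q)) \<phi>' \<phi>''" by simp
  have dk: "((\<lambda>s. k (g s)) has_real_derivative k' (g s) * g') (at s)"
    and dk': "((\<lambda>s. k' (g s)) has_real_derivative k'' (g s) * g') (at s)"
    if "(g has_real_derivative g') (at s)" for g g' s
    using DERIV_chain2[OF k(1) that] DERIV_chain2[OF k(2) that] by simp_all
  have kor: "kor4 (x, y, z) = (x\<^sup>2 + y\<^sup>2)\<^sup>2 + 16 * z\<^sup>2" for x y z by (simp add: kor4_def hor2_def)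
  have X: "X_field (\<lambda>p. k (kor4 p)) = (\<lambda>(x, y, z). k' (kor4 (x, y, z)) * (4 * x * (x\<^sup>2 + y\<^sup>2) - 16 * y * z))"
  proof (rule ext, clarify)
    fix x y z
    have 1: "((\<lambda>s. k (kor4 (s, y, z))) has_real_derivative k' (kor4 (x, y, z)) * (4 * x * (x\<^sup>2 + y\<^sup>2))) (at x)"
      unfolding kor by (rule dk) (auto intro!: derivative_eq_intros simp: algebra_simps)
    have 2: "((\<lambda>s. k (kor4 (x, y, s))) has_real_derivative k' (kor4 (x, y, z)) * (32 * z)) (at z)"
      unfolding kor by (rule dk) (auto intro!: derivative_eq_intros simp: algebra_simps)
    show "X_field (\<lambda>p. k (kor4 p)) (x, y, z) = k' (kor4 (x, y, z)) * (4 * x * (x\<^sup>2 + y\<^sup>2) - 16 * y * z)"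
      using DERIV_imp_deriv[OF 1] DERIV_imp_deriv[OF 2] by (simp add: X_field_def algebra_simps)
  qed
  have Y: "Y_field (\<lambda>p. k (kor4 p)) = (\<lambda>(x, y, z). k' (kor4 (x, y, z)) * (4 * y * (x\<^sup>2 + y\<^sup>2) + 16 * x * z))"
  proof (rule ext, clarify)
    fix x y z
    have 1: "((\<lambda>s. k (kor4 (x, s, z))) has_real_derivative k' (kor4 (x, y, z)) * (4 * y * (x\<^sup>2 + y\<^sup>2))) (at y)"
      unfolding kor by (rule dk) (auto intro!: derivative_eq_intros simp: algebra_simps)
    have 2: "((\<lambda>s. k (kor4 (x, y, s))) has_real_derivative k' (kor4 (x, y, z)) * (32 * z)) (at z)"
      unfolding kor by (rule dk) (auto intro!: derivative_eq_intros simp: algebra_simps)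
    show "Y_field (\<lambda>p. k (kor4 p)) (x, y, z) = k' (kor4 (x, y, z)) * (4 * y * (x\<^sup>2 + y\<^sup>2) + 16 * x * z)"
      using DERIV_imp_deriv[OF 1] DERIV_imp_deriv[OF 2] by (simp add: Y_field_def algebra_simps)
  qed
  have "hlap (\<phi>'' p) p = 8 * hor2 p * (2 * kor4 p * k'' (kor4 p) + 3 * k' (kor4 p))" for p
  proof -
    obtain x y z where p: "p = (x, y, z)" by (cases p)
    let ?t = "kor4 (x, y, z)"
    have dx: "((\<lambda>s. k' (kor4 (s, y, z))) has_real_derivative k'' ?t * (4 * x * (x\<^sup>2 + y\<^sup>2))) (at x)"
      unfolding kor by (rule dk') (auto intro!: derivative_eq_intros simp: algebra_simps)
    have dy: "((\<lambda>s. k' (kor4 (x, s, z))) has_real_derivative k'' ?t * (4 * y * (x\<^sup>2 + y\<^sup>2))) (at y)"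
      unfolding kor by (rule dk') (auto intro!: derivative_eq_intros simp: algebra_simps)
    have dz: "((\<lambda>s. k' (kor4 (x, y, s))) has_real_derivative k'' ?t * (32 * z)) (at z)"
      unfolding kor by (rule dk') (auto intro!: derivative_eq_intros simp: algebra_simps)
    have Xx: "((\<lambda>s. k' (kor4 (s, y, z)) * (4 * s * (s\<^sup>2 + y\<^sup>2) - 16 * y * z)) has_real_derivative
        k'' ?t * (4 * x * (x\<^sup>2 + y\<^sup>2)) * (4 * x * (x\<^sup>2 + y\<^sup>2) - 16 * y * z) + (12 * x\<^sup>2 + 4 * y\<^sup>2) * k' ?t) (at x)"
      by (rule DERIV_mult[OF dx]) (auto intro!: derivative_eq_intros simp: algebra_simps power2_eq_square)
    have Xz: "((\<lambda>s. k' (kor4 (x, y, s)) * (4 * x * (x\<^sup>2 + y\<^sup>2) - 16 * y * s)) has_real_derivative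
        k'' ?t * (32 * z) * (4 * x * (x\<^sup>2 + y\<^sup>2) - 16 * y * z) + (- 16 * y) * k' ?t) (at z)"
      by (rule DERIV_mult[OF dz]) (auto intro!: derivative_eq_intros simp: algebra_simps)
    have Yy: "((\<lambda>s. k' (kor4 (x, s, z)) * (4 * s * (x\<^sup>2 + s\<^sup>2) + 16 * x * z)) has_real_derivative
        k'' ?t * (4 * y * (x\<^sup>2 + y\<^sup>2)) * (4 * y * (x\<^sup>2 + y\<^sup>2) + 16 * x * z) + (4 * x\<^sup>2 + 12 * y\<^sup>2) * k' ?t) (at y)"
      by (rule DERIV_mult[OF dy]) (auto intro!: derivative_eq_intros simp: algebra_simps power2_eq_square)
    have Yz: "((\<lambda>s. k' (kor4 (x, y, s)) * (4 * y * (x\<^sup>2 + y\<^sup>2) + 16 * x * s)) has_real_derivative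
        k'' ?t * (32 * z) * (4 * y * (x\<^sup>2 + y\<^sup>2) + 16 * x * z) + (16 * x) * k' ?t) (at z)"
      by (rule DERIV_mult[OF dz]) (auto intro!: derivative_eq_intros simp: algebra_simps)
    have "hlap (\<phi>'' p) p = X_field (X_field (\<lambda>p. k (kor4 p))) p + Y_field (Y_field (\<lambda>p. k (kor4 p))) p"
      using hlaplacian_eq_hlap[OF open_UNIV UNIV_I C2] by (simp add: hlaplacian_def)
    also have "X_field (X_field (\<lambda>p. k (kor4 p))) p =
        k'' ?t * (4 * x * (x\<^sup>2 + y\<^sup>2)) * (4 * x * (x\<^sup>2 + y\<^sup>2) - 16 * y * z) + (12 * x\<^sup>2 + 4 * y\<^sup>2) * k' ?t
        - y / 2 * (k'' ?t * (32 * z) * (4 * x * (x\<^sup>2 + y\<^sup>2) - 16 * y * z) + (- 16 * y) * k' ?t)"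
      unfolding X p X_field_def prod.case DERIV_imp_deriv[OF Xx] DERIV_imp_deriv[OF Xz] ..
    also have "Y_field (Y_field (\<lambda>p. k (kor4 p))) p =
        k'' ?t * (4 * y * (x\<^sup>2 + y\<^sup>2)) * (4 * y * (x\<^sup>2 + y\<^sup>2) + 16 * x * z) + (4 * x\<^sup>2 + 12 * y\<^sup>2) * k' ?t
        + x / 2 * (k'' ?t * (32 * z) * (4 * y * (x\<^sup>2 + y\<^sup>2) + 16 * x * z) + (16 * x) * k' ?t)"
      unfolding Y p Y_field_def prod.case DERIV_imp_deriv[OF Yy] DERIV_imp_deriv[OF Yz] ..
    also have "k'' ?t * (4 * x * (x\<^sup>2 + y\<^sup>2)) * (4 * x * (x\<^sup>2 + y\<^sup>2) - 16 * y * z) + (12 * x\<^sup>2 + 4 * y\<^sup>2) * k' ?t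
        - y / 2 * (k'' ?t * (32 * z) * (4 * x * (x\<^sup>2 + y\<^sup>2) - 16 * y * z) + (- 16 * y) * k' ?t) +
        (k'' ?t * (4 * y * (x\<^sup>2 + y\<^sup>2)) * (4 * y * (x\<^sup>2 + y\<^sup>2) + 16 * x * z) + (4 * x\<^sup>2 + 12 * y\<^sup>2) * k' ?t
        + x / 2 * (k'' ?t * (32 * z) * (4 * y * (x\<^sup>2 + y\<^sup>2) + 16 * x * z) + (16 * x) * k' ?t))
        = 8 * (x\<^sup>2 + y\<^sup>2) * (2 * ((x\<^sup>2 + y\<^sup>2)\<^sup>2 + 16 * z\<^sup>2) * k'' ?t + 3 * k' ?t)"
    proof -
      have "b * (4 * x * (x\<^sup>2 + y\<^sup>2)) * (4 * x * (x\<^sup>2 + y\<^sup>2) - 16 * y * z) + (12 * x\<^sup>2 + 4 * y\<^sup>2) * a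
        - y / 2 * (b * (32 * z) * (4 * x * (x\<^sup>2 + y\<^sup>2) - 16 * y * z) + (- 16 * y) * a) +
        (b * (4 * y * (x\<^sup>2 + y\<^sup>2)) * (4 * y * (x\<^sup>2 + y\<^sup>2) + 16 * x * z) + (4 * x\<^sup>2 + 12 * y\<^sup>2) * a
        + x / 2 * (b * (32 * z) * (4 * y * (x\<^sup>2 + y\<^sup>2) + 16 * x * z) + (16 * x) * a))
        = 8 * (x\<^sup>2 + y\<^sup>2) * (2 * ((x\<^sup>2 + y\<^sup>2)\<^sup>2 + 16 * z\<^sup>2) * b + 3 * a)" for a b :: real
        by (simp add: algebra_simps power2_eq_square)
      then show ?thesis .
    qed
    finally show ?thesis by (simp only: p hor2_def kor fst_conv snd_conv)
  qed
  with C2 show thesis by (rule that)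
qed

lemma DERIV_if_le:
  fixes g h :: "real \<Rightarrow> real"
  assumes g: "\<And>x. x \<le> a \<Longrightarrow> (g has_real_derivative g' x) (at x)"
    and h: "\<And>x. a \<le> x \<Longrightarrow> (h has_real_derivative h' x) (at x)"
    and eq: "g a = h a" "g' a = h' a"
  shows "((\<lambda>x. if x \<le> a then g x else h x) has_real_derivative (if x \<le> a then g' x else h' x)) (at x)"
proof -
  let ?f = "\<lambda>x. if x \<le> a then g x else h x"
  consider "x < a" | "a < x" | "x = a" by linarith
  then show ?thesis
  proof cases
    case 1
    have "(?f has_real_derivative g' x) (at x)"
      by (rule has_field_derivative_transform_within_open[OF g, of _ "{..<a}"]) (use 1 in auto)
    then show ?thesis using 1 by simp
  next
    case 2
    have "(?f has_real_derivative h' x) (at x)"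
      by (rule has_field_derivative_transform_within_open[OF h, of _ "{a<..}"]) (use 2 in auto)
    then show ?thesis using 2 by simp
  next
    case 3
    have "(?f has_real_derivative g' a) (at a)"
      unfolding has_field_derivative_iff
    proof (rule filterlim_split_at)
      have "((\<lambda>x. (g x - g a) / (x - a)) \<longlongrightarrow> g' a) (at_left a)"
        using g[of a] unfolding has_field_derivative_iff by (simp add: filterlim_at_split)
      then show "((\<lambda>x. (?f x - ?f a) / (x - a)) \<longlongrightarrow> g' a) (at_left a)"
        by (rule Lim_transform_eventually) (auto simp: eventually_at_filter)
      have "((\<lambda>x. (h x - h a) / (x - a)) \<longlongrightarrow> h' a) (at_right a)"
        using h[of a] unfolding has_field_derivative_iff by (simp add: filterlim_at_split)
      then show "((\<lambda>x. (?f x - ?f a) / (x - a)) \<longlongrightarrow> g' a) (at_right a)"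
        unfolding eq(2) by (rule Lim_transform_eventually) (auto simp: eventually_at_filter eq(1))
    qed
    then show ?thesis using 3 by simp
  qed
qed

subsection \<open>Mean values against a smooth kernel\<close>

lemma DERIV_max0_power:
  "((\<lambda>t. max 0 t ^ Suc (Suc n)) has_real_derivative real (Suc (Suc n)) * max 0 t ^ Suc n) (at t)"
proof -
  have 1: "((\<lambda>t. if t \<le> 0 then 0 else t ^ Suc (Suc n)) has_real_derivative
      (if t \<le> 0 then 0 else real (Suc (Suc n)) * t ^ Suc n)) (at t)" for t :: real
  proof (rule DERIV_if_le)
    show "((\<lambda>t. t ^ Suc (Suc n)) has_real_derivative real (Suc (Suc n)) * x ^ Suc n) (at x)" for x :: real
      using DERIV_pow[of "Suc (Suc n)" x] by simp
  qed auto
  have 2: "(\<lambda>t :: real. if t \<le> 0 then 0 else t ^ Suc (Suc n)) = (\<lambda>t. max 0 t ^ Suc (Suc n))"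
    by (auto simp: max_def)
  have 3: "(if t \<le> 0 then 0 else real (Suc (Suc n)) * t ^ Suc n) = real (Suc (Suc n)) * max 0 t ^ Suc n"
    by (auto simp: max_def)
  show ?thesis using 1[of t] unfolding 2 3 .
qed

text \<open>Folland's fundamental solution is a multiple of \<open>kor4 p powr (-1/2)\<close>. Replacing
  \<open>- t powr (-1/2)\<close> by its Taylor polynomial of degree four at \<open>t = 1\<close> for \<open>t \<le> 1\<close> removes the
  singularity and turns the Dirac mass into a multiple of the kernel \<open>max 0 (1 - t) ^ 3\<close>.\<close>

definition fsol :: "real \<Rightarrow> real" where
  "fsol t = (if t \<le> 1 then - (1 + (1 - t) / 2 + 3 * (1 - t)\<^sup>2 / 8 + 5 * (1 - t) ^ 3 / 16 + 35 * (1 - t) ^ 4 / 128)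
    else - inverse (sqrt t))"

definition fsol' :: "real \<Rightarrow> real" where
  "fsol' t = (if t \<le> 1 then 1 / 2 + 3 * (1 - t) / 4 + 15 * (1 - t)\<^sup>2 / 16 + 35 * (1 - t) ^ 3 / 32
    else inverse (sqrt t) ^ 3 / 2)"

definition fsol'' :: "real \<Rightarrow> real" where
  "fsol'' t = (if t \<le> 1 then - (3 / 4 + 15 * (1 - t) / 8 + 105 * (1 - t)\<^sup>2 / 32)
    else - (3 / 4) * inverse (sqrt t) ^ 5)"

lemma DERIV_inverse_sqrt:
  assumes "0 < t"
  shows "((\<lambda>t. inverse (sqrt t)) has_real_derivative - (inverse (sqrt t) ^ 3 / 2)) (at t)"
  using assms by (auto intro!: derivative_eq_intros simp: power3_eq_cube)

lemma DERIV_fsol: "(fsol has_real_derivative fsol' t) (at t)"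
  unfolding fsol_def[abs_def] fsol'_def
proof (rule DERIV_if_le)
  fix x :: real assume "1 \<le> x"
  then show "((\<lambda>t. - inverse (sqrt t)) has_real_derivative inverse (sqrt x) ^ 3 / 2) (at x)"
    using DERIV_minus[OF DERIV_inverse_sqrt[of x]] by simp
qed (auto intro!: derivative_eq_intros simp: field_simps eval_nat_numeral)

lemma DERIV_fsol': "(fsol' has_real_derivative fsol'' t) (at t)"
  unfolding fsol'_def[abs_def] fsol''_def
proof (rule DERIV_if_le)
  fix x :: real assume "1 \<le> x"
  then have "0 < x" by simp
  from DERIV_cdivide[OF DERIV_power[OF DERIV_inverse_sqrt[OF this], of 3], of 2]
  show "((\<lambda>t. inverse (sqrt t) ^ 3 / 2) has_real_derivative - (3 / 4) * inverse (sqrt x) ^ 5) (at x)"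
    by (rule DERIV_cong) (simp add: eval_nat_numeral)
qed (auto intro!: derivative_eq_intros simp: field_simps eval_nat_numeral)

lemma continuous_on_fsol'': "continuous_on UNIV fsol''"
  unfolding fsol''_def[abs_def]
  by (rule continuous_on_cases_le[where h = "\<lambda>t. t"]) (auto intro!: continuous_intros)

text \<open>For \<open>t > 1\<close> the homogeneous equation holds because
  \<open>t powr (-1/2)\<close> solves it. For \<open>t \<le> 1\<close> the Taylor coefficients
  cancel every power of \<open>1 - t\<close> below the third, and the top coefficient leaves
  \<open>105/16 + 105/32 = 315/32\<close>.\<close>

lemma fsol_ode: "2 * t * fsol'' t + 3 * fsol' t = 315 / 32 * max 0 (1 - t) ^ 3"
proof (cases "t \<le> 1")
  case True
  then have "max 0 (1 - t) = 1 - t" by simp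
  with True show ?thesis
    by (simp add: fsol'_def fsol''_def) (simp add: power2_eq_square power3_eq_cube field_simps)
next
  case False
  define s where "s = inverse (sqrt t)"
  have "t * s\<^sup>2 = 1" using False by (simp add: s_def power_inverse)
  then have "2 * t * (- (3 / 4) * s ^ 5) + 3 * (s ^ 3 / 2) = 0"
    by (simp add: eval_nat_numeral algebra_simps)
  then show ?thesis using False by (simp add: fsol'_def fsol''_def s_def max_def)
qed

text \<open>The factor \<open>hor2\<close> comes from \<open>radial_C2_data\<close>. Under the
  dilation by \<open>sqrt \<sigma>\<close> volume scales with \<open>\<sigma>\<^sup>2\<close> and
  \<open>hor2\<close> with \<open>\<sigma>\<close>, so dividing by \<open>\<sigma> ^ 3\<close> makes
  the mass independent of the scale.\<close>

definition hkernel :: "real \<Rightarrow> heis \<Rightarrow> real" where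
  "hkernel \<sigma> p = hor2 p * max 0 (1 - kor4 p / \<sigma>\<^sup>2) ^ 3 / \<sigma> ^ 3"

lemma hor2_nonneg: "0 \<le> hor2 p" by (simp add: hor2_def)

lemma hkernel_nonneg: "0 < \<sigma> \<Longrightarrow> 0 \<le> hkernel \<sigma> p"
  by (simp add: hkernel_def hor2_nonneg)

lemma continuous_on_hor2: "continuous_on S hor2"
  unfolding hor2_def by (intro continuous_intros)

lemma continuous_on_kor4: "continuous_on S kor4"
  unfolding kor4_def by (intro continuous_intros continuous_on_hor2)

lemma continuous_on_hkernel: "0 < \<sigma> \<Longrightarrow> continuous_on S (hkernel \<sigma>)"
  unfolding hkernel_def by (intro continuous_intros continuous_on_hor2 continuous_on_kor4) auto

lemma hkernel_support:
  assumes "0 < \<sigma>" "\<sigma> \<le> 1" "3 * sqrt \<sigma> < norm p"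
  shows "hkernel \<sigma> p = 0"
proof -
  have "\<sigma>\<^sup>2 < kor4 p" using norm_le_of_kor4[of p \<sigma>] assms by linarith
  then have "1 \<le> kor4 p / \<sigma>\<^sup>2" using assms(1) by simp
  then show ?thesis by (simp add: hkernel_def)
qed

lemma integrable_continuous_support:
  fixes f :: "'a::euclidean_space \<Rightarrow> real"
  assumes "continuous_on UNIV f" "\<And>x. T < norm x \<Longrightarrow> f x = 0"
  shows "integrable lborel f"
proof -
  have "integrable lborel (\<lambda>x. indicator (cball 0 T) x *\<^sub>R f x)"
    by (rule borel_integrable_compact[OF compact_cball continuous_on_subset[OF assms(1)]]) simp
  moreover have "(\<lambda>x. indicator (cball 0 T) x *\<^sub>R f x) = f"
    using assms(2) by (auto simp: indicator_def fun_eq_iff)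
  ultimately show ?thesis by simp
qed

lemma integral_pos_continuous:
  fixes f :: "'a::euclidean_space \<Rightarrow> real"
  assumes "continuous_on UNIV f" "integrable lborel f" "\<And>x. 0 \<le> f x" "0 < f a"
  shows "0 < (\<integral>x. f x \<partial>lborel)"
proof (rule ccontr)
  assume "\<not> 0 < (\<integral>x. f x \<partial>lborel)"
  moreover have "0 \<le> (\<integral>x. f x \<partial>lborel)" by (intro integral_nonneg_AE AE_I2 assms(3))
  ultimately have "(\<integral>x. f x \<partial>lborel) = 0" by simp
  then have "AE x in lborel. f x = 0"
    using assms(2,3) by (subst (asm) integral_nonneg_eq_0_iff_AE) auto
  then have ae: "AE x in lborel. x \<notin> {x. 0 < f x}" by eventually_elim simp
  have op: "open {x. 0 < f x}" by (intro open_Collect_less continuous_intros assms(1))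
  then have "emeasure lborel {x. 0 < f x} = 0"
    using ae AE_iff_null_sets[of "{x. 0 < f x}" lborel] by (metis borel_open null_setsD1 sets_lborel)
  moreover have "{x. 0 < f x} \<noteq> {}" using assms(4) by blast
  ultimately show False using emeasure_lborel_open_pos[OF op] by simp
qed

lemma integrable_hkernel:
  assumes "0 < \<sigma>" "\<sigma> \<le> 1"
  shows "integrable lborel (hkernel \<sigma>)"
  by (rule integrable_continuous_support[OF continuous_on_hkernel[OF assms(1)] hkernel_support[OF assms]])

lemma integrable_mult_bounded:
  fixes w k :: "'a::euclidean_space \<Rightarrow> real"
  assumes "w \<in> borel_measurable borel" "\<And>p. \<bar>w p\<bar> \<le> B" "integrable lborel k"
  shows "integrable lborel (\<lambda>p. w p * k p)"
proof (rule Bochner_Integration.integrable_bound)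
  show "integrable lborel (\<lambda>p. B * k p)" using assms(3) by simp
  show "AE p in lborel. norm (w p * k p) \<le> norm (B * k p)"
  proof (rule AE_I2)
    fix p
    have "\<bar>w p\<bar> * \<bar>k p\<bar> \<le> \<bar>B\<bar> * \<bar>k p\<bar>" using assms(2)[of p] by (intro mult_right_mono) auto
    then show "norm (w p * k p) \<le> norm (B * k p)" by (simp add: abs_mult)
  qed
qed (use assms in simp)

text \<open>What a limit of walk values retains near the origin: approximation by uniformly bounded
  functions that eventually satisfy the exact mean value property at scales tending to zero. It is
  stated on a Euclidean ball about the origin because arbitrary points are translated there.\<close>

definition asymp_harmonic :: "real \<Rightarrow> (heis \<Rightarrow> real) \<Rightarrow> bool" where
  "asymp_harmonic T w \<longleftrightarrow> (\<exists>v e M. (\<forall>i. v i \<in> borel_measurable borel) \<and> (\<forall>i q. \<bar>v i q\<bar> \<le> M) \<and>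
     (\<forall>i. 0 < e i) \<and> e \<longlonglongrightarrow> (0::real) \<and> (\<forall>p. norm p \<le> T \<longrightarrow> (\<lambda>i. v i p) \<longlonglongrightarrow> w p) \<and>
     (\<forall>\<^sub>F i in sequentially. \<forall>p. norm p \<le> T \<longrightarrow> disc_avg (e i) (v i) p = v i p))"

lemma asymp_harmonic_const: "asymp_harmonic T (\<lambda>_. c)"
proof -
  have "(\<lambda>i. inverse (real (Suc i))) \<longlonglongrightarrow> 0" by (rule LIMSEQ_inverse_real_of_nat)
  then show ?thesis
    unfolding asymp_harmonic_def using step.prob_space
    by (intro exI[of _ "\<lambda>_ _. c"] exI[of _ "\<lambda>i. inverse (real (Suc i))"] exI[of _ "\<bar>c\<bar>"]) (simp add: disc_avg_def)
qed

lemma asymp_harmonic_weak: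
  assumes "asymp_harmonic T' w" "w \<in> borel_measurable borel"
    and \<phi>: "C2_data UNIV \<phi> \<phi>' \<phi>''" "\<And>p. T < norm p \<Longrightarrow> \<phi> p = 0" and T: "0 < T" "T < T'"
  shows "(\<integral>q. w q * hlap (\<phi>'' q) q \<partial>lborel) = 0"
proof -
  obtain v e M where v: "\<forall>i. v i \<in> borel_measurable borel" "\<forall>i q. \<bar>v i q\<bar> \<le> M"
     "\<forall>i. 0 < e i" "e \<longlonglongrightarrow> (0::real)" "\<forall>p. norm p \<le> T' \<longrightarrow> (\<lambda>i. v i p) \<longlonglongrightarrow> w p"
     and h: "\<forall>\<^sub>F i in sequentially. \<forall>p. norm p \<le> T' \<longrightarrow> disc_avg (e i) (v i) p = v i p"
    using assms(1) unfolding asymp_harmonic_def by blast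
  have "(\<lambda>i. (\<integral>q. \<phi> q * (disc_avg (e i) (v i) q - v i q) \<partial>lborel) / (e i)\<^sup>2)
    \<longlonglongrightarrow> step_var / 2 * (\<integral>q. w q * hlap (\<phi>'' q) q \<partial>lborel)"
    using v by (intro weak_laplacian[OF \<phi> T, where M = M] assms(2)) blast+
  moreover have "\<forall>\<^sub>F i in sequentially. (\<integral>q. \<phi> q * (disc_avg (e i) (v i) q - v i q) \<partial>lborel) / (e i)\<^sup>2 = 0"
    using h
  proof eventually_elim
    case (elim i)
    have "\<phi> q * (disc_avg (e i) (v i) q - v i q) = 0" for q
    proof (cases "norm q \<le> T'")
      case True
      then have "disc_avg (e i) (v i) q = v i q" using elim by blast
      then show ?thesis by simp
    qed (use \<phi>(2)[of q] T(2) in simp)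
    then have "(\<lambda>q. \<phi> q * (disc_avg (e i) (v i) q - v i q)) = (\<lambda>_. 0)" by (rule ext)
    then show ?case by simp
  qed
  then have "(\<lambda>i. (\<integral>q. \<phi> q * (disc_avg (e i) (v i) q - v i q) \<partial>lborel) / (e i)\<^sup>2) \<longlonglongrightarrow> 0"
    by (rule tendsto_eventually)
  ultimately have "step_var / 2 * (\<integral>q. w q * hlap (\<phi>'' q) q \<partial>lborel) = 0"
    by (rule LIMSEQ_unique)
  then show ?thesis using step_var_pos by simp
qed

text \<open>Outside the larger support both rescaled regularizations equal
  \<open>- inverse (sqrt (kor4 p))\<close>, so their difference is an admissible compactly supported
  test function. Its sub-Laplacian is \<open>315/4 = 8 * 315/32\<close> times the difference of the
  two kernels.\<close>

lemma kernel_average_independent: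
  assumes w: "asymp_harmonic T w" "w \<in> borel_measurable borel" "\<And>p. \<bar>w p\<bar> \<le> B"
    and \<sigma>: "0 < \<sigma>" "\<sigma> \<le> 1" "3 * sqrt \<sigma> < T" and \<tau>: "0 < \<tau>" "\<tau> \<le> \<sigma>"
  shows "(\<integral>p. w p * hkernel \<sigma> p \<partial>lborel) = (\<integral>p. w p * hkernel \<tau> p \<partial>lborel)"
proof -
  \<comment> \<open>The rescaling \<open>fsol (t / s\<^sup>2) / s\<close> is the one that leaves
    \<open>- t powr (-1/2)\<close> unchanged.\<close>
  have scale: "((\<lambda>t. fsol (t / s\<^sup>2) / s) has_real_derivative fsol' (t / s\<^sup>2) / s ^ 3) (at t)"
    "((\<lambda>t. fsol' (t / s\<^sup>2) / s ^ 3) has_real_derivative fsol'' (t / s\<^sup>2) / s ^ 5) (at t)"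
    if "0 < s" for s t
  proof -
    have d: "((\<lambda>t. t / s\<^sup>2) has_real_derivative 1 / s\<^sup>2) (at t)"
      by (rule DERIV_cdivide[OF DERIV_ident])
    show "((\<lambda>t. fsol (t / s\<^sup>2) / s) has_real_derivative fsol' (t / s\<^sup>2) / s ^ 3) (at t)"
      by (rule DERIV_cong[OF DERIV_cdivide[OF DERIV_chain2[OF DERIV_fsol d]]])
        (use that in \<open>simp add: field_simps eval_nat_numeral\<close>)
    show "((\<lambda>t. fsol' (t / s\<^sup>2) / s ^ 3) has_real_derivative fsol'' (t / s\<^sup>2) / s ^ 5) (at t)"
      by (rule DERIV_cong[OF DERIV_cdivide[OF DERIV_chain2[OF DERIV_fsol' d]]])
        (use that in \<open>simp add: field_simps eval_nat_numeral\<close>)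
  qed
  have cont: "continuous_on UNIV (\<lambda>t. fsol'' (t / s\<^sup>2) / s ^ 5)" if "0 < s" for s
    using that by (intro continuous_intros continuous_on_compose2[OF continuous_on_fsol'']) auto
  have "\<exists>\<phi>' \<phi>''. C2_data UNIV (\<lambda>p. fsol (kor4 p / \<sigma>\<^sup>2) / \<sigma> - fsol (kor4 p / \<tau>\<^sup>2) / \<tau>) \<phi>' \<phi>'' \<and>
     (\<forall>p. hlap (\<phi>'' p) p = 8 * hor2 p * (2 * kor4 p * (fsol'' (kor4 p / \<sigma>\<^sup>2) / \<sigma> ^ 5 - fsol'' (kor4 p / \<tau>\<^sup>2) / \<tau> ^ 5)
       + 3 * (fsol' (kor4 p / \<sigma>\<^sup>2) / \<sigma> ^ 3 - fsol' (kor4 p / \<tau>\<^sup>2) / \<tau> ^ 3)))"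
    by (rule radial_C2_data[OF DERIV_diff[OF scale(1)[OF \<sigma>(1)] scale(1)[OF \<tau>(1)]]
        DERIV_diff[OF scale(2)[OF \<sigma>(1)] scale(2)[OF \<tau>(1)]] continuous_on_diff[OF cont[OF \<sigma>(1)] cont[OF \<tau>(1)]]]) blast
  then obtain \<phi>' \<phi>'' where \<phi>: "C2_data UNIV (\<lambda>p. fsol (kor4 p / \<sigma>\<^sup>2) / \<sigma> - fsol (kor4 p / \<tau>\<^sup>2) / \<tau>) \<phi>' \<phi>''"
     "\<forall>p. hlap (\<phi>'' p) p = 8 * hor2 p * (2 * kor4 p * (fsol'' (kor4 p / \<sigma>\<^sup>2) / \<sigma> ^ 5 - fsol'' (kor4 p / \<tau>\<^sup>2) / \<tau> ^ 5)
       + 3 * (fsol' (kor4 p / \<sigma>\<^sup>2) / \<sigma> ^ 3 - fsol' (kor4 p / \<tau>\<^sup>2) / \<tau> ^ 3))"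
    by blast
  have far: "fsol (kor4 p / s\<^sup>2) / s = - inverse (sqrt (kor4 p))" if "0 < s" "s\<^sup>2 < kor4 p" for s p
    using that by (simp add: fsol_def real_sqrt_divide inverse_eq_divide)
  have supp: "fsol (kor4 p / \<sigma>\<^sup>2) / \<sigma> - fsol (kor4 p / \<tau>\<^sup>2) / \<tau> = 0" if "3 * sqrt \<sigma> < norm p" for p
  proof -
    have "\<sigma>\<^sup>2 < kor4 p" using norm_le_of_kor4[of p \<sigma>] \<sigma> that by linarith
    moreover have "\<tau>\<^sup>2 \<le> \<sigma>\<^sup>2" using \<tau> by (intro power_mono) auto
    ultimately show ?thesis using far[OF \<sigma>(1)] far[OF \<tau>(1)] by simp
  qed
  have kern: "8 * hor2 p * (2 * kor4 p * (fsol'' (kor4 p / s\<^sup>2) / s ^ 5) + 3 * (fsol' (kor4 p / s\<^sup>2) / s ^ 3)) =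
     315 / 4 * hkernel s p" if "0 < s" for s p
  proof -
    have "2 * kor4 p * (fsol'' (kor4 p / s\<^sup>2) / s ^ 5) + 3 * (fsol' (kor4 p / s\<^sup>2) / s ^ 3) =
       (2 * (kor4 p / s\<^sup>2) * fsol'' (kor4 p / s\<^sup>2) + 3 * fsol' (kor4 p / s\<^sup>2)) / s ^ 3"
      by (simp add: add_divide_distrib flip: power_add)
    also have "\<dots> = 315 / 32 * max 0 (1 - kor4 p / s\<^sup>2) ^ 3 / s ^ 3" by (simp only: fsol_ode)
    finally show ?thesis by (simp add: hkernel_def)
  qed
  have hl: "hlap (\<phi>'' p) p = 315 / 4 * (hkernel \<sigma> p - hkernel \<tau> p)" for p
    unfolding right_diff_distrib kern[OF \<sigma>(1), symmetric] kern[OF \<tau>(1), symmetric] \<phi>(2)[rule_format]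
    by (simp add: algebra_simps)
  have \<tau>1: "\<tau> \<le> 1" using \<sigma>(2) \<tau>(2) by simp
  have i: "integrable lborel (\<lambda>p. w p * hkernel \<sigma> p)" "integrable lborel (\<lambda>p. w p * hkernel \<tau> p)"
    using integrable_mult_bounded[OF w(2,3)] integrable_hkernel \<sigma>(1,2) \<tau>(1) \<tau>1 by blast+
  have "0 = (\<integral>p. w p * hlap (\<phi>'' p) p \<partial>lborel)"
    using asymp_harmonic_weak[OF w(1,2) \<phi>(1) supp _ \<sigma>(3)] \<sigma>(1) by simp
  also have "\<dots> = (\<integral>p. 315 / 4 * (w p * hkernel \<sigma> p - w p * hkernel \<tau> p) \<partial>lborel)"
    by (simp add: hl algebra_simps)
  also have "\<dots> = 315 / 4 * ((\<integral>p. w p * hkernel \<sigma> p \<partial>lborel) - (\<integral>p. w p * hkernel \<tau> p \<partial>lborel))"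
    using i by simp
  finally show ?thesis by simp
qed

definition hmass :: real where
  "hmass = (\<integral>p. hkernel 1 p \<partial>lborel)"

text \<open>Constants satisfy the mean value property, so scale invariance of the mass is a case of
  \<open>kernel_average_independent\<close>; the radius 4 exceeds the support radius 3 at scale
  1.\<close>

lemma integral_hkernel:
  assumes "0 < \<sigma>" "\<sigma> \<le> 1"
  shows "(\<integral>p. hkernel \<sigma> p \<partial>lborel) = hmass"
  using kernel_average_independent[OF asymp_harmonic_const[of 4 1], of 1 1 \<sigma>] assms by (simp add: hmass_def)

lemma hmass_pos: "0 < hmass"
  unfolding hmass_def
proof (rule integral_pos_continuous[of _ "(1/2, 0, 0)"])
  show "0 < hkernel 1 (1 / 2, 0, 0)" by (simp add: hkernel_def hor2_def kor4_def power2_eq_square)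
qed (simp_all add: continuous_on_hkernel integrable_hkernel hkernel_nonneg)

lemma kernel_mean_value:
  assumes w: "asymp_harmonic T w" "w \<in> borel_measurable borel" "\<And>p. \<bar>w p\<bar> \<le> B" "isCont w 0"
    and \<sigma>: "0 < \<sigma>" "\<sigma> \<le> 1" "3 * sqrt \<sigma> < T"
  shows "(\<integral>p. w p * hkernel \<sigma> p \<partial>lborel) = w 0 * hmass"
proof -
  have "\<bar>(\<integral>p. w p * hkernel \<sigma> p \<partial>lborel) - w 0 * hmass\<bar> \<le> 0 + \<eta>" if "0 < \<eta>" for \<eta>
  proof -
    have "0 < \<eta> / hmass" using that hmass_pos by simp
    then obtain d where d: "0 < d" "\<And>p. norm p < d \<Longrightarrow> \<bar>w p - w 0\<bar> < \<eta> / hmass"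
      using w(4) unfolding continuous_at_eps_delta dist_norm real_norm_def diff_0_right by metis
    \<comment> \<open>Makes \<open>3 * sqrt \<tau> \<le> d / 2\<close>, so the kernel at scale
      \<open>\<tau>\<close> sees only points where \<open>w\<close> is close to
      \<open>w 0\<close>.\<close>
    define \<tau> where "\<tau> = min \<sigma> ((d / 6)\<^sup>2)"
    have \<tau>: "0 < \<tau>" "\<tau> \<le> \<sigma>" using \<sigma>(1) d(1) by (simp_all add: \<tau>_def)
    have "sqrt \<tau> \<le> d / 6" using d(1) real_sqrt_le_mono[of \<tau> "(d / 6)\<^sup>2"] by (simp add: \<tau>_def)
    then have \<tau>d: "3 * sqrt \<tau> < d" using d(1) by simp
    have \<tau>1: "\<tau> \<le> 1" using \<sigma>(2) \<tau>(2) by simp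
    note i\<tau> = integrable_hkernel[OF \<tau>(1) \<tau>1]
    have i: "integrable lborel (\<lambda>p. w p * hkernel \<tau> p)" by (rule integrable_mult_bounded[OF w(2,3) i\<tau>])
    have "(\<integral>p. w p * hkernel \<sigma> p \<partial>lborel) - w 0 * hmass = (\<integral>p. w p * hkernel \<tau> p \<partial>lborel) - w 0 * (\<integral>p. hkernel \<tau> p \<partial>lborel)"
      using kernel_average_independent[OF w(1,2,3) \<sigma> \<tau>] integral_hkernel[OF \<tau>(1) \<tau>1] by simp
    also have "\<dots> = (\<integral>p. (w p - w 0) * hkernel \<tau> p \<partial>lborel)"
      using i i\<tau> by (simp add: left_diff_distrib)
    also have "\<bar>\<dots>\<bar> \<le> (\<integral>p. \<bar>(w p - w 0) * hkernel \<tau> p\<bar> \<partial>lborel)" by (rule integral_abs_bound)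
    also have "\<dots> \<le> (\<integral>p. \<eta> / hmass * hkernel \<tau> p \<partial>lborel)"
    proof (rule integral_mono)
      show "integrable lborel (\<lambda>p. \<bar>(w p - w 0) * hkernel \<tau> p\<bar>)"
        using i i\<tau> by (auto simp: left_diff_distrib)
      show "\<bar>(w p - w 0) * hkernel \<tau> p\<bar> \<le> \<eta> / hmass * hkernel \<tau> p" for p
      proof (cases "norm p < d")
        case True
        have "\<bar>(w p - w 0) * hkernel \<tau> p\<bar> = \<bar>w p - w 0\<bar> * hkernel \<tau> p"
          using hkernel_nonneg[OF \<tau>(1)] by (simp add: abs_mult)
        also have "\<dots> \<le> \<eta> / hmass * hkernel \<tau> p"
          by (intro mult_right_mono less_imp_le[OF d(2)[OF True]] hkernel_nonneg \<tau>(1))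
        finally show ?thesis .
      next
        case False
        then have "hkernel \<tau> p = 0" using hkernel_support[OF \<tau>(1) \<tau>1, of p] \<tau>d by simp
        then show ?thesis by simp
      qed
    qed (use i\<tau> in simp)
    also have "\<dots> = \<eta>" using integral_hkernel[OF \<tau>(1) \<tau>1] hmass_pos by simp
    finally show ?thesis by simp
  qed
  then have "\<bar>(\<integral>p. w p * hkernel \<sigma> p \<partial>lborel) - w 0 * hmass\<bar> \<le> 0" by (rule field_le_epsilon)
  then show ?thesis by simp
qed

text \<open>Two derivatives of the truncated cube leave a truncated linear function, which is still
  continuous. Composition with the polynomial \<open>kor4\<close> and multiplication by
  \<open>hor2\<close> preserve this.\<close>

lemma C2_param_hkernel:
  assumes "0 < \<sigma>"
  obtains K' K'' where "C2_param (\<lambda>q p. hkernel \<sigma> (hinv q \<star> p)) K' K''"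
proof -
  have d1: "((\<lambda>t. max 0 (1 - t / \<sigma>\<^sup>2) ^ 3 / \<sigma> ^ 3) has_real_derivative (3 * (max 0 (1 - t / \<sigma>\<^sup>2))\<^sup>2 * (- 1 / \<sigma>\<^sup>2) / \<sigma> ^ 3)) (at t)"
    and d2: "((\<lambda>t. 3 * (max 0 (1 - t / \<sigma>\<^sup>2))\<^sup>2 * (- 1 / \<sigma>\<^sup>2) / \<sigma> ^ 3) has_real_derivative
        3 * (2 * max 0 (1 - t / \<sigma>\<^sup>2) * (- 1 / \<sigma>\<^sup>2)) * (- 1 / \<sigma>\<^sup>2) / \<sigma> ^ 3) (at t)" for t
  proof -
    have l: "((\<lambda>t. 1 - t / \<sigma>\<^sup>2) has_real_derivative - 1 / \<sigma>\<^sup>2) (at t)"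
      by (rule DERIV_cong[OF DERIV_diff[OF DERIV_const DERIV_cdivide[OF DERIV_ident]]]) simp
    have 3: "((\<lambda>t. max 0 (1 - t / \<sigma>\<^sup>2) ^ 3) has_real_derivative 3 * (max 0 (1 - t / \<sigma>\<^sup>2))\<^sup>2 * (- 1 / \<sigma>\<^sup>2)) (at t)"
      using DERIV_chain2[OF DERIV_max0_power[of 1] l] by (simp add: numeral_3_eq_3 numeral_2_eq_2)
    have 2: "((\<lambda>t. (max 0 (1 - t / \<sigma>\<^sup>2))\<^sup>2) has_real_derivative 2 * max 0 (1 - t / \<sigma>\<^sup>2) * (- 1 / \<sigma>\<^sup>2)) (at t)"
      using DERIV_chain2[OF DERIV_max0_power[of 0] l] by (simp add: numeral_2_eq_2)
    show "((\<lambda>t. max 0 (1 - t / \<sigma>\<^sup>2) ^ 3 / \<sigma> ^ 3) has_real_derivative (3 * (max 0 (1 - t / \<sigma>\<^sup>2))\<^sup>2 * (- 1 / \<sigma>\<^sup>2) / \<sigma> ^ 3)) (at t)"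
      by (rule DERIV_cdivide[OF 3])
    show "((\<lambda>t. 3 * (max 0 (1 - t / \<sigma>\<^sup>2))\<^sup>2 * (- 1 / \<sigma>\<^sup>2) / \<sigma> ^ 3) has_real_derivative
        3 * (2 * max 0 (1 - t / \<sigma>\<^sup>2) * (- 1 / \<sigma>\<^sup>2)) * (- 1 / \<sigma>\<^sup>2) / \<sigma> ^ 3) (at t)"
      by (rule DERIV_cdivide[OF DERIV_cmult_right[OF DERIV_cmult[OF 2]]])
  qed
  have d3: "continuous_on UNIV (\<lambda>t. 3 * (2 * max 0 (1 - t / \<sigma>\<^sup>2) * (- 1 / \<sigma>\<^sup>2)) * (- 1 / \<sigma>\<^sup>2) / \<sigma> ^ 3)"
    using assms by (intro continuous_intros) auto
  obtain f' f'' g' g'' where f: "C2_param (\<lambda>q p. hor2 (hinv q \<star> p)) f' f''" and g: "C2_param (\<lambda>q p. kor4 (hinv q \<star> p)) g' g''"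
    using C2_param_left_translate by blast
  have "hkernel \<sigma> p = hor2 p * (max 0 (1 - kor4 p / \<sigma>\<^sup>2) ^ 3 / \<sigma> ^ 3)" for p by (simp add: hkernel_def)
  with C2_param_mult[OF f C2_param_compose[OF g d1 d2 d3]] show thesis
    using that by simp
qed

text \<open>Differentiating twice under the integral sign puts all derivatives on the kernel, so
  continuity of \<open>u\<close> suffices.\<close>

lemma C2_on_integral_param:
  fixes u :: "heis \<Rightarrow> real"
  assumes K: "C2_param K K' K''" and u: "continuous_on (cbox a b) u" and U: "open U" "convex U"
  shows "C2_on U (\<lambda>q. integral (cbox a b) (\<lambda>p. u p * K q p))"
proof -
  have d1: "((\<lambda>q. K q p) has_derivative blinfun_apply (K' q p)) (at q)"
    and d2: "((\<lambda>q. K' q p) has_derivative blinfun_apply (K'' q p)) (at q)" for q p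
    using K unfolding C2_param_def by blast+
  have c: "continuous_on UNIV (\<lambda>x. K (fst x) (snd x))" "continuous_on UNIV (\<lambda>x. K' (fst x) (snd x))"
    "continuous_on UNIV (\<lambda>x. K'' (fst x) (snd x))"
    using K unfolding C2_param_def by blast+
  have us: "continuous_on (U \<times> cbox a b) (\<lambda>x. u (snd x))"
    by (intro continuous_on_compose2[OF u] continuous_intros) auto
  have c0: "continuous_on (cbox a b) (\<lambda>p. u p * K q p)" for q
    using continuous_on_compose2[OF c(1), of "cbox a b" "\<lambda>p. (q, p)"]
    by (intro continuous_intros u) (simp add: continuous_intros)
  have c1: "continuous_on (U \<times> cbox a b) (\<lambda>(q, p). u p *\<^sub>R K' q p)"
    and c2: "continuous_on (U \<times> cbox a b) (\<lambda>(q, p). u p *\<^sub>R K'' q p)"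
    unfolding case_prod_beta'
    by (intro continuous_intros us continuous_on_subset[OF c(2)] continuous_on_subset[OF c(3)] subset_UNIV)+
  have c1': "continuous_on (cbox a b) (\<lambda>p. u p *\<^sub>R K' q p)" for q
    using continuous_on_compose2[OF c(2), of "cbox a b" "\<lambda>p. (q, p)"]
    by (intro continuous_intros u) (simp add: continuous_intros)
  have 1: "((\<lambda>q. integral (cbox a b) (\<lambda>p. u p * K q p)) has_derivative
       blinfun_apply (integral (cbox a b) (\<lambda>p. u p *\<^sub>R K' q p))) (at q)" if "q \<in> U" for q
  proof -
    have "((\<lambda>q. integral (cbox a b) (\<lambda>p. u p * K q p)) has_derivative
       blinfun_apply (integral (cbox a b) (\<lambda>p. u p *\<^sub>R K' q p))) (at q within U)"
    proof (rule leibniz_rule[OF _ _ c1 that U(2)])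
      show "((\<lambda>q. u p * K q p) has_derivative blinfun_apply (u p *\<^sub>R K' q p)) (at q within U)" for q p
        by (rule has_derivative_eq_rhs[OF has_derivative_mult_right[OF has_derivative_at_withinI[OF d1]]])
          (rule ext, simp add: blinfun.scaleR_left)
    qed (rule integrable_continuous[OF c0])
    then show ?thesis unfolding at_within_open[OF that U(1)] .
  qed
  have 2: "((\<lambda>q. integral (cbox a b) (\<lambda>p. u p *\<^sub>R K' q p)) has_derivative
       blinfun_apply (integral (cbox a b) (\<lambda>p. u p *\<^sub>R K'' q p))) (at q)" if "q \<in> U" for q
  proof -
    have "((\<lambda>q. integral (cbox a b) (\<lambda>p. u p *\<^sub>R K' q p)) has_derivative
       blinfun_apply (integral (cbox a b) (\<lambda>p. u p *\<^sub>R K'' q p))) (at q within U)"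
    proof (rule leibniz_rule[OF _ _ c2 that U(2)])
      show "((\<lambda>q. u p *\<^sub>R K' q p) has_derivative blinfun_apply (u p *\<^sub>R K'' q p)) (at q within U)" for q p
        by (rule has_derivative_eq_rhs[OF has_derivative_scaleR_right[OF has_derivative_at_withinI[OF d2]]])
          (rule ext, simp add: blinfun.scaleR_left)
    qed (rule integrable_continuous[OF c1'])
    then show ?thesis unfolding at_within_open[OF that U(1)] .
  qed
  have "continuous_on U (\<lambda>q. integral (cbox a b) (\<lambda>p. u p *\<^sub>R K'' q p))"
    by (rule integral_continuous_on_param[OF c2])
  with 1 2 have "C2_data U (\<lambda>q. integral (cbox a b) (\<lambda>p. u p * K q p))
      (\<lambda>q. integral (cbox a b) (\<lambda>p. u p *\<^sub>R K' q p)) (\<lambda>q. integral (cbox a b) (\<lambda>p. u p *\<^sub>R K'' q p))"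
    unfolding C2_data_def by blast
  then show ?thesis unfolding C2_on_iff_C2_data by blast
qed

lemma C2_on_cmult:
  fixes f :: "'a::real_normed_vector \<Rightarrow> real"
  assumes "C2_on S f"
  shows "C2_on S (\<lambda>x. c * f x)"
proof -
  obtain f' f'' where f: "C2_data S f f' f''" using assms by (auto simp: C2_on_iff_C2_data)
  have "((\<lambda>x. c * f x) has_derivative blinfun_apply (c *\<^sub>R f' x)) (at x)"
    "((\<lambda>x. c *\<^sub>R f' x) has_derivative blinfun_apply (c *\<^sub>R f'' x)) (at x)" if "x \<in> S" for x
  proof -
    have d: "(f has_derivative blinfun_apply (f' x)) (at x)" "(f' has_derivative blinfun_apply (f'' x)) (at x)"
      using f that unfolding C2_data_def by blast+
    show "((\<lambda>x. c * f x) has_derivative blinfun_apply (c *\<^sub>R f' x)) (at x)"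
      by (rule has_derivative_eq_rhs[OF has_derivative_mult_right[OF d(1)]]) (rule ext, simp add: blinfun.scaleR_left)
    show "((\<lambda>x. c *\<^sub>R f' x) has_derivative blinfun_apply (c *\<^sub>R f'' x)) (at x)"
      by (rule has_derivative_eq_rhs[OF has_derivative_scaleR_right[OF d(2)]]) (rule ext, simp add: blinfun.scaleR_left)
  qed
  moreover have "continuous_on S (\<lambda>x. c *\<^sub>R f'' x)"
    using f unfolding C2_data_def by (intro continuous_intros) blast
  ultimately have "C2_data S (\<lambda>x. c * f x) (\<lambda>x. c *\<^sub>R f' x) (\<lambda>x. c *\<^sub>R f'' x)"
    unfolding C2_data_def by blast
  then show ?thesis unfolding C2_on_iff_C2_data by blast
qed

subsection \<open>Limits of the walk values\<close>

context boundary_walk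
begin

context
  fixes e :: "nat \<Rightarrow> real" and u :: "heis \<Rightarrow> real"
  assumes e: "\<And>i. 0 < e i" "e \<longlonglongrightarrow> 0"
    and unif: "uniform_limit D (\<lambda>i. u_eps D F (e i)) u sequentially"
    and cont: "continuous_on (closure D) u"
begin

text \<open>The extension by zero is bounded and Borel measurable on the whole space, as the
  integrals over \<open>lborel\<close> demand, and coincides with \<open>u\<close> on the open set
  \<open>D\<close>.\<close>

definition u_ext :: "heis \<Rightarrow> real" where
  "u_ext p = indicator (closure D) p *\<^sub>R u p"

lemma borel_measurable_u_ext: "u_ext \<in> borel_measurable borel"
  unfolding u_ext_def[abs_def] by (rule borel_measurable_continuous_on_indicator[OF _ cont]) simp

lemma u_ext_eq: "p \<in> D \<Longrightarrow> u_ext p = u p"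
  using closure_subset[of D] by (auto simp: u_ext_def indicator_def)

lemma u_ext_bounded: "\<exists>B. \<forall>p. \<bar>u_ext p\<bar> \<le> B"
proof -
  have "bounded (u ` closure D)"
    using D(2) cont by (intro compact_imp_bounded compact_continuous_image) (simp_all add: compact_closure)
  then obtain B where "\<forall>x\<in>u ` closure D. norm x \<le> B" unfolding bounded_iff by blast
  then have "\<bar>u_ext p\<bar> \<le> max 0 B" for p
    by (cases "p \<in> closure D") (auto simp: u_ext_def intro: max.coboundedI2)
  then show ?thesis by blast
qed

lemma translate_in_cball:
  assumes "(1 + norm q) * T \<le> r" "norm p \<le> T"
  shows "q \<star> p \<in> cball q r"
proof -
  have "dist (q \<star> p) q \<le> (1 + norm q) * norm p" unfolding dist_norm by (rule norm_hmul_diff_left)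
  also have "\<dots> \<le> (1 + norm q) * T" using assms(2) by (intro mult_left_mono) auto
  finally show ?thesis using assms(1) by (simp add: dist_commute)
qed

lemma borel_measurable_u_ext_translate: "(\<lambda>p. u_ext (q \<star> p)) \<in> borel_measurable borel"
  by (rule measurable_compose[OF borel_measurable_hmul_const(2) borel_measurable_u_ext])

text \<open>Left translation commutes with \<open>hshift\<close>, so the mean value property of
  \<open>u_eps\<close> near \<open>q\<close> becomes one near the origin. The condition on
  \<open>T\<close> keeps \<open>q \<star> p\<close> within \<open>cball q r\<close>.\<close>

lemma asymp_harmonic_translate:
  assumes q: "cball q r \<subseteq> D" and T: "(1 + norm q) * T \<le> r"
  shows "asymp_harmonic T (\<lambda>p. u_ext (q \<star> p))"
proof -
  define v where "v i p = u_eps D F (e i) (q \<star> p)" for i p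
  have "cball q r \<inter> frontier D = {}" using q domain.frontier_disjoint by blast
  from hsetdist_pos_on_compact[OF domain.compact_frontier domain.frontier_nonempty compact_cball this]
  obtain m where m: "0 < m" "\<And>x. x \<in> cball q r \<Longrightarrow> m \<le> hsetdist x (frontier D)" by metis
  have 1: "v i \<in> borel_measurable borel" for i
    unfolding v_def[abs_def]
    by (rule measurable_compose[OF borel_measurable_hmul_const(2) borel_measurable_u_eps[OF e(1)]])
  have 2: "\<bar>v i p\<bar> \<le> bound" for i p unfolding v_def by (rule u_eps_le_bound[OF e(1)])
  have 3: "(\<lambda>i. v i p) \<longlonglongrightarrow> u_ext (q \<star> p)" if "norm p \<le> T" for p
  proof -
    have "q \<star> p \<in> D" using translate_in_cball[OF T that] q by blast
    then show ?thesis using tendsto_uniform_limitI[OF unif] by (simp add: v_def u_ext_eq)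
  qed
  have "\<forall>\<^sub>F i in sequentially. e i < m" using order_tendstoD(2)[OF e(2) m(1)] .
  then have 4: "\<forall>\<^sub>F i in sequentially. \<forall>p. norm p \<le> T \<longrightarrow> disc_avg (e i) (v i) p = v i p"
  proof eventually_elim
    case (elim i)
    have "disc_avg (e i) (v i) p = v i p" if "norm p \<le> T" for p
    proof -
      have "e i \<le> hsetdist (q \<star> p) (frontier D)"
        using m(2)[OF translate_in_cball[OF T that]] elim by simp
      from u_eps_mean_value[OF e(1) this] show ?thesis
        by (simp add: v_def disc_avg_def hshift_hmul)
    qed
    then show ?case by blast
  qed
  show ?thesis
    unfolding asymp_harmonic_def using 1 2 3 4 e by blast
qed

text \<open>The mean value formula at the origin is applied to the left translate of
  \<open>u_ext\<close>. Left invariance of Lebesgue measure then shifts the translation onto the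
  kernel, where the dependence on \<open>q\<close> can be differentiated.\<close>

lemma kernel_representation:
  assumes q: "cball q r \<subseteq> D" "0 < r" and T: "(1 + norm q) * T \<le> r"
    and \<sigma>: "0 < \<sigma>" "\<sigma> \<le> 1" "3 * sqrt \<sigma> < T"
  shows "u q * hmass = (\<integral>p. u_ext p * hkernel \<sigma> (hinv q \<star> p) \<partial>lborel)"
proof -
  obtain B where B: "\<forall>p. \<bar>u_ext p\<bar> \<le> B" using u_ext_bounded by blast
  have qD: "q \<in> D" using q by auto
  have "isCont u_ext q"
  proof -
    have "continuous_on D u_ext"
      using continuous_on_subset[OF cont closure_subset] u_ext_eq by (metis continuous_on_cong)
    then show ?thesis using qD D(1) by (simp add: continuous_on_eq_continuous_at)
  qed
  moreover have "isCont (\<lambda>p. q \<star> p) 0"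
  proof -
    have "continuous_on UNIV (\<lambda>p. q \<star> p)" by (intro continuous_intros)
    then show ?thesis unfolding continuous_on_eq_continuous_at[OF open_UNIV] by blast
  qed
  ultimately have c: "isCont (\<lambda>p. u_ext (q \<star> p)) 0"
    using isCont_o2[where f = "\<lambda>p. q \<star> p" and g = u_ext and a = 0] by simp
  have "(\<integral>p. u_ext (q \<star> p) * hkernel \<sigma> p \<partial>lborel) = u_ext (q \<star> 0) * hmass"
    by (rule kernel_mean_value[OF asymp_harmonic_translate[OF q(1) T] borel_measurable_u_ext_translate B[rule_format] c \<sigma>])
  moreover have "(\<integral>p. u_ext (q \<star> p) * hkernel \<sigma> p \<partial>lborel) = (\<integral>p. u_ext p * hkernel \<sigma> (hinv q \<star> p) \<partial>lborel)"
  proof -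
    have "(\<lambda>p. hkernel \<sigma> (hinv q \<star> p)) \<in> borel_measurable borel"
      by (rule measurable_compose[OF borel_measurable_hmul_const(2)
            borel_measurable_continuous_onI[OF continuous_on_hkernel[OF \<sigma>(1)]]])
    then have "(\<lambda>p. u_ext p * hkernel \<sigma> (hinv q \<star> p)) \<in> borel_measurable borel"
      using borel_measurable_u_ext by simp
    from lborel_integral_hmul(2)[OF this, of q] show ?thesis by simp
  qed
  ultimately show ?thesis using u_ext_eq[OF qD] by simp
qed

text \<open>One scale \<open>\<sigma>\<close> and one box must serve all \<open>q'\<close> near
  \<open>q\<close>, so that the representation becomes a parameter integral over a fixed
  domain.\<close>

lemma limit_C2_on: "C2_on D u"
proof (rule C2_on_local)
  fix q assume "q \<in> D"
  then obtain a b where ab: "q \<in> box a b" "cbox a b \<subseteq> D"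
    using open_contains_cbox[OF D(1)] by metis
  obtain d where d: "0 < d" "cball q d \<subseteq> box a b"
    using ab(1) open_box open_contains_cball by metis
  \<comment> \<open>Halving \<open>d\<close> keeps the ball of radius \<open>r\<close> about every
    \<open>q'\<close> in \<open>ball q r\<close> inside the box. \<open>R\<close> bounds the norm of
    all such \<open>q'\<close>, so that \<open>T\<close> and \<open>\<sigma>\<close> work uniformly,
    with \<open>3 * sqrt \<sigma> \<le> T / 2\<close>.\<close>
  define r where "r = d / 2"
  define R where "R = norm q + d"
  define T where "T = r / (1 + R)"
  define \<sigma> where "\<sigma> = min 1 ((T / 6)\<^sup>2)"
  have R: "0 \<le> R" and r: "0 < r" using d(1) by (simp_all add: R_def r_def)
  have T: "0 < T" using R r by (simp add: T_def)
  have \<sigma>: "0 < \<sigma>" "\<sigma> \<le> 1" using T by (simp_all add: \<sigma>_def)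
  have "sqrt \<sigma> \<le> T / 6" using T real_sqrt_le_mono[of \<sigma> "(T / 6)\<^sup>2"] by (simp add: \<sigma>_def)
  then have \<sigma>T: "3 * sqrt \<sigma> < T" using T by simp
  obtain K' K'' where K: "C2_param (\<lambda>q p. hkernel \<sigma> (hinv q \<star> p)) K' K''"
    using C2_param_hkernel[OF \<sigma>(1)] by metis
  have c: "continuous_on (cbox a b) u"
    using cont ab(2) closure_subset continuous_on_subset by blast
  have "C2_on (ball q r) (\<lambda>q'. inverse hmass * integral (cbox a b) (\<lambda>p. u p * hkernel \<sigma> (hinv q' \<star> p)))"
    by (intro C2_on_cmult C2_on_integral_param[OF K c]) simp_all
  moreover have "inverse hmass * integral (cbox a b) (\<lambda>p. u p * hkernel \<sigma> (hinv q' \<star> p)) = u q'" if "q' \<in> ball q r" for q'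
  proof -
    have q': "dist q q' < r" using that by simp
    have "cball q' r \<subseteq> cball q d"
    proof
      fix x assume "x \<in> cball q' r"
      then show "x \<in> cball q d" using q' dist_triangle[of q x q'] by (simp add: r_def)
    qed
    then have sub: "cball q' r \<subseteq> box a b" using d(2) by blast
    then have subD: "cball q' r \<subseteq> D" using ab(2) box_subset_cbox by blast
    have "norm q' \<le> norm q + dist q q'" by (metis dist_commute dist_norm norm_triangle_sub)
    then have "1 + norm q' \<le> 1 + R" using q' d(1) by (simp add: R_def r_def)
    then have "(1 + norm q') * T \<le> (1 + R) * T" using T by (intro mult_right_mono) auto
    then have Tr: "(1 + norm q') * T \<le> r" using R by (simp add: T_def)
    define f where "f p = u_ext p * hkernel \<sigma> (hinv q' \<star> p)" for p
    have f0: "f p = 0" if "p \<notin> cbox a b" for p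
    proof -
      have "T < norm (hinv q' \<star> p)"
      proof (rule ccontr)
        assume "\<not> T < norm (hinv q' \<star> p)"
        then have "q' \<star> (hinv q' \<star> p) \<in> cball q' r" by (intro translate_in_cball[OF Tr]) simp
        then show False using sub box_subset_cbox that by (metis hmul_hinv_cancel(2) subsetD)
      qed
      then show ?thesis using hkernel_support[OF \<sigma>] \<sigma>T by (simp add: f_def)
    qed
    obtain B where B: "\<forall>p. \<bar>u_ext p\<bar> \<le> B" using u_ext_bounded by blast
    have "integrable lborel f"
      unfolding f_def
    proof (rule integrable_mult_bounded[OF borel_measurable_u_ext B[rule_format]])
      show "integrable lborel (\<lambda>p. hkernel \<sigma> (hinv q' \<star> p))"
        using lborel_integral_hmul(4)[OF borel_measurable_continuous_onI[OF continuous_on_hkernel[OF \<sigma>(1)]]]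
          integrable_hkernel[OF \<sigma>] by blast
    qed
    then have f1: "(\<integral>p. f p \<partial>lborel) = integral UNIV f" by (rule integral_lborel[symmetric])
    have "f = (\<lambda>p. if p \<in> cbox a b then u p * hkernel \<sigma> (hinv q' \<star> p) else 0)"
    proof (rule ext)
      fix p
      show "f p = (if p \<in> cbox a b then u p * hkernel \<sigma> (hinv q' \<star> p) else 0)"
      proof (cases "p \<in> cbox a b")
        case True
        then have "p \<in> D" using ab(2) by blast
        then show ?thesis using True by (simp add: f_def u_ext_eq)
      qed (simp add: f0)
    qed
    then have "integral UNIV f = integral (cbox a b) (\<lambda>p. u p * hkernel \<sigma> (hinv q' \<star> p))"
      by (simp only: integral_restrict_UNIV)
    moreover have "u q' * hmass = (\<integral>p. f p \<partial>lborel)"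
      unfolding f_def by (rule kernel_representation[OF subD r Tr \<sigma> \<sigma>T])
    ultimately show ?thesis using f1 hmass_pos by (simp add: field_simps)
  qed
  ultimately have "C2_on (ball q r) u"
    unfolding C2_on_iff_C2_data using C2_data_cong_open[OF open_ball] by blast
  then show "\<exists>U. open U \<and> q \<in> U \<and> C2_on U u"
    using r by (intro exI[of _ "ball q r"]) simp
qed

text \<open>Averages are used in place of integration by parts. If \<open>hlap (u'' q) q\<close>
  were nonzero, the increments \<open>disc_avg h u - u\<close> near \<open>q\<close> would have a
  fixed sign and size at least of order \<open>h\<^sup>2\<close>. Tested against a nonnegative bump,
  this contradicts weak harmonicity.\<close>

lemma limit_harmonic:
  assumes u: "C2_data D u u' u''" and q: "q \<in> D"
  shows "hlap (u'' q) q = 0"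
proof (rule ccontr)
  define c where "c = hlap (u'' q) q"
  assume "hlap (u'' q) q \<noteq> 0"
  then have c0: "c \<noteq> 0" by (simp add: c_def)
  define s where "s = sgn c"
  have sc: "s * c = \<bar>c\<bar>" "\<bar>s\<bar> = 1" using c0 by (auto simp: s_def sgn_if)
  have E: "C2_data D u_ext u' u''" by (rule C2_data_cong_open[OF D(1) u]) (simp add: u_ext_eq)
  \<comment> \<open>With this oscillation of \<open>u''\<close> the Taylor error is at most a
    quarter of \<open>step_var * \<bar>c\<bar>\<close> times the squared scale.\<close>
  define \<omega> where "\<omega> = step_var * \<bar>c\<bar> / (2 * (2 + norm q)\<^sup>2)"
  have q2: "0 < 2 + norm q" by (simp add: add_pos_nonneg)
  have \<omega>0: "0 < \<omega>" using step_var_pos c0 q2 by (simp add: \<omega>_def)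
  have \<omega>2: "\<omega> * (2 + norm q)\<^sup>2 = step_var * \<bar>c\<bar> / 2" using q2 by (simp add: \<omega>_def)
  have cu: "continuous_on D u''" using u by (simp add: C2_data_def)
  have "isCont u'' q" using cu D(1) q by (simp add: continuous_on_eq_continuous_at)
  then obtain d1 where d1: "0 < d1" "\<And>x. dist x q < d1 \<Longrightarrow> dist (u'' x) (u'' q) < \<omega> / 2"
    using half_gt_zero[OF \<omega>0] unfolding continuous_at_eps_delta dist_norm by metis
  have "isCont (\<lambda>x. hlap (u'' x) x) q"
    using continuous_on_hlap[OF cu] D(1) q by (simp add: continuous_on_eq_continuous_at)
  moreover have "0 < \<bar>c\<bar> / 4" using c0 by simp
  ultimately obtain d2 where d2: "0 < d2" "\<And>x. dist x q < d2 \<Longrightarrow> dist (hlap (u'' x) x) c < \<bar>c\<bar> / 4"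
    unfolding continuous_at_eps_delta dist_norm c_def by metis
  obtain d3 where d3: "0 < d3" "ball q d3 \<subseteq> D" using D(1) q by (metis open_contains_ball)
  \<comment> \<open>The factor 1/3 leaves room for a point within \<open>r\<close> of
    \<open>q\<close> and a further step of length at most \<open>r\<close>. The bound 1/2 lets
    \<open>2 + norm q\<close> dominate \<open>1 + norm x\<close> for such points.\<close>
  define r where "r = min (1/2) (min d1 (min d2 d3) / 3)"
  have r: "0 < r" "r \<le> 1/2" "2 * r < d1" "2 * r < d2" "2 * r < d3"
    using d1(1) d2(1) d3(1) by (auto simp: r_def min_def)
  define T where "T = r / (1 + norm q)"
  have q1: "0 < 1 + norm q" by (simp add: add_pos_nonneg)
  have T: "0 < T" "(1 + norm q) * T \<le> r" using r(1) q1 by (simp_all add: T_def)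
  define \<sigma> where "\<sigma> = min 1 ((T / 6)\<^sup>2)"
  have \<sigma>: "0 < \<sigma>" "\<sigma> \<le> 1" using T(1) by (simp_all add: \<sigma>_def)
  have "sqrt \<sigma> \<le> T / 6" using T(1) real_sqrt_le_mono[of \<sigma> "(T / 6)\<^sup>2"] by (simp add: \<sigma>_def)
  then have \<sigma>T: "3 * sqrt \<sigma> < T" using T(1) by simp
  \<comment> \<open>A truncated cube again yields a compactly supported \<open>C\<^sup>2\<close>
    bump, now without the factor \<open>hor2\<close>, hence positive at the origin.\<close>
  define g where "g t = max 0 (\<sigma>\<^sup>2 - t) ^ 3" for t :: real
  define \<phi> where "\<phi> p = g (kor4 p)" for p
  have supp: "\<phi> p = 0" if "3 * sqrt \<sigma> < norm p" for p
    using norm_le_of_kor4[of p \<sigma>] \<sigma> that by (force simp: \<phi>_def g_def)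
  have \<phi>0: "0 \<le> \<phi> p" for p by (simp add: \<phi>_def g_def)
  have l: "((\<lambda>t. \<sigma>\<^sup>2 - t) has_real_derivative - 1) (at t)" for t by (auto intro!: derivative_eq_intros)
  have g1: "(g has_real_derivative 3 * (max 0 (\<sigma>\<^sup>2 - t))\<^sup>2 * - 1) (at t)" for t
    unfolding g_def[abs_def] using DERIV_chain2[OF DERIV_max0_power[of 1] l] by (simp add: numeral_3_eq_3 numeral_2_eq_2)
  have g2: "((\<lambda>t. 3 * (max 0 (\<sigma>\<^sup>2 - t))\<^sup>2 * - 1) has_real_derivative 6 * max 0 (\<sigma>\<^sup>2 - t)) (at t)" for t
    using DERIV_cmult[OF DERIV_chain2[OF DERIV_max0_power[of 0] l], of "- 3"] by (simp add: numeral_2_eq_2)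
  have g3: "continuous_on UNIV (\<lambda>t. 6 * max 0 (\<sigma>\<^sup>2 - t))" by (intro continuous_intros)
  have "\<exists>\<phi>' \<phi>''. C2_data UNIV (\<lambda>p. g (kor4 p)) \<phi>' \<phi>''" by (rule radial_C2_data[OF g1 g2 g3]) blast
  then obtain \<phi>' \<phi>'' where C2: "C2_data UNIV \<phi> \<phi>' \<phi>''" unfolding \<phi>_def[abs_def] by blast
  define W where "W p = u_ext (q \<star> p)" for p
  have mW: "W \<in> borel_measurable borel" unfolding W_def[abs_def] by (rule borel_measurable_u_ext_translate)
  obtain B where B: "\<forall>p. \<bar>u_ext p\<bar> \<le> B" using u_ext_bounded by blast
  have BW: "\<bar>W p\<bar> \<le> B" for p unfolding W_def using B by blast
  have "cball q r \<subseteq> D"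
  proof
    fix x assume "x \<in> cball q r"
    then have "x \<in> ball q d3" using r by simp
    then show "x \<in> D" using d3(2) by blast
  qed
  then have "asymp_harmonic T W" unfolding W_def[abs_def] using T(2) by (rule asymp_harmonic_translate)
  from asymp_harmonic_weak[OF this mW C2 supp _ \<sigma>T]
  have weak: "(\<integral>p. W p * hlap (\<phi>'' p) p \<partial>lborel) = 0" using \<sigma>(1) by simp
  define h where "h i = inverse (real (Suc i))" for i
  have h: "\<And>i. 0 < h i" "h \<longlonglongrightarrow> 0" unfolding h_def[abs_def] using LIMSEQ_inverse_real_of_nat by simp_all
  \<comment> \<open>Applying \<open>weak_laplacian\<close> to the constant sequence \<open>W\<close>
    turns the vanishing weak Laplacian into a statement about averages of \<open>W\<close>
    itself.\<close>
  have lim: "(\<lambda>i. (\<integral>p. \<phi> p * (disc_avg (h i) W p - W p) \<partial>lborel) / (h i)\<^sup>2) \<longlonglongrightarrow> 0"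
    using weak_laplacian[OF C2 supp _ \<sigma>T, where v = "\<lambda>_. W" and M = B and e = h and w = W] mW BW h \<sigma>(1)
    by (simp add: weak)
  have i\<phi>: "integrable lborel \<phi>"
    by (rule integrable_continuous_support[OF C2_data_continuous_on[OF C2] supp])
  have pos: "0 < (\<integral>p. \<phi> p \<partial>lborel)"
    by (rule integral_pos_continuous[OF C2_data_continuous_on[OF C2] i\<phi> \<phi>0, of 0])
      (use \<sigma>(1) in \<open>simp add: \<phi>_def g_def kor4_def hor2_def\<close>)
  \<comment> \<open>In this unit the main term is at least
    \<open>3 * \<kappa> * (h i)\<^sup>2\<close> and the Taylor error at most
    \<open>2 * \<kappa> * (h i)\<^sup>2\<close>.\<close>
  define \<kappa> where "\<kappa> = step_var * \<bar>c\<bar> / 8"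
  have \<kappa>: "0 < \<kappa>" using step_var_pos c0 by (simp add: \<kappa>_def)
  have low: "\<kappa> * (h i)\<^sup>2 \<le> s * (disc_avg (h i) W p - W p)" if p: "norm p \<le> T" and hi: "h i < r / (2 + norm q)" for p i
  proof -
    define x where "x = q \<star> p"
    have xq: "dist x q \<le> r" using translate_in_cball[OF T(2) p] by (simp add: x_def dist_commute)
    have "norm x \<le> norm q + dist x q" by (metis dist_norm norm_triangle_sub)
    then have xn: "1 + norm x \<le> 2 + norm q" using xq r(2) by simp
    have "h i * (2 + norm q) < r" using hi q2 by (simp only: pos_less_divide_eq)
    then have hx: "(1 + norm x) * h i \<le> r"
      using mult_right_mono[OF xn less_imp_le[OF h(1)[of i]]] by (simp add: mult.commute)
    have "y \<in> D \<and> norm (u'' y - u'' x) \<le> \<omega>" if "dist y x \<le> (1 + norm x) * h i" for y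
    proof -
      have yq: "dist y q \<le> 2 * r" using that hx xq dist_triangle[of y q x] by linarith
      then have "y \<in> ball q d3" using r by (simp add: dist_commute)
      moreover have "dist (u'' y) (u'' q) < \<omega> / 2" "dist (u'' x) (u'' q) < \<omega> / 2"
        using d1(2) yq xq r by auto
      then have "dist (u'' y) (u'' x) \<le> \<omega>" using dist_triangle_half_l[of "u'' y" "u'' q" \<omega> "u'' x"]
        by (simp add: dist_commute)
      ultimately show ?thesis using d3(2) by (auto simp: dist_norm)
    qed
    from disc_avg_taylor[OF E borel_measurable_u_ext less_imp_le[OF h(1)] this]
    have t: "\<bar>disc_avg (h i) u_ext x - u_ext x - (h i)\<^sup>2 * step_var * hlap (u'' x) x / 2\<bar> \<le> (h i)\<^sup>2 * \<omega> * (1 + norm x)\<^sup>2 / 2"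
      by blast
    have "\<omega> * (1 + norm x)\<^sup>2 \<le> \<omega> * (2 + norm q)\<^sup>2"
      using xn \<omega>0 by (intro mult_left_mono power_mono) auto
    then have "(h i)\<^sup>2 / 2 * (\<omega> * (1 + norm x)\<^sup>2) \<le> (h i)\<^sup>2 / 2 * (step_var * \<bar>c\<bar> / 2)"
      unfolding \<omega>2 by (intro mult_left_mono) auto
    moreover have "(h i)\<^sup>2 * \<omega> * (1 + norm x)\<^sup>2 / 2 = (h i)\<^sup>2 / 2 * (\<omega> * (1 + norm x)\<^sup>2)" by simp
    moreover have "(h i)\<^sup>2 / 2 * (step_var * \<bar>c\<bar> / 2) = (h i)\<^sup>2 * (2 * \<kappa>)" by (simp add: \<kappa>_def)
    ultimately have t2: "\<bar>disc_avg (h i) u_ext x - u_ext x - (h i)\<^sup>2 * step_var * hlap (u'' x) x / 2\<bar> \<le> (h i)\<^sup>2 * (2 * \<kappa>)"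
      using t by linarith
    have "\<bar>hlap (u'' x) x - c\<bar> < \<bar>c\<bar> / 4" using d2(2)[of x] xq r by (simp add: dist_real_def)
    then have "3 / 4 * \<bar>c\<bar> \<le> s * hlap (u'' x) x"
      using c0 by (auto simp: s_def sgn_if abs_if split: if_splits)
    then have "(h i)\<^sup>2 * step_var / 2 * (3 / 4 * \<bar>c\<bar>) \<le> (h i)\<^sup>2 * step_var / 2 * (s * hlap (u'' x) x)"
      using step_var_pos by (intro mult_left_mono) auto
    then have t3: "(h i)\<^sup>2 * (3 * \<kappa>) \<le> s * ((h i)\<^sup>2 * step_var * hlap (u'' x) x / 2)"
      by (simp add: \<kappa>_def mult_ac)
    have "\<bar>s * (disc_avg (h i) u_ext x - u_ext x - (h i)\<^sup>2 * step_var * hlap (u'' x) x / 2)\<bar> \<le> (h i)\<^sup>2 * (2 * \<kappa>)"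
      using t2 sc(2) by (simp add: abs_mult)
    then have "s * ((h i)\<^sup>2 * step_var * hlap (u'' x) x / 2) - (h i)\<^sup>2 * (2 * \<kappa>) \<le> s * (disc_avg (h i) u_ext x - u_ext x)"
      unfolding right_diff_distrib by linarith
    then have "(h i)\<^sup>2 * (3 * \<kappa>) - (h i)\<^sup>2 * (2 * \<kappa>) \<le> s * (disc_avg (h i) u_ext x - u_ext x)" using t3 by linarith
    moreover have "disc_avg (h i) W p = disc_avg (h i) u_ext x" "W p = u_ext x"
      by (simp_all add: W_def x_def disc_avg_def hshift_hmul)
    ultimately show ?thesis by (simp add: algebra_simps)
  qed
  have "0 < r / (2 + norm q)" using r(1) q2 by simp
  from order_tendstoD(2)[OF h(2) this]
  have "\<forall>\<^sub>F i in sequentially. \<kappa> * (\<integral>p. \<phi> p \<partial>lborel) \<le> s * ((\<integral>p. \<phi> p * (disc_avg (h i) W p - W p) \<partial>lborel) / (h i)\<^sup>2)"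
  proof eventually_elim
    case (elim i)
    have bd: "\<bar>disc_avg (h i) W p - W p\<bar> \<le> 2 * B" for p
      using disc_avg_bound[OF mW BW, of "h i" p] BW[of p] by linarith
    have i1: "integrable lborel (\<lambda>p. (disc_avg (h i) W p - W p) * \<phi> p)"
      using borel_measurable_disc_avg[OF mW] mW by (intro integrable_mult_bounded[OF _ bd i\<phi>]) simp
    have "(\<integral>p. \<kappa> * (h i)\<^sup>2 * \<phi> p \<partial>lborel) \<le> (\<integral>p. s * ((disc_avg (h i) W p - W p) * \<phi> p) \<partial>lborel)"
    proof (rule integral_mono)
      show "\<kappa> * (h i)\<^sup>2 * \<phi> p \<le> s * ((disc_avg (h i) W p - W p) * \<phi> p)" for p
      proof (cases "norm p \<le> T")
        case True
        show ?thesis using mult_right_mono[OF low[OF True elim] \<phi>0[of p]] by (simp only: mult.assoc)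
      next
        case False
        then show ?thesis using supp[of p] \<sigma>T by simp
      qed
    qed (use i\<phi> i1 in simp_all)
    then have "\<kappa> * (h i)\<^sup>2 * (\<integral>p. \<phi> p \<partial>lborel) \<le> s * (\<integral>p. \<phi> p * (disc_avg (h i) W p - W p) \<partial>lborel)"
      by (simp add: mult.commute)
    then show ?case using h(1)[of i] by (simp add: pos_le_divide_eq mult_ac)
  qed
  moreover have "(\<lambda>i. s * ((\<integral>p. \<phi> p * (disc_avg (h i) W p - W p) \<partial>lborel) / (h i)\<^sup>2)) \<longlonglongrightarrow> s * 0"
    by (rule tendsto_mult_left[OF lim])
  ultimately have "\<kappa> * (\<integral>p. \<phi> p \<partial>lborel) \<le> s * 0"
    by (intro tendsto_lowerbound[OF _ _ sequentially_bot])
  then show False using \<kappa> pos by (simp add: mult_le_0_iff)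
qed

lemma limit_dirichlet_solution:
  assumes "\<And>p. p \<in> frontier D \<Longrightarrow> u p = F p"
  shows "dirichlet_solution D F u"
proof -
  obtain u' u'' where u: "C2_data D u u' u''" using limit_C2_on by (auto simp: C2_on_iff_C2_data)
  then have "hlaplacian u q = 0" if "q \<in> D" for q
    using hlaplacian_eq_hlap[OF D(1) that u] limit_harmonic[OF u that] by simp
  then show ?thesis
    unfolding dirichlet_solution_def using limit_C2_on cont assms by blast
qed

end

end

theorem theorem9p2:
  fixes D :: "heis set" and F :: "heis \<Rightarrow> real"
  assumes "open D" and "bounded D" and "connected D" and "walk_regular D"
    and "continuous_on (frontier D) F"
  shows "(\<forall>(e :: nat \<Rightarrow> real) (u :: heis \<Rightarrow> real).
            (\<forall>i. 0 < e i \<and> e i < 1) \<and> e \<longlonglongrightarrow> 0 \<and>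
            uniform_limit D (\<lambda>i. u_eps D F (e i)) u sequentially \<and>
            continuous_on (closure D) u \<and> (\<forall>q\<in>frontier D. u q = F q) \<longrightarrow>
            dirichlet_solution D F u) \<and>
         (\<exists>u :: heis \<Rightarrow> real. dirichlet_solution D F u \<and>
            (\<forall>v. dirichlet_solution D F v \<longrightarrow> (\<forall>q\<in>closure D. v q = u q)) \<and>
            uniform_limit D (u_eps D F) u (at_right 0))"
\<comment> \<open>The locale assumes a nonempty domain; for the empty one, whose closure and
  frontier are empty, every claim is vacuous.\<close>
proof (cases "D = {}")
  case True
  have "dirichlet_solution D F u" for u
    using True by (simp add: dirichlet_solution_def C2_on_def)
  moreover have "uniform_limit D (u_eps D F) u (at_right 0)" for u
    using True by (simp add: uniform_limit_iff)
  ultimately show ?thesis using True by auto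
next
  case False
  interpret boundary_walk D F by unfold_locales (fact assms False)+
  have part1: "dirichlet_solution D F u"
    if "\<And>i. 0 < e i" "e \<longlonglongrightarrow> 0" "uniform_limit D (\<lambda>i. u_eps D F (e i)) u sequentially"
      "continuous_on (closure D) u" "\<And>q. q \<in> frontier D \<Longrightarrow> u q = F q" for e :: "nat \<Rightarrow> real" and u
    by (rule limit_dirichlet_solution[OF that])
  have unique: "v q = u q" if "dirichlet_solution D F u" "dirichlet_solution D F v" "q \<in> closure D" for u v q
    using dirichlet_solution_le[OF assms(1,2)] that by (metis order_antisym)
  have subseq: "\<exists>k u. strict_mono (k :: nat \<Rightarrow> nat) \<and> uniform_limit D (\<lambda>i. u_eps D F (e (k i))) u sequentially \<and>
      dirichlet_solution D F u" if e: "\<And>i. 0 < e i" "e \<longlonglongrightarrow> 0" for e :: "nat \<Rightarrow> real"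
  proof -
    obtain k u where k: "strict_mono (k :: nat \<Rightarrow> nat)"
      "uniform_limit D (\<lambda>i. u_eps D F (e (k i))) u sequentially"
      "continuous_on (closure D) u" "\<And>p. p \<in> frontier D \<Longrightarrow> u p = F p"
      using convergent_subsequence[OF assms(4) e] by metis
    have "(\<lambda>i. e (k i)) \<longlonglongrightarrow> 0" using LIMSEQ_subseq_LIMSEQ[OF e(2) k(1)] by (simp add: o_def)
    from part1[OF e(1) this k(2,3,4)] k(1,2) show ?thesis by blast
  qed
  have inv: "(\<lambda>i. inverse (real (Suc i))) \<longlonglongrightarrow> 0" by (rule LIMSEQ_inverse_real_of_nat)
  \<comment> \<open>Existence of a solution comes from the walk itself, along any sequence of scales
    tending to zero.\<close>
  obtain u where u: "dirichlet_solution D F u" using subseq[OF _ inv] by auto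
  have "uniform_limit D (u_eps D F) u (at_right 0)"
    unfolding uniform_limit_iff
  proof (intro allI impI, rule ccontr)
    fix \<eta> :: real assume "0 < \<eta>"
    assume "\<not> (\<forall>\<^sub>F \<epsilon> in at_right 0. \<forall>q\<in>D. dist (u_eps D F \<epsilon> q) (u q) < \<eta>)"
    \<comment> \<open>Failure of uniform convergence would provide scales tending to zero at each of
      which \<open>u_eps\<close> is at least \<open>\<eta>\<close> away from \<open>u\<close>
      somewhere. Some subsequence converges uniformly to a solution, which uniqueness identifies
      with \<open>u\<close>.\<close>
    then have "\<exists>\<epsilon>>0. \<epsilon> < b \<and> \<not> (\<forall>q\<in>D. dist (u_eps D F \<epsilon> q) (u q) < \<eta>)" if "0 < b" for b
      using that unfolding eventually_at_right_field by blast
    then have "\<exists>\<epsilon>>0. \<epsilon> < inverse (real (Suc i)) \<and> \<not> (\<forall>q\<in>D. dist (u_eps D F \<epsilon> q) (u q) < \<eta>)" for i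
      by simp
    then obtain e where e: "\<And>i. 0 < e i" "\<And>i. e i < inverse (real (Suc i))"
      "\<And>i. \<not> (\<forall>q\<in>D. dist (u_eps D F (e i) q) (u q) < \<eta>)" by metis
    have "e \<longlonglongrightarrow> 0"
      by (rule tendsto_sandwich[OF _ _ tendsto_const inv]) (intro always_eventually allI less_imp_le e)+
    from subseq[OF e(1) this] obtain k w where k: "uniform_limit D (\<lambda>i. u_eps D F (e (k i))) w sequentially"
      and w: "dirichlet_solution D F w" by blast
    have eq: "w q = u q" if "q \<in> D" for q using unique[OF u w] that closure_subset by blast
    from k \<open>0 < \<eta>\<close> have "\<forall>\<^sub>F i in sequentially. \<forall>q\<in>D. dist (u_eps D F (e (k i)) q) (w q) < \<eta>"
      unfolding uniform_limit_iff by blast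
    then obtain i where "\<forall>q\<in>D. dist (u_eps D F (e (k i)) q) (w q) < \<eta>"
      unfolding eventually_sequentially by blast
    then show False using e(3)[of "k i"] eq by simp
  qed
  then show ?thesis using part1 u unique by blast
qed

end
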